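(* The number of ways to place $n$ unlabelled copies of a rider piece $\mathbb P$ on an $n\times n$ board so that none attacks another is $$u_{\mathbb P}(n;n)=\frac{1}{n!}\left\{n^{2n}+\sum_{i=1}^{2n}n^{2n-i}\sum_{\kappa=2}^{2i}(n)_\kappa\sum_{\nu=\lceil\kappa/2\rceil}^{\min(i,2\kappa-2)}\ \sum_{[\mathcal U_\kappa^\nu]:\,\mathcal U_\kappa^\nu\in\mathscr L(\mathscr A_{\mathbb P}^\infty)}\mu(\hat0,\mathcal U_\kappa^\nu)\,\frac{1}{|\operatorname{Aut}(\mathcal U_\kappa^\nu)|}\,\bar\gamma_{i-\nu}(\mathcal U_\kappa^\nu)\right\},$$ where the innermost sum is over the types $[\mathcal U_\kappa^\nu]$ of intersection subspaces of $\mathscr A_{\mathbb P}^\infty$ that involve exactly $\kappa$ pieces and have codimension $\nu$, and each periodic coefficient $\bar\gamma_{i-\nu}(\mathcal U_\kappa^\nu)$ is evaluated at the given $n$.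
   Context: A rider piece $\mathbb P$ is given by a nonempty finite set $\mathbf M\subset\mathbb Z^2$ of nonzero, pairwise non-parallel vectors $m=(c,d)$ with $c,d$ relatively prime (the basic moves). The $n\times n$ board is $[n]^2=\{1,\dots,n\}^2$. Two pieces at positions $z,z'\in[n]^2$ attack each other if $z'-z$ is an integer multiple (possibly zero) of some $m\in\mathbf M$. $u_{\mathbb P}(q;n)$ is the number of placements of $q$ unlabelled copies of $\mathbb P$ on $[n]^2$ with no two attacking. $\mathscr A_{\mathbb P}^\infty$ is the arrangement in the countably-infinite-dimensional space $\mathbb R^\infty$ with coordinates $z_i=(x_i,y_i)$, $i\in\mathbb Z_{>0}$, of all hyperplanes $\mathcal H_{ij}^{d/c}:\ d(x_j-x_i)=c(y_j-y_i)$, for $(c,d)\in\mathbf M$ and $\{i,j\}\subset\mathbb Z_{>0}$. $\mathscr L(\mathscr A_{\mathbb P}^\infty)$ is the set of intersections of hyperplanes of the arrangement, ordered by reverse inclusion, with Möbius function $\mu$ and bottom element $\hat0$ the whole space (empty intersection). For an intersection subspace $\mathcal U$ whose defining equations involve $\kappa$ pieces (indices $i$), let $\widetilde{\mathcal U}\subseteq\mathbb R^{2\kappa}$ be the subspace (in the coordinates of those $\kappa$ pieces) defined by the same equations, $\nu=\operatorname{codim}\mathcal U$, and $\alpha(\mathcal U;n)$ the number of integer points in $(n+1)\big((0,1)^{2\kappa}\cap\widetilde{\mathcal U}\big)$, a quasipolynomial in $n$, written $\alpha(\mathcal U;n)=\sum_{j=0}^{2\kappa-\nu}\bar\gamma_j(\mathcal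 U)\,n^{2\kappa-\nu-j}$ with each $\bar\gamma_j(\mathcal U)$ a periodic function of $n$ (and $\bar\gamma_j(\mathcal U)=0$ for $j>2\kappa-\nu$). Two subspaces are isomorphic if one becomes the other by relabelling the pieces; the type $[\mathcal U]$ is the isomorphism class; $\operatorname{Aut}(\mathcal U)$ is the group of permutations of the $\kappa$ involved pieces that preserve $\mathcal U$. $(n)_\kappa=n(n-1)\cdots(n-\kappa+1)$. *)

theory Defs
  imports "HOL-Analysis.Analysis" "HOL-Combinatorics.Permutations"
begin

section \<open>Rider pieces and nonattacking placements\<close>

definition rider :: "(int \<times> int) set \<Rightarrow> bool" where
  "rider M \<longleftrightarrow> finite M \<and> M \<noteq> {} \<and>
     (\<forall>(c, d) \<in> M. (c, d) \<noteq> (0, 0) \<and> coprime c d) \<and>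
     (\<forall>(c, d) \<in> M. \<forall>(c', d') \<in> M. (c, d) \<noteq> (c', d') \<longrightarrow> c * d' \<noteq> c' * d)"

definition board :: "nat \<Rightarrow> (int \<times> int) set" where
  "board n = {1..int n} \<times> {1..int n}"

definition attacks :: "(int \<times> int) set \<Rightarrow> int \<times> int \<Rightarrow> int \<times> int \<Rightarrow> bool" where
  "attacks M z z' \<longleftrightarrow>
     (\<exists>(c, d) \<in> M. \<exists>k. fst z' - fst z = k * c \<and> snd z' - snd z = k * d)"

text \<open>Two pieces on the same square attack each other (multiple zero), so a nonattacking placement
  of \<open>q\<close> unlabelled pieces is a set of \<open>q\<close> squares.\<close>

definition nonattacking_count :: "(int \<times> int) set \<Rightarrow> nat \<Rightarrow> nat \<Rightarrow> nat" where
  "nonattacking_count M q n =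
     card {S. S \<subseteq> board n \<and> card S = q \<and> (\<forall>z\<in>S. \<forall>z'\<in>S. z \<noteq> z' \<longrightarrow> \<not> attacks M z z')}"

section \<open>The arrangement and its intersection subspaces\<close>

text \<open>A configuration \<open>z\<close> assigns to each piece \<open>i\<close> the point \<open>z i = (x\<^sub>i, y\<^sub>i)\<close>. The ambient space
  consists of the finitely supported configurations, which makes its dimension countable; the
  pieces are numbered from 1 and the dummy index 0 carries no coordinate.\<close>

type_synonym config = "nat \<Rightarrow> real \<times> real"

definition Rinf :: "config set" where
  "Rinf = {z. z 0 = 0 \<and> finite {i. z i \<noteq> 0}}"

definition move_eqn :: "int \<times> int \<Rightarrow> nat \<Rightarrow> nat \<Rightarrow> config \<Rightarrow> bool" where
  "move_eqn m i j z \<longleftrightarrow>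
     of_int (snd m) * (fst (z j) - fst (z i)) = of_int (fst m) * (snd (z j) - snd (z i))"

definition hyp :: "int \<times> int \<Rightarrow> nat \<Rightarrow> nat \<Rightarrow> config set" where
  "hyp m i j = {z \<in> Rinf. move_eqn m i j z}"

definition arrangement :: "(int \<times> int) set \<Rightarrow> config set set" where
  "arrangement M = {hyp m i j | m i j. m \<in> M \<and> i > 0 \<and> j > 0 \<and> i \<noteq> j}"

text \<open>The intersection with \<^const>\<open>Rinf\<close> only matters for the empty family.\<close>

definition intersections :: "(int \<times> int) set \<Rightarrow> config set set" where
  "intersections M = {Rinf \<inter> \<Inter>F | F. F \<subseteq> arrangement M}"

text \<open>The Moebius function of a family of sets ordered by reverse inclusion, by its usual
  recursion; it is set to 0 on the intervals that are infinite (which do not occur below an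
  intersection of finitely many hyperplanes of the arrangement) and on incomparable pairs.\<close>

function moebius_mu :: "'a set set \<Rightarrow> 'a set \<Rightarrow> 'a set \<Rightarrow> int" where
  "moebius_mu L A B =
     (if A = B then 1
      else if B \<subset> A \<and> finite {C \<in> L. B \<subset> C \<and> C \<subseteq> A}
      then - (\<Sum>C \<in> {C \<in> L. B \<subset> C \<and> C \<subseteq> A}. moebius_mu L A C)
      else 0)"
  by auto
termination
proof (relation "Wellfounded.measure (\<lambda>(L, A, B). card {C \<in> L. B \<subset> C \<and> C \<subseteq> A})")
  show "wf (Wellfounded.measure (\<lambda>(L, A, B). card {C \<in> L. B \<subset> C \<and> C \<subseteq> A}))"
    by simp
next
  fix L :: "'a set set" and A B C
  assume fin: "B \<subset> A \<and> finite {C \<in> L. B \<subset> C \<and> C \<subseteq> A}"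
    and C: "C \<in> {C \<in> L. B \<subset> C \<and> C \<subseteq> A}"
  have "{D \<in> L. C \<subset> D \<and> D \<subseteq> A} \<subset> {D \<in> L. B \<subset> D \<and> D \<subseteq> A}"
    using C by blast
  then show "((L, A, C), (L, A, B)) \<in> Wellfounded.measure (\<lambda>(L, A, B). card {C \<in> L. B \<subset> C \<and> C \<subseteq> A})"
    using fin by (simp add: psubset_card_mono)
qed

declare moebius_mu.simps [simp del]

text \<open>The pieces involved in the equations of \<open>U\<close>. Taking all hyperplanes that contain \<open>U\<close> gives
  the same pieces as any other family with intersection \<open>U\<close>: if \<open>i\<close> occurs in an equation
  satisfied by \<open>U\<close>, then no family of equations avoiding \<open>i\<close> can define \<open>U\<close>.\<close>

definition pieces :: "(int \<times> int) set \<Rightarrow> config set \<Rightarrow> nat set" where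
  "pieces M U =
     {i. i > 0 \<and> (\<exists>m\<in>M. \<exists>j. j > 0 \<and> j \<noteq> i \<and> U \<subseteq> hyp m i j)}"

text \<open>The dimension of the quotient of \<^const>\<open>Rinf\<close> by \<open>U\<close>, as the least number of vectors that
  span \<^const>\<open>Rinf\<close> together with \<open>U\<close>. The value is unspecified for infinite codimension.\<close>

definition codim :: "config set \<Rightarrow> nat" where
  "codim U = (LEAST k. \<exists>b :: nat \<Rightarrow> config. (\<forall>l<k. b l \<in> Rinf) \<and>
     (\<forall>z\<in>Rinf. \<exists>u\<in>U. \<exists>a :: nat \<Rightarrow> real. \<forall>i. z i = u i + (\<Sum>l<k. a l *\<^sub>R b l i)))"

section \<open>Types and automorphisms\<close>

text \<open>The equations of \<open>relabel \<pi> U\<close> are those of \<open>U\<close> with each piece \<open>i\<close> renamed to \<open>\<pi> i\<close>.\<close>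

definition relabel :: "(nat \<Rightarrow> nat) \<Rightarrow> config set \<Rightarrow> config set" where
  "relabel \<pi> U = {z. z \<circ> \<pi> \<in> U}"

definition same_type :: "(config set \<times> config set) set" where
  "same_type = {(U, W). \<exists>\<pi>. \<pi> permutes {0<..} \<and> W = relabel \<pi> U}"

definition subspace_types :: "(int \<times> int) set \<Rightarrow> nat \<Rightarrow> nat \<Rightarrow> config set set set" where
  "subspace_types M \<kappa> \<nu> =
     {U \<in> intersections M. card (pieces M U) = \<kappa> \<and> codim U = \<nu>} // same_type"

definition Aut :: "(int \<times> int) set \<Rightarrow> config set \<Rightarrow> (nat \<Rightarrow> nat) set" where
  "Aut M U = {\<pi>. \<pi> permutes pieces M U \<and> relabel \<pi> U = U}"

section \<open>Counting lattice points\<close>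

text \<open>The space \<open>\<real>\<^bsup>2\<kappa>\<^esup>\<close> of the \<open>\<kappa>\<close> involved pieces is represented by the functions on \<open>pieces M U\<close>,
  extended by \<^const>\<open>undefined\<close>.\<close>

definition reduced :: "(int \<times> int) set \<Rightarrow> config set \<Rightarrow> config set" where
  "reduced M U = {w \<in> pieces M U \<rightarrow>\<^sub>E UNIV.
     \<forall>m\<in>M. \<forall>i j. i > 0 \<and> j > 0 \<and> i \<noteq> j \<and> U \<subseteq> hyp m i j \<longrightarrow> move_eqn m i j w}"

definition open_cube :: "nat set \<Rightarrow> config set" where
  "open_cube I = (I \<rightarrow>\<^sub>E {0<..<1} \<times> {0<..<1})"

definition dilate :: "nat set \<Rightarrow> real \<Rightarrow> config set \<Rightarrow> config set" where
  "dilate I t S = (\<lambda>w. \<lambda>i\<in>I. t *\<^sub>R w i) ` S"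

definition alpha :: "(int \<times> int) set \<Rightarrow> config set \<Rightarrow> nat \<Rightarrow> nat" where
  "alpha M U n =
     card {w \<in> dilate (pieces M U) (real (n + 1)) (open_cube (pieces M U) \<inter> reduced M U).
       \<forall>i\<in>pieces M U. fst (w i) \<in> \<int> \<and> snd (w i) \<in> \<int>}"

text \<open>\<open>g j n\<close> is the value at \<open>n\<close> of the periodic coefficient of \<open>n\<^bsup>D - j\<^esup>\<close>.\<close>

definition is_quasipoly_coeffs :: "(nat \<Rightarrow> real) \<Rightarrow> nat \<Rightarrow> (nat \<Rightarrow> nat \<Rightarrow> real) \<Rightarrow> bool" where
  "is_quasipoly_coeffs f D g \<longleftrightarrow>
     (\<forall>j. \<exists>p>0. \<forall>n. g j (n + p) = g j n) \<and>
     (\<forall>j>D. \<forall>n. g j n = 0) \<and>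
     (\<forall>n\<ge>1. f n = (\<Sum>j\<le>D. g j n * real n ^ (D - j)))"

text \<open>The coefficients of a quasipolynomial are uniquely determined, so the choice is immaterial.\<close>

definition gamma_bar :: "(int \<times> int) set \<Rightarrow> nat \<Rightarrow> config set \<Rightarrow> nat \<Rightarrow> real" where
  "gamma_bar M j U n =
     (SOME g. is_quasipoly_coeffs (\<lambda>n. real (alpha M U n)) (2 * card (pieces M U) - codim U) g) j n"

definition falling_factorial :: "nat \<Rightarrow> nat \<Rightarrow> real" where
  "falling_factorial n k = (\<Prod>l<k. real n - real l)"

end

theory Submission
  imports Defs
begin

text \<open>
  A labelled placement of \<open>n\<close> pieces is a point of \<open>[n]\<^bsup>2n\<^esup>\<close>, and it is nonattacking exactly when it
  avoids all hyperplanes of the arrangement that involve the labels \<open>1..n\<close>. Moebius inversion over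
  the intersection subspaces with pieces in \<open>{1..n}\<close> therefore expresses \<open>n!\<close> times the unlabelled
  count as \<open>\<Sum>U. \<mu>(U) * card (U \<inter> [n]\<^bsup>2n\<^esup>)\<close> (\<open>labelled_count_by_subspaces\<close>). If \<open>U\<close> involves \<open>\<kappa>\<close> pieces,
  the other \<open>n - \<kappa>\<close> pieces are free, so the number of points is \<open>alpha M U n * n ^ (2 * (n - \<kappa>))\<close>.

  All ingredients depend on the type of \<open>U\<close> only. The subspaces of the type of \<open>U\<close> with pieces in
  \<open>{1..n}\<close> are the images of \<open>U\<close> under the injections of its \<open>\<kappa>\<close> pieces into \<open>{1..n}\<close>, each obtained
  once for every automorphism; this gives the factor \<open>falling_factorial n \<kappa> / card (Aut M U)\<close>
  (\<open>card_subspaces_of_type\<close>). Expanding \<open>alpha M U n\<close> into its coefficients and collecting the powers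
  \<open>n ^ (2 * n - i)\<close>, where \<open>i\<close> is the sum of the codimension \<open>\<nu>\<close> and the index of the coefficient,
  yields the formula. The ranges of the sums are complete because \<open>\<kappa> \<le> 2 * \<nu>\<close> and
  \<open>\<nu> \<le> 2 * \<kappa> - 2\<close> (\<open>codim_bounds\<close>): a graph without isolated vertices yields independent equations
  for at least half of its vertices, and translations of the plane preserve every \<open>U\<close>.

  The substantial point is that \<open>alpha M U n\<close> is a quasipolynomial for all \<open>n\<close>, of degree at most
  \<open>2 * \<kappa> - \<nu>\<close>, a case of Ehrhart's theorem. Board points on \<open>U\<close> are strictly positive solutions of a
  homogeneous linear Diophantine system, the slack variables \<open>n + 1 - x\<close> included. Elliott's
  reduction compares two variables \<open>y i\<close> and \<open>y j\<close>, subtracts the smaller from the larger one, and so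
  splits the solutions into those of three simpler systems (\<open>elliott_split\<close>); it ends in systems without
  equations, whose counts are annihilated by products of forward differences
  (\<open>quasipolynomial_no_equations\<close>). Strict positivity keeps all pieces of the decomposition relatively
  open, which is why the formula is exact from \<open>n = 0\<close> on and not only for large \<open>n\<close>. The degree is
  then read off the growth: a point of \<open>U\<close> is determined by \<open>2 * \<kappa> - \<nu>\<close> of its coordinates, so
  \<open>alpha M U n \<le> (n + 1) ^ (2 * \<kappa> - \<nu>)\<close>.
\<close>

section \<open>Quasipolynomials and forward differences\<close>

definition fdiff :: "nat \<Rightarrow> (nat \<Rightarrow> real) \<Rightarrow> nat \<Rightarrow> real" where
  "fdiff h f n = f (n + h) - f n"

text \<open>A sequence is polynomial of degree below \<open>k\<close> on every residue class modulo \<open>p\<close> exactly when its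
  \<open>k\<close>-fold forward difference with step \<open>p\<close> vanishes. Taking this as the definition makes the closure
  properties below formal identities; the coefficients are only extracted at the end, in
  \<open>quasipolynomial_coeffs\<close>.\<close>

definition quasipolynomial :: "(nat \<Rightarrow> real) \<Rightarrow> bool" where
  "quasipolynomial f \<longleftrightarrow> (\<exists>p>0. \<exists>k. (fdiff p ^^ k) f = (\<lambda>_. 0))"

lemma fdiff_zero [simp]: "fdiff h (\<lambda>_. 0) = (\<lambda>_. 0)"
  by (auto simp: fdiff_def)

lemma fdiff_pow_zero [simp]: "(fdiff h ^^ k) (\<lambda>_. 0) = (\<lambda>_. 0)"
  by (induction k) auto

lemma fdiff_commute: "fdiff h (fdiff p f) = fdiff p (fdiff h f)"
  by (auto simp: fdiff_def fun_eq_iff ac_simps)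

lemma fdiff_pow_commute: "fdiff h ((fdiff p ^^ k) f) = (fdiff p ^^ k) (fdiff h f)"
  by (induction k) (auto simp: fdiff_commute[of h p])

lemma fdiff_pow_add:
  "(fdiff p ^^ k) (\<lambda>n. f n + g n) = (\<lambda>n. (fdiff p ^^ k) f n + (fdiff p ^^ k) g n)"
proof (induction k)
  case (Suc k)
  then show ?case by (auto simp: fdiff_def fun_eq_iff)
qed auto

lemma fdiff_pow_sum:
  "(fdiff p ^^ k) (\<lambda>n. \<Sum>i<m. f i n) = (\<lambda>n. \<Sum>i<(m::nat). (fdiff p ^^ k) (f i) n)"
  by (induction m) (auto simp: fdiff_pow_add)

lemma fdiff_pow_dilate:
  "(fdiff p ^^ k) (\<lambda>n. f (c * n + s)) n = (fdiff (c * p) ^^ k) f (c * n + s)"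
proof (induction k arbitrary: n)
  case (Suc k)
  then show ?case by (auto simp: fdiff_def algebra_simps)
qed auto

text \<open>A long step is a chain of short ones, so a difference with step \<open>m * p\<close> is a sum of shifts of
  the difference with step \<open>p\<close>. This is what lets periods be replaced by common multiples.\<close>

lemma fdiff_mult: "fdiff (m * p) f n = (\<Sum>i<m. fdiff p f (n + i * p))"
proof (induction m)
  case (Suc m)
  then show ?case by (simp add: fdiff_def algebra_simps)
qed (simp add: fdiff_def)

lemma fdiff_pow_eq_0_mult:
  assumes "(fdiff p ^^ k) f = (\<lambda>_. 0)"
  shows "(fdiff (m * p) ^^ k) f = (\<lambda>_. 0)"
  using assms
proof (induction k arbitrary: f)
  case (Suc k)
  have 0: "(fdiff p ^^ k) (fdiff p f) = (\<lambda>_. 0)"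
    using Suc.prems by (simp add: fdiff_pow_commute)
  have "(fdiff p ^^ k) (\<lambda>n. fdiff p f (n + s)) n = 0" for s n
    using fdiff_pow_dilate[of k p "fdiff p f" 1 s n] 0 by simp
  then have "(fdiff p ^^ k) (\<lambda>n. \<Sum>i<m. fdiff p f (n + i * p)) = (\<lambda>_. 0)"
    unfolding fdiff_pow_sum by auto
  then have "(fdiff p ^^ k) (fdiff (m * p) f) = (\<lambda>_. 0)"
    by (simp add: fdiff_mult[abs_def])
  from Suc.IH[OF this] show ?case
    by (simp add: fdiff_pow_commute)
qed auto

lemma fdiff_pow_eq_0_mono:
  assumes "(fdiff p ^^ k) f = (\<lambda>_. 0)" "k \<le> l"
  shows "(fdiff p ^^ l) f = (\<lambda>_. 0)"
proof -
  have "(fdiff p ^^ l) f = (fdiff p ^^ (l - k)) ((fdiff p ^^ k) f)"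
    using assms(2) by (metis comp_apply funpow_add le_add_diff_inverse2)
  then show ?thesis using assms(1) by simp
qed

lemma quasipolynomial_zero [simp]: "quasipolynomial (\<lambda>_. 0)"
  unfolding quasipolynomial_def by (rule exI[of _ 1]) (auto intro: exI[of _ 0])

lemma quasipolynomial_add:
  assumes "quasipolynomial f" "quasipolynomial g"
  shows "quasipolynomial (\<lambda>n. f n + g n)"
proof -
  obtain p k where p: "p > 0" "(fdiff p ^^ k) f = (\<lambda>_. 0)"
    using assms(1) by (auto simp: quasipolynomial_def)
  obtain q l where q: "q > 0" "(fdiff q ^^ l) g = (\<lambda>_. 0)"
    using assms(2) by (auto simp: quasipolynomial_def)
  have "(fdiff (q * p) ^^ (max k l)) f = (\<lambda>_. 0)"
    by (rule fdiff_pow_eq_0_mono[OF fdiff_pow_eq_0_mult[OF p(2)]]) auto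
  moreover have "(fdiff (p * q) ^^ (max k l)) g = (\<lambda>_. 0)"
    by (rule fdiff_pow_eq_0_mono[OF fdiff_pow_eq_0_mult[OF q(2)]]) auto
  ultimately have "(fdiff (p * q) ^^ (max k l)) (\<lambda>n. f n + g n) = (\<lambda>_. 0)"
    by (simp add: fdiff_pow_add mult.commute)
  then show ?thesis using p(1) q(1) unfolding quasipolynomial_def
    by (metis nat_0_less_mult_iff)
qed

text \<open>Counting sequences enter through this lemma: it is enough that the first difference with some
  step is a quasipolynomial.\<close>

lemma quasipolynomial_antidifference:
  assumes "quasipolynomial (fdiff h f)" "h > 0"
  shows "quasipolynomial f"
proof -
  obtain p k where p: "p > 0" "(fdiff p ^^ k) (fdiff h f) = (\<lambda>_. 0)"
    using assms(1) by (auto simp: quasipolynomial_def)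
  have "(fdiff (h * p) ^^ k) (fdiff h f) = (\<lambda>_. 0)"
    by (rule fdiff_pow_eq_0_mult[OF p(2)])
  then have "(fdiff h ^^ 1) ((fdiff (h * p) ^^ k) f) = (\<lambda>_. 0)"
    by (simp add: fdiff_pow_commute)
  from fdiff_pow_eq_0_mult[OF this, of p]
  have "(fdiff (h * p) ^^ Suc k) f = (\<lambda>_. 0)"
    by (simp add: mult.commute)
  then show ?thesis using p(1) assms(2) unfolding quasipolynomial_def
    by (metis nat_0_less_mult_iff)
qed

lemma quasipolynomial_dilate:
  assumes "quasipolynomial f"
  shows "quasipolynomial (\<lambda>n. f (c * n + s))"
proof -
  obtain p k where p: "p > 0" "(fdiff p ^^ k) f = (\<lambda>_. 0)"
    using assms by (auto simp: quasipolynomial_def)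
  have "(fdiff p ^^ k) (\<lambda>n. f (c * n + s)) n = 0" for n
    using fdiff_pow_dilate fdiff_pow_eq_0_mult[OF p(2)] by simp
  then show ?thesis using p(1) unfolding quasipolynomial_def by blast
qed

lemma binomial_eq_poly: "\<exists>P. \<forall>q. real (q choose j) = poly P (real q)"
proof -
  have "real (q choose j) = poly (smult (1 / fact j) (\<Prod>i<j. [:- real i, 1:])) (real q)" for q
    by (simp add: binomial_gbinomial gbinomial_prod_rev poly_prod lessThan_atLeast0)
  then show ?thesis by blast
qed

text \<open>Newton's forward difference formula, which turns vanishing differences back into a polynomial.\<close>

lemma newton_series:
  assumes "(fdiff 1 ^^ k) u = (\<lambda>_. 0)"
  shows "u q = (\<Sum>j<k. (fdiff 1 ^^ j) u 0 * real (q choose j))"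
  using assms
proof (induction k arbitrary: u q)
  case (Suc k)
  have "(fdiff 1 ^^ k) (fdiff 1 u) = (\<lambda>_. 0)"
    using Suc.prems by (simp add: fdiff_pow_commute)
  note IH = Suc.IH[OF this]
  have hockey: "(\<Sum>r<q. real (r choose j)) = real (q choose Suc j)" for j
    by (induction q) auto
  have "u q - u 0 = (\<Sum>r<q. fdiff 1 u r)"
    by (induction q) (auto simp: fdiff_def)
  also have "\<dots> = (\<Sum>j<k. (fdiff 1 ^^ j) (fdiff 1 u) 0 * (\<Sum>r<q. real (r choose j)))"
    by (subst IH, subst sum.swap) (simp add: sum_distrib_left)
  also have "\<dots> = (\<Sum>j<k. (fdiff 1 ^^ Suc j) u 0 * real (q choose Suc j))"
    by (simp add: hockey fdiff_pow_commute)
  finally show ?case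
    by (simp add: sum.lessThan_Suc_shift del: sum.lessThan_Suc)
qed auto

lemma poly_of_fdiff_eq_0:
  assumes "(fdiff 1 ^^ k) u = (\<lambda>_. 0)"
  obtains P where "\<And>q. u q = poly P (real q)"
proof -
  obtain B where B: "\<And>j q. real (q choose j) = poly (B j) (real q)"
    using binomial_eq_poly by metis
  have "u q = poly (\<Sum>j<k. smult ((fdiff 1 ^^ j) u 0) (B j)) (real q)" for q
    using newton_series[OF assms, of q] by (simp add: poly_sum B)
  then show ?thesis using that by blast
qed

text \<open>The degree of a counting quasipolynomial is read off its growth; the reductions below do not
  keep track of the number of differences that annihilate it.\<close>

lemma degree_le_of_growth:
  fixes P :: "real poly"
  assumes bound: "\<And>q::nat. \<bar>poly P (real q)\<bar> \<le> C * real (q + 1) ^ D"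
  shows "degree P \<le> D"
proof (rule ccontr)
  assume "\<not> degree P \<le> D"
  define R :: "real poly" where "R = [:1, 1:] ^ D"
  have R: "poly R (real q) = real (q + 1) ^ D" for q
    by (simp add: R_def poly_power add.commute)
  have "degree R < degree P"
    using \<open>\<not> degree P \<le> D\<close> by (simp add: R_def degree_power_eq)
  then have "((\<lambda>x. poly R x / poly P x) \<longlongrightarrow> 0) at_infinity" and "P \<noteq> 0"
    by (auto intro: poly_divide_tendsto_0_at_infinity)
  then have lim: "(\<lambda>q. poly R (real q) / poly P (real q)) \<longlonglongrightarrow> 0"
    using filterlim_compose[OF _ filterlim_real_at_infinity_sequentially] by blast
  have "eventually (\<lambda>x. poly P x \<noteq> 0) at_infinity"
    using \<open>P \<noteq> 0\<close> by (rule poly_eventually_not_zero)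
  then have nz: "eventually (\<lambda>q. poly P (real q) \<noteq> 0) sequentially"
    using filterlim_real_at_infinity_sequentially by (rule eventually_compose_filterlim)
  have "eventually (\<lambda>q. \<bar>poly R (real q) / poly P (real q)\<bar> < 1 / (\<bar>C\<bar> + 1)) sequentially"
    using tendstoD[OF lim, of "1 / (\<bar>C\<bar> + 1)"] by (simp add: add_nonneg_pos)
  with nz have "eventually (\<lambda>q. False) sequentially"
  proof eventually_elim
    case (elim q)
    define r where "r = real (q + 1) ^ D"
    have "r > 0" by (simp add: r_def)
    have "r / \<bar>poly P (real q)\<bar> < 1 / (\<bar>C\<bar> + 1)"
      using elim \<open>r > 0\<close> by (simp add: R r_def abs_divide)
    then have "r * (\<bar>C\<bar> + 1) < \<bar>poly P (real q)\<bar>"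
      using elim(1) by (simp add: field_simps)
    also have "\<dots> \<le> C * r"
      using bound[of q] by (simp add: r_def)
    also have "\<dots> \<le> r * (\<bar>C\<bar> + 1)"
      using \<open>r > 0\<close> by (simp add: mult.commute mult_left_mono)
    finally show ?case by simp
  qed
  then show False by simp
qed

text \<open>On the residue class of \<open>r\<close> the sequence is a polynomial in \<open>q\<close>, where \<open>n = p * q + r\<close>.
  Substituting \<open>q = (n - r) / p\<close> gives a polynomial in \<open>n\<close> whose coefficients depend on \<open>n mod p\<close>
  only; the growth bound holds on each class separately and bounds each degree.\<close>

lemma quasipolynomial_coeffs:
  assumes "quasipolynomial f" and bound: "\<And>n. \<bar>f n\<bar> \<le> real (n + 1) ^ D"
  obtains g where "is_quasipoly_coeffs f D g"
proof -
  obtain p k where p: "p > 0" "(fdiff p ^^ k) f = (\<lambda>_. 0)"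
    using assms(1) by (auto simp: quasipolynomial_def)
  have "\<exists>P. \<forall>q. f (p * q + r) = poly P (real q)" for r
  proof -
    have "(fdiff 1 ^^ k) (\<lambda>q. f (p * q + r)) = (\<lambda>_. 0)"
      using fdiff_pow_dilate[of k 1 f p r] p(2) by auto
    then show ?thesis using poly_of_fdiff_eq_0 by metis
  qed
  then obtain P where P: "\<And>r q. f (p * q + r) = poly (P r) (real q)"
    by metis
  have deg: "degree (P r) \<le> D" if "r < p" for r
  proof (rule degree_le_of_growth)
    fix q
    have "\<bar>poly (P r) (real q)\<bar> \<le> real (p * q + r + 1) ^ D"
      using bound[of "p * q + r"] P by simp
    also have "\<dots> \<le> real (p * (q + 1)) ^ D"
    proof (rule power_mono)
      have "p * q + r + 1 \<le> p * (q + 1)" using that by simp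
      then show "real (p * q + r + 1) \<le> real (p * (q + 1))" by (simp only: of_nat_le_iff)
    qed auto
    also have "\<dots> = real p ^ D * real (q + 1) ^ D"
      by (simp only: of_nat_mult power_mult_distrib)
    finally show "\<bar>poly (P r) (real q)\<bar> \<le> real p ^ D * real (q + 1) ^ D" .
  qed
  define Q where "Q r = pcompose (P r) [:- real r / real p, 1 / real p:]" for r
  have degQ: "degree (Q r) \<le> D" if "r < p" for r
    using deg[OF that] p(1) unfolding Q_def by (simp add: degree_pcompose)
  have Q: "f n = poly (Q (n mod p)) (real n)" for n
  proof -
    have "real n = real p * real (n div p) + real (n mod p)"
      by (metis div_mult_mod_eq mult.commute of_nat_add of_nat_mult)
    then have "- real (n mod p) / real p + real n / real p = real (n div p)"
      using p(1) by (simp add: field_simps)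
    then have "poly (Q (n mod p)) (real n) = poly (P (n mod p)) (real (n div p))"
      by (simp add: Q_def poly_pcompose)
    also have "\<dots> = f n" using P[of "n div p" "n mod p"] by simp
    finally show ?thesis by simp
  qed
  define g where "g j n = (if j \<le> D then coeff (Q (n mod p)) (D - j) else 0)" for j n
  have "f n = (\<Sum>j\<le>D. g j n * real n ^ (D - j))" for n
  proof -
    have "Q (n mod p) = (\<Sum>i\<le>D. monom (coeff (Q (n mod p)) i) i)"
      using degQ[of "n mod p"] p(1) by (simp add: poly_as_sum_of_monoms')
    from arg_cong[OF this, of "\<lambda>R. poly R (real n)"]
    have "f n = (\<Sum>i\<le>D. coeff (Q (n mod p)) i * real n ^ i)"
      using Q[of n] by (simp add: poly_sum poly_monom)
    also have "\<dots> = (\<Sum>j\<le>D. coeff (Q (n mod p)) (D - j) * real n ^ (D - j))"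
      by (rule sum.nat_diff_reindex[of _ "Suc D", simplified lessThan_Suc_atMost, symmetric, simplified])
    finally show ?thesis by (simp add: g_def)
  qed
  moreover have "g j (n + p) = g j n" for j n by (simp add: g_def)
  ultimately have "is_quasipoly_coeffs f D g"
    using p(1) unfolding is_quasipoly_coeffs_def by (auto simp: g_def)
  then show ?thesis using that by blast
qed

section \<open>Positive solutions of linear Diophantine systems\<close>

text \<open>The equations are indexed by \<open>E\<close>, the variables by \<open>I\<close>, and \<open>h\<close> grades the solutions. Strict
  positivity is essential: the cases \<open>y i > y j\<close>, \<open>y i = y j\<close>, \<open>y i < y j\<close> then lead to systems of
  the same kind.\<close>

definition positive_solutions ::
  "'e set \<Rightarrow> 'i set \<Rightarrow> ('i \<Rightarrow> 'e \<Rightarrow> int) \<Rightarrow> ('i \<Rightarrow> nat) \<Rightarrow> nat \<Rightarrow> ('i \<Rightarrow> nat) set" where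
  "positive_solutions E I a h t =
     {y \<in> I \<rightarrow>\<^sub>E {1..}. (\<forall>e\<in>E. (\<Sum>k\<in>I. int (y k) * a k e) = 0) \<and> (\<Sum>k\<in>I. y k * h k) = t}"

text \<open>The argument 0 stands for the weight 1. In weight 0 the system without variables has one solution
  and in every other weight it has none, so including weight 0 would spoil quasipolynomiality.\<close>

abbreviation solution_count ::
  "'e set \<Rightarrow> 'i set \<Rightarrow> ('i \<Rightarrow> 'e \<Rightarrow> int) \<Rightarrow> ('i \<Rightarrow> nat) \<Rightarrow> nat \<Rightarrow> real" where
  "solution_count E I a h n \<equiv> real (card (positive_solutions E I a h (Suc n)))"

lemma finite_positive_solutions:
  assumes "finite I" "\<And>k. k \<in> I \<Longrightarrow> h k > 0"
  shows "finite (positive_solutions E I a h t)"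
proof (rule finite_subset)
  show "positive_solutions E I a h t \<subseteq> I \<rightarrow>\<^sub>E {..t}"
  proof
    fix y assume y: "y \<in> positive_solutions E I a h t"
    have "y k \<le> t" if "k \<in> I" for k
    proof -
      have "y k * 1 \<le> y k * h k" using assms(2)[OF that] by (intro mult_le_mono2) simp
      also have "\<dots> \<le> (\<Sum>k\<in>I. y k * h k)"
        using assms(1) that by (intro member_le_sum) auto
      finally show ?thesis using y by (simp add: positive_solutions_def)
    qed
    then show "y \<in> I \<rightarrow>\<^sub>E {..t}" using y by (auto simp: positive_solutions_def PiE_iff)
  qed
qed (auto intro: finite_PiE assms)

lemma positive_solutions_uminus:
  "positive_solutions E I (\<lambda>k e. - a k e) h t = positive_solutions E I a h t"
  by (simp add: positive_solutions_def sum_negf)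

text \<open>The substitution \<open>y i \<mapsto> y i + y j\<close> on the variables is dual to adding column \<open>i\<close> to column \<open>j\<close>.\<close>

lemma sum_fold_coordinate:
  fixes c :: "'i \<Rightarrow> 'b :: comm_semiring_1"
  assumes "finite I" "i \<in> I" "j \<in> I" "i \<noteq> j"
  shows "(\<Sum>k\<in>I. y k * (c(j := c i + c j)) k) = (\<Sum>k\<in>I. (y(i := y i + y j)) k * c k)"
proof -
  have I: "I = insert i (insert j (I - {i, j}))" using assms by auto
  have "(\<Sum>k\<in>I - {i, j}. y k * (c(j := c i + c j)) k) = (\<Sum>k\<in>I - {i, j}. y k * c k)"
       "(\<Sum>k\<in>I - {i, j}. (y(i := y i + y j)) k * c k) = (\<Sum>k\<in>I - {i, j}. y k * c k)"
    by (auto intro!: sum.cong)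
  then show ?thesis
    using assms by (subst (1 2) I) (simp add: algebra_simps)
qed

lemma sum_merge_coordinate:
  fixes c :: "'i \<Rightarrow> 'b :: comm_semiring_1"
  assumes "finite I" "i \<in> I" "j \<in> I" "i \<noteq> j"
  shows "(\<Sum>k\<in>I - {i}. y k * (c(j := c i + c j)) k) = (\<Sum>k\<in>I. (y(i := y j)) k * c k)"
proof -
  have I: "I = insert i (insert j (I - {i, j}))" "I - {i} = insert j (I - {i, j})"
    using assms by auto
  have "(\<Sum>k\<in>I - {i, j}. y k * (c(j := c i + c j)) k) = (\<Sum>k\<in>I - {i, j}. y k * c k)"
       "(\<Sum>k\<in>I - {i, j}. (y(i := y j)) k * c k) = (\<Sum>k\<in>I - {i, j}. y k * c k)"
    by (auto intro!: sum.cong)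
  then show ?thesis
    using assms by (subst (2) I(1), subst I(2)) (simp add: algebra_simps)
qed

lemma card_solutions_greater:
  assumes "finite I" "i \<in> I" "j \<in> I" "i \<noteq> j"
  shows "card (positive_solutions E I (a(j := \<lambda>e. a i e + a j e)) (h(j := h i + h j)) t) =
         card {y \<in> positive_solutions E I a h t. y i > y j}"
proof (rule bij_betw_same_card[of "\<lambda>y. y(i := y i + y j)"], rule bij_betwI[where g = "\<lambda>y. y(i := y i - y j)"])
  have eq: "(\<Sum>k\<in>I. int (y k) * (a(j := \<lambda>e. a i e + a j e)) k e) =
            (\<Sum>k\<in>I. int ((y(i := y i + y j)) k) * a k e)" for y e
  proof -
    have "(\<Sum>k\<in>I. int (y k) * (a(j := \<lambda>e. a i e + a j e)) k e) =
          (\<Sum>k\<in>I. int (y k) * ((\<lambda>k. a k e)(j := a i e + a j e)) k)"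
      by (intro sum.cong) auto
    also have "\<dots> = (\<Sum>k\<in>I. ((\<lambda>k. int (y k))(i := int (y i) + int (y j))) k * a k e)"
      using sum_fold_coordinate[OF assms, of "\<lambda>k. int (y k)" "\<lambda>k. a k e"] .
    also have "\<dots> = (\<Sum>k\<in>I. int ((y(i := y i + y j)) k) * a k e)"
      by (intro sum.cong) auto
    finally show ?thesis .
  qed
  have ht: "(\<Sum>k\<in>I. y k * (h(j := h i + h j)) k) = (\<Sum>k\<in>I. (y(i := y i + y j)) k * h k)" for y
    using sum_fold_coordinate[OF assms, of y h] .
  show "(\<lambda>y. y(i := y i + y j)) \<in>
      positive_solutions E I (a(j := \<lambda>e. a i e + a j e)) (h(j := h i + h j)) t \<rightarrow>
      {y \<in> positive_solutions E I a h t. y i > y j}"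
    using assms(2-4) unfolding positive_solutions_def eq ht
    by (force simp: PiE_iff extensional_def)
  show "(\<lambda>y. y(i := y i - y j)) \<in> {y \<in> positive_solutions E I a h t. y i > y j} \<rightarrow>
      positive_solutions E I (a(j := \<lambda>e. a i e + a j e)) (h(j := h i + h j)) t"
  proof
    fix y assume y: "y \<in> {y \<in> positive_solutions E I a h t. y i > y j}"
    define z where "z = y(i := y i - y j)"
    have "z(i := z i + z j) = y" using y assms(4) by (auto simp: z_def)
    moreover have "z \<in> I \<rightarrow>\<^sub>E {1..}"
      using y assms(2-4) by (auto simp: z_def positive_solutions_def PiE_iff extensional_def)
    ultimately show "z \<in> positive_solutions E I (a(j := \<lambda>e. a i e + a j e)) (h(j := h i + h j)) t"
      using y unfolding positive_solutions_def eq ht by (simp del: fun_upd_apply)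
  qed
qed (use assms in \<open>auto simp: fun_eq_iff\<close>)

lemma card_solutions_equal:
  assumes "finite I" "i \<in> I" "j \<in> I" "i \<noteq> j"
  shows "card (positive_solutions E (I - {i}) (a(j := \<lambda>e. a i e + a j e)) (h(j := h i + h j)) t) =
         card {y \<in> positive_solutions E I a h t. y i = y j}"
proof (rule bij_betw_same_card[of "\<lambda>y. y(i := y j)"], rule bij_betwI[where g = "\<lambda>y. y(i := undefined)"])
  have eq: "(\<Sum>k\<in>I - {i}. int (y k) * (a(j := \<lambda>e. a i e + a j e)) k e) =
            (\<Sum>k\<in>I. int ((y(i := y j)) k) * a k e)" for y e
  proof -
    have "(\<Sum>k\<in>I - {i}. int (y k) * (a(j := \<lambda>e. a i e + a j e)) k e) =
          (\<Sum>k\<in>I - {i}. int (y k) * ((\<lambda>k. a k e)(j := a i e + a j e)) k)"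
      by (intro sum.cong) auto
    also have "\<dots> = (\<Sum>k\<in>I. ((\<lambda>k. int (y k))(i := int (y j))) k * a k e)"
      using sum_merge_coordinate[OF assms, of "\<lambda>k. int (y k)" "\<lambda>k. a k e"] .
    also have "\<dots> = (\<Sum>k\<in>I. int ((y(i := y j)) k) * a k e)"
      by (intro sum.cong) auto
    finally show ?thesis .
  qed
  have ht: "(\<Sum>k\<in>I - {i}. y k * (h(j := h i + h j)) k) = (\<Sum>k\<in>I. (y(i := y j)) k * h k)" for y
    using sum_merge_coordinate[OF assms, of y h] .
  show "(\<lambda>y. y(i := y j)) \<in>
      positive_solutions E (I - {i}) (a(j := \<lambda>e. a i e + a j e)) (h(j := h i + h j)) t \<rightarrow>
      {y \<in> positive_solutions E I a h t. y i = y j}"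
    using assms(2-4) unfolding positive_solutions_def eq ht
    by (force simp: PiE_iff extensional_def)
  show "(\<lambda>y. y(i := undefined)) \<in> {y \<in> positive_solutions E I a h t. y i = y j} \<rightarrow>
      positive_solutions E (I - {i}) (a(j := \<lambda>e. a i e + a j e)) (h(j := h i + h j)) t"
  proof
    fix y assume y: "y \<in> {y \<in> positive_solutions E I a h t. y i = y j}"
    define z where "z = y(i := undefined)"
    have "z(i := z j) = y" using y assms(4) by (auto simp: z_def fun_eq_iff)
    moreover have "z \<in> (I - {i}) \<rightarrow>\<^sub>E {1..}"
      using y assms(2-4) by (auto simp: z_def positive_solutions_def PiE_iff extensional_def)
    ultimately show "z \<in> positive_solutions E (I - {i}) (a(j := \<lambda>e. a i e + a j e)) (h(j := h i + h j)) t"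
      using y unfolding positive_solutions_def eq ht by (simp del: fun_upd_apply)
  qed
  show "(y(i := y j))(i := undefined) = y"
    if "y \<in> positive_solutions E (I - {i}) (a(j := \<lambda>e. a i e + a j e)) (h(j := h i + h j)) t" for y
    using that by (auto simp: positive_solutions_def PiE_iff extensional_def fun_eq_iff)
qed (use assms in \<open>auto simp: fun_eq_iff\<close>)

text \<open>Elliott's reduction: where \<open>y i > y j\<close>, the positive variables \<open>y i - y j\<close> and \<open>y j\<close> satisfy the
  system with column \<open>i\<close> added to column \<open>j\<close>, and symmetrically; where \<open>y i = y j\<close> the two columns
  merge. No rounding and no case of residues occurs, because the substitution is unimodular.\<close>

lemma elliott_split:
  assumes "finite I" "\<And>k. k \<in> I \<Longrightarrow> h k > 0" "i \<in> I" "j \<in> I" "i \<noteq> j"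
  shows "card (positive_solutions E I a h t) =
      card (positive_solutions E I (a(j := \<lambda>e. a i e + a j e)) (h(j := h i + h j)) t) +
      card (positive_solutions E I (a(i := \<lambda>e. a i e + a j e)) (h(i := h i + h j)) t) +
      card (positive_solutions E (I - {i}) (a(j := \<lambda>e. a i e + a j e)) (h(j := h i + h j)) t)"
proof -
  let ?S = "positive_solutions E I a h t"
  have fin: "finite ?S" using finite_positive_solutions assms(1,2) by blast
  have "?S = {y \<in> ?S. y i > y j} \<union> {y \<in> ?S. y j > y i} \<union> {y \<in> ?S. y i = y j}" by auto
  then have "card ?S = card ({y \<in> ?S. y i > y j} \<union> {y \<in> ?S. y j > y i} \<union> {y \<in> ?S. y i = y j})"
    by simp
  also have "\<dots> = card {y \<in> ?S. y i > y j} + card {y \<in> ?S. y j > y i} + card {y \<in> ?S. y i = y j}"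
    using fin by (subst card_Un_disjoint; (subst card_Un_disjoint)?; auto)
  also have "card {y \<in> ?S. y j > y i} =
      card (positive_solutions E I (a(i := \<lambda>e. a i e + a j e)) (h(i := h i + h j)) t)"
    using card_solutions_greater[OF assms(1) assms(4,3) assms(5)[symmetric], of E a h t]
    by (simp add: add.commute)
  finally show ?thesis
    using card_solutions_greater[OF assms(1,3-5), of E a h t]
      card_solutions_equal[OF assms(1,3-5), of E a h t] by simp
qed

lemma quasipolynomial_split:
  assumes "finite I" "\<And>k. k \<in> I \<Longrightarrow> h k > 0" "i \<in> I" "j \<in> I" "i \<noteq> j"
    and "quasipolynomial (solution_count E I (a(j := \<lambda>e. a i e + a j e)) (h(j := h i + h j)))"
    and "quasipolynomial (solution_count E I (a(i := \<lambda>e. a i e + a j e)) (h(i := h i + h j)))"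
    and "quasipolynomial (solution_count E (I - {i}) (a(j := \<lambda>e. a i e + a j e)) (h(j := h i + h j)))"
  shows "quasipolynomial (solution_count E I a h)"
  using quasipolynomial_add[OF quasipolynomial_add[OF assms(6,7)] assms(8)]
  by (simp add: elliott_split[OF assms(1-5)])

text \<open>Without equations this is the number of ways to write \<open>t\<close> as \<open>\<Sum>k. y k * h k\<close>. Lowering one
  \<open>y i\<close> by one pairs the solutions of weight \<open>t + h i\<close> having \<open>y i > 1\<close> with all solutions of weight
  \<open>t\<close>, and the solutions with \<open>y i = 1\<close> are those of the system without \<open>i\<close>. Hence the difference
  with step \<open>h i\<close> removes the variable \<open>i\<close>.\<close>

lemma quasipolynomial_no_equations:
  assumes "finite I" "\<And>k. k \<in> I \<Longrightarrow> h k > 0"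
  shows "quasipolynomial (solution_count {} I a h)"
  using assms
proof (induction I)
  case empty
  have "positive_solutions {} {} a h (Suc n) = {}" for n by (auto simp: positive_solutions_def)
  then show ?case by simp
next
  case (insert i I)
  let ?S = "\<lambda>t. positive_solutions {} (insert i I) a h t"
  have hi: "h i > 0" using insert.prems by simp
  have "fdiff (h i) (solution_count {} (insert i I) a h) n = solution_count {} I a h n" for n
  proof -
    let ?t = "Suc n"
    have fin: "finite (?S (?t + h i))"
      using finite_positive_solutions insert by blast
    have sum_upd: "(\<Sum>k\<in>I. (y(i := v)) k * h k) = (\<Sum>k\<in>I. y k * h k)" for y v
      using insert.hyps by (intro sum.cong) auto
    have more: "card (?S ?t) = card {y \<in> ?S (?t + h i). y i > 1}"
    proof (rule bij_betw_same_card[of "\<lambda>y. y(i := y i + 1)"], rule bij_betwI[where g = "\<lambda>y. y(i := y i - 1)"])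
      show "(\<lambda>y. y(i := y i + 1)) \<in> ?S ?t \<rightarrow> {y \<in> ?S (?t + h i). y i > 1}"
        using insert.hyps by (force simp: positive_solutions_def PiE_iff extensional_def sum_upd[unfolded fun_upd_def])
      show "(\<lambda>y. y(i := y i - 1)) \<in> {y \<in> ?S (?t + h i). y i > 1} \<rightarrow> ?S ?t"
      proof
        fix y assume y: "y \<in> {y \<in> ?S (?t + h i). y i > 1}"
        then obtain v where v: "y i = Suc v" by (cases "y i") auto
        show "y(i := y i - 1) \<in> ?S ?t"
          using y v insert.hyps
          by (auto simp: positive_solutions_def PiE_iff extensional_def sum_upd[unfolded fun_upd_def])
      qed
    qed (auto simp: fun_eq_iff)
    have one: "card (positive_solutions {} I a h ?t) = card {y \<in> ?S (?t + h i). y i = 1}"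
    proof (rule bij_betw_same_card[of "\<lambda>y. y(i := 1)"], rule bij_betwI[where g = "\<lambda>y. y(i := undefined)"])
      show "(\<lambda>y. y(i := 1)) \<in> positive_solutions {} I a h ?t \<rightarrow> {y \<in> ?S (?t + h i). y i = 1}"
        using insert.hyps by (force simp: positive_solutions_def PiE_iff extensional_def sum_upd[unfolded fun_upd_def])
      show "(\<lambda>y. y(i := undefined)) \<in> {y \<in> ?S (?t + h i). y i = 1} \<rightarrow> positive_solutions {} I a h ?t"
        using insert.hyps by (force simp: positive_solutions_def PiE_iff extensional_def sum_upd[unfolded fun_upd_def])
    qed (use insert.hyps in \<open>auto simp: positive_solutions_def PiE_iff extensional_def fun_eq_iff\<close>)
    have "?S (?t + h i) = {y \<in> ?S (?t + h i). y i > 1} \<union> {y \<in> ?S (?t + h i). y i = 1}"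
      by (force simp: positive_solutions_def PiE_iff)
    then have "card (?S (?t + h i)) = card ({y \<in> ?S (?t + h i). y i > 1} \<union> {y \<in> ?S (?t + h i). y i = 1})"
      by simp
    also have "\<dots> = card (?S ?t) + card (positive_solutions {} I a h ?t)"
      using fin unfolding more one by (subst card_Un_disjoint) auto
    finally show ?thesis by (simp add: fdiff_def)
  qed
  then have "fdiff (h i) (solution_count {} (insert i I) a h) = solution_count {} I a h" by blast
  then show ?case
    using insert hi by (metis quasipolynomial_antidifference insert_iff)
qed


lemma no_solution_if_nonneg:
  assumes "finite I" "e \<in> E" "\<And>k. k \<in> I \<Longrightarrow> a k e \<ge> 0" "i \<in> I" "a i e > 0"
  shows "positive_solutions E I a h t = {}"
proof -
  have "(\<Sum>k\<in>I. int (y k) * a k e) \<noteq> 0" if "y \<in> I \<rightarrow>\<^sub>E {1..}" for y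
  proof -
    have "y i > 0" using that assms(4) by (auto simp: PiE_iff)
    then have "0 < int (y i) * a i e" using assms(5) by simp
    also have "\<dots> \<le> (\<Sum>k\<in>I. int (y k) * a k e)"
      using assms by (intro member_le_sum) auto
    finally show ?thesis by simp
  qed
  then show ?thesis using assms(2) by (auto simp: positive_solutions_def)
qed

text \<open>Termination of Elliott's reduction for one equation. If \<open>m > 0\<close> is the largest absolute value of
  a coefficient and, after a change of sign, some coefficient is \<open>m\<close>, it is paired with a negative
  coefficient \<open>b\<close>. The sum \<open>m + b\<close> lies strictly between \<open>- m\<close> and \<open>m\<close>: if it replaces \<open>m\<close>, or
  \<open>b = - m\<close>, fewer coefficients are extremal; otherwise it replaces \<open>b\<close> and is positive, so fewer
  coefficients are negative. Without a negative coefficient there is no solution. Three nested inductions follow this order: on the bound, on the number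
  of extremal coefficients, on the number of negative ones.\<close>

lemma quasipolynomial_eliminate:
  fixes E :: "'e set" and e :: 'e
  assumes e: "e \<in> E"
    and reduce: "\<And>(I :: 'i set) a h. finite I \<Longrightarrow> (\<And>k. k \<in> I \<Longrightarrow> h k > 0) \<Longrightarrow>
      (\<And>k. k \<in> I \<Longrightarrow> a k e = 0) \<Longrightarrow> quasipolynomial (solution_count E I a h)"
    and "finite I" "\<And>k. k \<in> I \<Longrightarrow> h k > 0"
  shows "quasipolynomial (solution_count E (I :: 'i set) a h)"
proof -
  have "quasipolynomial (solution_count E I a h)"
    if "finite I" "\<And>k. k \<in> I \<Longrightarrow> h k > 0" "\<And>k. k \<in> I \<Longrightarrow> \<bar>a k e\<bar> \<le> int M"
    for M and I :: "'i set" and a h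
    using that
  proof (induction M arbitrary: I a h)
    case 0
    then show ?case by (intro reduce) auto
  next
    case (Suc M)
    let ?m = "int (Suc M)"
    from Suc.prems show ?case
    proof (induction "card {k \<in> I. \<bar>a k e\<bar> = ?m}" arbitrary: I a h rule: less_induct)
      case (less I0 a0 h0)
      note fewer_extremal = less.hyps and prems0 = less.prems
      have top: "quasipolynomial (solution_count E I b h)"
        if "finite I" "\<And>k. k \<in> I \<Longrightarrow> h k > 0" "\<And>k. k \<in> I \<Longrightarrow> \<bar>b k e\<bar> \<le> ?m"
          "card {k \<in> I. \<bar>b k e\<bar> = ?m} = card {k \<in> I0. \<bar>a0 k e\<bar> = ?m}" "i \<in> I" "b i e = ?m"
        for I :: "'i set" and b :: "'i \<Rightarrow> 'e \<Rightarrow> int" and h i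
        using that
      proof (induction "card {k \<in> I. b k e < 0}" arbitrary: b h rule: less_induct)
        case (less b h)
        note fin = less.prems(1) and pos = less.prems(2) and bd = less.prems(3)
          and cnt = less.prems(4)
        note i = less.prems(5) less.prems(6)
        show ?case
        proof (cases "\<exists>j\<in>I. b j e < 0")
          case False
          then have "positive_solutions E I b h t = {}" for t
            using no_solution_if_nonneg[OF fin e, of b i] i by force
          then show ?thesis by simp
        next
          case True
          then obtain j where j: "j \<in> I" "b j e < 0" by blast
          have ij: "i \<noteq> j" using i j by auto
          \<comment> \<open>Column \<open>i\<close> added to column \<open>j\<close>, and the reverse; merging also leaves \<open>b1\<close>, without \<open>i\<close>.\<close>
          define b1 where "b1 = b(j := \<lambda>e. b i e + b j e)"
          define b2 where "b2 = b(i := \<lambda>e. b i e + b j e)"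
          have sum_small: "\<bar>b i e + b j e\<bar> < ?m" using bd[OF j(1)] j(2) i(2) by simp
          have bd1: "\<bar>b1 k e\<bar> \<le> ?m" and bd2: "\<bar>b2 k e\<bar> \<le> ?m" if "k \<in> I" for k
            using bd[OF that] sum_small by (auto simp: b1_def b2_def)
          have fewer: "card {k \<in> J. \<bar>c k e\<bar> = ?m} < card {k \<in> I0. \<bar>a0 k e\<bar> = ?m}"
            if "{k \<in> J. \<bar>c k e\<bar> = ?m} \<subseteq> {k \<in> I. \<bar>b k e\<bar> = ?m} - {l}" "l \<in> I" "\<bar>b l e\<bar> = ?m"
            for J and c :: "'i \<Rightarrow> 'e \<Rightarrow> int" and l
            unfolding cnt[symmetric] using that fin by (intro psubset_card_mono) auto
          have "quasipolynomial (solution_count E I b1 (h(j := h i + h j)))"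
          proof (cases "b j e = - ?m")
            case True
            have "{k \<in> I. \<bar>b1 k e\<bar> = ?m} \<subseteq> {k \<in> I. \<bar>b k e\<bar> = ?m} - {j}"
              using sum_small by (auto simp: b1_def)
            from fewer[where J = I and c = b1 and l = j, OF this j(1)] True show ?thesis
              using fin pos j(1) i(1) bd1 by (intro fewer_extremal) auto
          next
            case False
            have "{k \<in> I. \<bar>b1 k e\<bar> = ?m} = {k \<in> I. \<bar>b k e\<bar> = ?m}"
              using False sum_small bd[OF j(1)] j(2) by (auto simp: b1_def)
            moreover have "{k \<in> I. b1 k e < 0} = {k \<in> I. b k e < 0} - {j}"
              using i bd[OF j(1)] by (auto simp: b1_def)
            then have "card {k \<in> I. b1 k e < 0} < card {k \<in> I. b k e < 0}"
              using j fin by (intro psubset_card_mono) auto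
            ultimately show ?thesis
              using fin pos j(1) i ij bd1 cnt
              by (intro less.hyps) (auto simp: b1_def)
          qed
          moreover have "quasipolynomial (solution_count E I b2 (h(i := h i + h j)))"
          proof -
            have "{k \<in> I. \<bar>b2 k e\<bar> = ?m} \<subseteq> {k \<in> I. \<bar>b k e\<bar> = ?m} - {i}"
              using sum_small by (auto simp: b2_def)
            from fewer[where J = I and c = b2 and l = i, OF this i(1)] i(2) show ?thesis
              using fin pos j(1) i(1) bd2 by (intro fewer_extremal) auto
          qed
          moreover have "quasipolynomial (solution_count E (I - {i}) b1 (h(j := h i + h j)))"
          proof -
            have "{k \<in> I - {i}. \<bar>b1 k e\<bar> = ?m} \<subseteq> {k \<in> I. \<bar>b k e\<bar> = ?m} - {i}"
              using sum_small by (auto simp: b1_def split: if_splits)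
            from fewer[where J = "I - {i}" and c = b1 and l = i, OF this i(1)] i(2) show ?thesis
              using fin pos j(1) i(1) bd1 by (intro fewer_extremal) auto
          qed
          ultimately show ?thesis
            using quasipolynomial_split[OF fin pos i(1) j(1) ij] by (simp add: b1_def b2_def)
        qed
      qed
      show ?case
      proof (cases "\<exists>i\<in>I0. \<bar>a0 i e\<bar> = ?m")
        case True
        then obtain i where i: "i \<in> I0" "\<bar>a0 i e\<bar> = ?m" by blast
        then consider "a0 i e = ?m" | "- a0 i e = ?m" by linarith
        then show ?thesis
        proof cases
          case 1
          then show ?thesis using top[of I0 h0 a0 i] prems0 i by simp
        next
          case 2
          then have "quasipolynomial (solution_count E I0 (\<lambda>k e. - a0 k e) h0)"
            using top[of I0 h0 "\<lambda>k e. - a0 k e" i] prems0 i by simp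
          then show ?thesis by (simp add: positive_solutions_uminus)
        qed
      next
        case False
        have "\<bar>a0 k e\<bar> \<le> int M" if "k \<in> I0" for k
          using False prems0(3)[OF that] that by fastforce
        then show ?thesis using Suc.IH[of I0 h0 a0] prems0 by blast
      qed
    qed
  qed
  moreover have "\<bar>a k e\<bar> \<le> int (nat (\<Sum>k\<in>I. \<bar>a k e\<bar>))" if "k \<in> I" for k
    using member_le_sum[OF that, of "\<lambda>k. \<bar>a k e\<bar>"] assms(3) by (simp add: sum_nonneg)
  ultimately show ?thesis using assms(3,4) by blast
qed

text \<open>Columns that vanish in an equation keep vanishing when columns are added, so the equations can be
  eliminated one after another.\<close>

theorem quasipolynomial_solution_count:
  assumes "finite E" "finite I" "\<And>k. k \<in> I \<Longrightarrow> h k > 0"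
  shows "quasipolynomial (solution_count E I a h)"
  using assms
proof (induction E arbitrary: I a h)
  case empty
  then show ?case by (intro quasipolynomial_no_equations)
next
  case (insert e E)
  show ?case
  proof (rule quasipolynomial_eliminate[where e = e])
    fix I :: "'b set" and a :: "'b \<Rightarrow> 'a \<Rightarrow> int" and h :: "'b \<Rightarrow> nat"
    assume I: "finite I" "\<And>k. k \<in> I \<Longrightarrow> h k > 0" "\<And>k. k \<in> I \<Longrightarrow> a k e = 0"
    have "positive_solutions (insert e E) I a h t = positive_solutions E I a h t" for t
      using I(3) by (simp add: positive_solutions_def)
    then show "quasipolynomial (solution_count (insert e E) I a h)"
      using insert.IH[OF I(1,2)] by simp
  qed (use insert.prems in auto)
qed

section \<open>Integer points of a dilated cube on a rational subspace\<close>

lemma all_equal_sum_iff: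
  fixes w :: "'j \<Rightarrow> nat"
  assumes "finite J" "J \<noteq> {}"
  shows "(\<forall>i\<in>J. \<forall>j\<in>J. w i = w j) \<and> sum w J = card J * m \<longleftrightarrow> (\<forall>j\<in>J. w j = m)"
proof (intro iffI conjI)
  assume *: "(\<forall>i\<in>J. \<forall>j\<in>J. w i = w j) \<and> sum w J = card J * m"
  obtain j0 where j0: "j0 \<in> J" using assms by blast
  have "sum w J = (\<Sum>j\<in>J. w j0)" using * j0 by (intro sum.cong) blast+
  then have "card J * w j0 = card J * m" using *[THEN conjunct2] by (simp only: sum_constant of_nat_id)
  then have "w j0 = m" using assms by simp
  then show "\<forall>j\<in>J. w j = m" using *[THEN conjunct1] j0 by blast
qed auto

text \<open>With \<open>t = n + 1\<close>, the condition \<open>1 \<le> x j \<le> n\<close> says that \<open>x j\<close> and its slack \<open>t - x j\<close> are both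
  positive. Variable and slack are indexed by \<open>(j, False)\<close> and \<open>(j, True)\<close>; further equations make
  the sums \<open>x j + (t - x j)\<close> equal for all \<open>j\<close>, so the total of all variables determines \<open>t\<close>. All
  weights can therefore be 1, and the count at \<open>n\<close> is the one of weight \<open>card J * (n + 1)\<close>.\<close>

theorem quasipolynomial_cube_count:
  fixes F :: "('j \<Rightarrow> int) set"
  assumes "finite J" "J \<noteq> {}" "finite F"
  shows "quasipolynomial
    (\<lambda>n. real (card {x \<in> J \<rightarrow>\<^sub>E {1..int n}. \<forall>c\<in>F. (\<Sum>j\<in>J. c j * x j) = 0}))"
proof -
  \<comment> \<open>The given forms, and for each pair of indices the equality of their totals.\<close>
  define E :: "(('j \<Rightarrow> int) + ('j \<times> 'j)) set" where "E = Inl ` F \<union> Inr ` (J \<times> J)"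
  define I where "I = J \<times> (UNIV :: bool set)"
  define a :: "'j \<times> bool \<Rightarrow> ('j \<Rightarrow> int) + ('j \<times> 'j) \<Rightarrow> int" where
    "a = (\<lambda>(j, b) e. case e of Inl c \<Rightarrow> (if b then 0 else c j)
       | Inr (j1, j2) \<Rightarrow> (if j = j1 then 1 else 0) - (if j = j2 then 1 else 0))"
  define N where "N = card J"
  have "N > 0" using assms by (simp add: N_def card_gt_0_iff)
  have sum_I: "(\<Sum>k\<in>I. f k) = (\<Sum>j\<in>J. f (j, False) + f (j, True))" for f :: "'j \<times> bool \<Rightarrow> 'c :: comm_monoid_add"
  proof -
    have "(\<Sum>k\<in>I. f k) = (\<Sum>j\<in>J. \<Sum>b\<in>UNIV. f (j, b))"
      unfolding I_def by (simp add: sum.cartesian_product)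
    then show ?thesis by (simp add: UNIV_bool add.commute)
  qed
  have sols: "positive_solutions E I a (\<lambda>_. 1) (N * (n + 1)) =
      {y \<in> I \<rightarrow>\<^sub>E {1..}. (\<forall>c\<in>F. (\<Sum>j\<in>J. c j * int (y (j, False))) = 0) \<and>
         (\<forall>j\<in>J. y (j, False) + y (j, True) = n + 1)}" for n
  proof -
    have *: "(\<Sum>k\<in>I. int (y k) * a k (Inr (j1, j2))) =
        int (y (j1, False) + y (j1, True)) - int (y (j2, False) + y (j2, True))"
      if "j1 \<in> J" "j2 \<in> J" for y :: "'j \<times> bool \<Rightarrow> nat" and j1 j2
    proof -
      have "(\<Sum>k\<in>I. int (y k) * a k (Inr (j1, j2))) =
          (\<Sum>j\<in>J. (if j = j1 then int (y (j, False) + y (j, True)) else 0) -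
             (if j = j2 then int (y (j, False) + y (j, True)) else 0))"
        unfolding sum_I by (intro sum.cong) (auto simp: a_def)
      then show ?thesis using that assms(1) by (simp add: sum_subtractf)
    qed
    have **: "(\<Sum>k\<in>I. int (y k) * a k (Inl c)) = (\<Sum>j\<in>J. c j * int (y (j, False)))"
      for y :: "'j \<times> bool \<Rightarrow> nat" and c
      unfolding sum_I by (intro sum.cong) (auto simp: a_def)
    have ball_E: "(\<forall>e\<in>E. P e) \<longleftrightarrow> (\<forall>c\<in>F. P (Inl c)) \<and> (\<forall>j1\<in>J. \<forall>j2\<in>J. P (Inr (j1, j2)))" for P
      by (auto simp: E_def)
    have Inr_iff: "(\<Sum>k\<in>I. int (y k) * a k (Inr (j1, j2))) = 0 \<longleftrightarrow>
        y (j1, False) + y (j1, True) = y (j2, False) + y (j2, True)"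
      if "j1 \<in> J" "j2 \<in> J" for y :: "'j \<times> bool \<Rightarrow> nat" and j1 j2
      unfolding *[OF that] by linarith
    have eqs: "(\<forall>e\<in>E. (\<Sum>k\<in>I. int (y k) * a k e) = 0) \<longleftrightarrow>
        (\<forall>c\<in>F. (\<Sum>j\<in>J. c j * int (y (j, False))) = 0) \<and>
        (\<forall>j1\<in>J. \<forall>j2\<in>J. y (j1, False) + y (j1, True) = y (j2, False) + y (j2, True))"
      for y :: "'j \<times> bool \<Rightarrow> nat"
      unfolding ball_E ** using Inr_iff by blast
    have total: "(\<Sum>k\<in>I. y k * 1) = (\<Sum>j\<in>J. y (j, False) + y (j, True))" for y :: "'j \<times> bool \<Rightarrow> nat"
      unfolding mult_1_right sum_I ..
    have "(\<forall>e\<in>E. (\<Sum>k\<in>I. int (y k) * a k e) = 0) \<and> (\<Sum>k\<in>I. y k * 1) = N * (n + 1) \<longleftrightarrow>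
        (\<forall>c\<in>F. (\<Sum>j\<in>J. c j * int (y (j, False))) = 0) \<and>
        (\<forall>j\<in>J. y (j, False) + y (j, True) = n + 1)" for y :: "'j \<times> bool \<Rightarrow> nat"
      by (simp only: eqs[of y] total[of y] N_def conj_assoc
        all_equal_sum_iff[OF assms(1,2), of "\<lambda>j. y (j, False) + y (j, True)" "n + 1"])
    then show ?thesis by (simp only: positive_solutions_def)
  qed
  have count: "solution_count E I a (\<lambda>_. 1) (N * n + (N - 1)) =
      real (card {x \<in> J \<rightarrow>\<^sub>E {1..int n}. \<forall>c\<in>F. (\<Sum>j\<in>J. c j * x j) = 0})" for n
  proof -
    define S where "S = positive_solutions E I a (\<lambda>_. 1) (N * (n + 1))"
    have S: "S = {y \<in> I \<rightarrow>\<^sub>E {1..}. (\<forall>c\<in>F. (\<Sum>j\<in>J. c j * int (y (j, False))) = 0) \<and>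
         (\<forall>j\<in>J. y (j, False) + y (j, True) = n + 1)}"
      unfolding S_def by (rule sols)
    \<comment> \<open>The shift by \<open>N - 1\<close> compensates that \<open>solution_count\<close> starts at weight 1.\<close>
    have t: "Suc (N * n + (N - 1)) = N * (n + 1)" using \<open>N > 0\<close> by simp
    have "bij_betw (\<lambda>y. \<lambda>j\<in>J. int (y (j, False))) S
       {x \<in> J \<rightarrow>\<^sub>E {1..int n}. \<forall>c\<in>F. (\<Sum>j\<in>J. c j * x j) = 0}"
    proof (rule bij_betwI[where g = "\<lambda>x. \<lambda>(j, b)\<in>I. if b then n + 1 - nat (x j) else nat (x j)"])
      show "(\<lambda>y. \<lambda>j\<in>J. int (y (j, False))) \<in> S \<rightarrow>
         {x \<in> J \<rightarrow>\<^sub>E {1..int n}. \<forall>c\<in>F. (\<Sum>j\<in>J. c j * x j) = 0}"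
      proof
        fix y assume y: "y \<in> S"
        have "1 \<le> int (y (j, False)) \<and> int (y (j, False)) \<le> int n" if "j \<in> J" for j
        proof -
          have yS: "y \<in> I \<rightarrow>\<^sub>E {1..}" "\<forall>j\<in>J. y (j, False) + y (j, True) = n + 1"
            using y unfolding S by blast+
          have pos: "y (j, b) \<ge> 1" for b
            using PiE_mem[OF yS(1), of "(j, b)"] that by (simp add: I_def)
          moreover have "y (j, False) + y (j, True) = n + 1"
            using yS(2) that by blast
          ultimately show ?thesis using pos[of True] pos[of False] by linarith
        qed
        moreover have "(\<Sum>j\<in>J. c j * (\<lambda>j\<in>J. int (y (j, False))) j) = 0" if "c \<in> F" for c
          using y that by (simp add: S)
        ultimately show "(\<lambda>j\<in>J. int (y (j, False))) \<in> {x \<in> J \<rightarrow>\<^sub>E {1..int n}. \<forall>c\<in>F. (\<Sum>j\<in>J. c j * x j) = 0}"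
          by (simp add: PiE_iff)
      qed
    next
      show "(\<lambda>x. \<lambda>(j, b)\<in>I. if b then n + 1 - nat (x j) else nat (x j)) \<in>
        {x \<in> J \<rightarrow>\<^sub>E {1..int n}. \<forall>c\<in>F. (\<Sum>j\<in>J. c j * x j) = 0} \<rightarrow>
        S"
      proof
        fix x assume x: "x \<in> {x \<in> J \<rightarrow>\<^sub>E {1..int n}. \<forall>c\<in>F. (\<Sum>j\<in>J. c j * x j) = 0}"
        define y where "y = (\<lambda>(j, b)\<in>I. if b then n + 1 - nat (x j) else nat (x j))"
        have rng: "1 \<le> x j" "x j \<le> int n" if "j \<in> J" for j using x that by (auto simp: PiE_iff)
        then have nat_rng: "1 \<le> nat (x j)" "nat (x j) \<le> n" if "j \<in> J" for j using that by fastforce+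
        have yF: "y (j, False) = nat (x j)" and yT: "y (j, True) = n + 1 - nat (x j)" if "j \<in> J" for j
          using that by (auto simp: y_def I_def)
        have "(\<Sum>j\<in>J. c j * int (y (j, False))) = (\<Sum>j\<in>J. c j * x j)" for c
        proof (rule sum.cong)
          fix j assume "j \<in> J"
          then show "c j * int (y (j, False)) = c j * x j" using yF rng(1)[of j] by simp
        qed simp
        moreover have "y \<in> I \<rightarrow>\<^sub>E {1..}"
        proof (rule PiE_I)
          fix k assume "k \<in> I"
          then obtain j b where k: "k = (j, b)" "j \<in> J" by (auto simp: I_def)
          show "y k \<in> {1..}" using yF yT nat_rng[OF k(2)] k by (cases b) auto
        qed (simp add: y_def)
        moreover have "y (j, False) + y (j, True) = n + 1" if "j \<in> J" for j
          using yF yT nat_rng[OF that] that by simp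
        ultimately have "y \<in> S"
          using x by (simp add: S del: One_nat_def)
        then show "(\<lambda>(j, b)\<in>I. if b then n + 1 - nat (x j) else nat (x j)) \<in>
            S" by (simp only: y_def)
      qed
    next
      fix y assume y: "y \<in> S"
      show "(\<lambda>(j, b)\<in>I. if b then n + 1 - nat ((\<lambda>j\<in>J. int (y (j, False))) j)
          else nat ((\<lambda>j\<in>J. int (y (j, False))) j)) = y"
      proof
        fix k :: "'j \<times> bool"
        obtain j b where k: "k = (j, b)" by (cases k)
        show "(\<lambda>(j, b)\<in>I. if b then n + 1 - nat ((\<lambda>j\<in>J. int (y (j, False))) j)
          else nat ((\<lambda>j\<in>J. int (y (j, False))) j)) k = y k"
        proof (cases "j \<in> J")
          case True
          moreover have "y (j, False) + y (j, True) = n + 1"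
            using y True unfolding S by blast
          then have "n + 1 - y (j, False) = y (j, True)" by linarith
          ultimately show ?thesis by (cases b) (simp_all add: I_def k)
        next
          case False
          have "y \<in> extensional I" using y unfolding S by (blast dest: PiE_iff[THEN iffD1])
          then have "y k = undefined" using False by (simp add: I_def k extensional_def)
          then show ?thesis using False by (simp add: I_def k)
        qed
      qed
    next
      fix x assume x: "x \<in> {x \<in> J \<rightarrow>\<^sub>E {1..int n}. \<forall>c\<in>F. (\<Sum>j\<in>J. c j * x j) = 0}"
      show "(\<lambda>j\<in>J. int ((\<lambda>(j, b)\<in>I. if b then n + 1 - nat (x j) else nat (x j)) (j, False))) = x"
      proof
        fix j
        have "x j \<ge> 1 \<or> j \<notin> J" "x j = undefined \<or> j \<in> J"
          using x by (auto simp: PiE_iff extensional_def)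
        then show "(\<lambda>j\<in>J. int ((\<lambda>(j, b)\<in>I. if b then n + 1 - nat (x j) else nat (x j)) (j, False))) j = x j"
          by (cases "j \<in> J") (auto simp: I_def)
      qed
    qed
    from bij_betw_same_card[OF this] show ?thesis unfolding t S_def by (rule arg_cong)
  qed
  have "quasipolynomial (solution_count E I a (\<lambda>_. 1))"
    using assms by (intro quasipolynomial_solution_count) (auto simp: E_def I_def)
  from quasipolynomial_dilate[OF this, of N "N - 1"] show ?thesis
    unfolding count .
qed

section \<open>Coordinates, spanning families and dominating sets\<close>

text \<open>Every subspace of a coordinate space is the graph of a function of some of the coordinates. The set
  \<open>B\<close> of these coordinates grows by a coordinate \<open>i\<close> exactly when the subspace has a vector that
  vanishes on the earlier coordinates but not at \<open>i\<close>.\<close>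

lemma determining_coordinates:
  fixes V :: "('j \<Rightarrow> real) set"
  assumes "finite J"
    and add: "\<forall>v\<in>V. \<forall>w\<in>V. \<forall>c. (\<lambda>j. v j + c * w j) \<in> V"
    and zero: "(\<lambda>_. 0) \<in> V"
  shows "\<exists>B\<subseteq>J. (\<forall>v\<in>V. (\<forall>j\<in>B. v j = 0) \<longrightarrow> (\<forall>j\<in>J. v j = 0)) \<and> (\<forall>b. \<exists>v\<in>V. \<forall>j\<in>B. v j = b j)"
  using assms(1)
proof (induction J)
  case empty
  then show ?case using zero by auto
next
  case (insert i J)
  then obtain B where B: "B \<subseteq> J" "\<forall>v\<in>V. (\<forall>j\<in>B. v j = 0) \<longrightarrow> (\<forall>j\<in>J. v j = 0)"
    "\<forall>b. \<exists>v\<in>V. \<forall>j\<in>B. v j = b j" by auto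
  show ?case
  proof (cases "\<exists>w\<in>V. (\<forall>j\<in>J. w j = 0) \<and> w i \<noteq> 0")
    case True
    then obtain w where w: "w \<in> V" "\<forall>j\<in>J. w j = 0" "w i \<noteq> 0" by blast
    have "\<exists>v\<in>V. \<forall>j\<in>insert i B. v j = b j" for b
    proof -
      obtain v where v: "v \<in> V" "\<forall>j\<in>B. v j = b j" using B(3) by blast
      let ?c = "(b i - v i) / w i"
      have "\<forall>j\<in>insert i B. v j + ?c * w j = b j"
        using w v B(1) by (auto simp: subset_iff)
      then show ?thesis using add[rule_format, OF v(1) w(1), of ?c] by (intro bexI)
    qed
    then show ?thesis using B by (intro exI[of _ "insert i B"]) auto
  next
    case False
    then show ?thesis using B by (intro exI[of _ B]) blast
  qed
qed

lemma card_le_of_spanning: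
  fixes \<beta> :: "nat \<Rightarrow> 'j \<Rightarrow> real"
  assumes "finite X" and "\<And>c. \<exists>a. \<forall>x\<in>X. c x = (\<Sum>l<k. a l * \<beta> l x)"
  shows "card X \<le> k"
  using assms
proof (induction k arbitrary: X \<beta>)
  case 0
  have "X = {}"
  proof (rule ccontr)
    assume "X \<noteq> {}"
    then show False using 0(2)[of "\<lambda>_. 1"] by auto
  qed
  then show ?case by simp
next
  case (Suc k)
  show ?case
  proof (cases "\<exists>x0\<in>X. \<beta> k x0 \<noteq> 0")
    case False
    then have "\<exists>a. \<forall>x\<in>X. c x = (\<Sum>l<k. a l * \<beta> l x)" for c
      using Suc.prems(2)[of c] by auto
    then have "card X \<le> k" using Suc.IH[OF Suc.prems(1)] by blast
    then show ?thesis by simp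
  next
    case True
    then obtain x0 where x0: "x0 \<in> X" "\<beta> k x0 \<noteq> 0" by blast
    \<comment> \<open>Gaussian elimination with pivot \<open>\<beta> k x0\<close>; it clears the coordinate \<open>x0\<close>.\<close>
    define \<gamma> where "\<gamma> l x = \<beta> l x - \<beta> l x0 / \<beta> k x0 * \<beta> k x" for l x
    have "\<exists>a. \<forall>x\<in>X - {x0}. c x = (\<Sum>l<k. a l * \<gamma> l x)" for c
    proof -
      obtain a where a: "\<forall>x\<in>X. (if x = x0 then 0 else c x) = (\<Sum>l<Suc k. a l * \<beta> l x)"
        using Suc.prems(2)[of "\<lambda>x. if x = x0 then 0 else c x"] by blast
      have "a k * \<beta> k x0 = - (\<Sum>l<k. a l * \<beta> l x0)" using bspec[OF a x0(1)] by simp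
      then have ak: "a k = - (\<Sum>l<k. a l * \<beta> l x0) / \<beta> k x0" using x0(2) by (simp add: field_simps)
      have "c x = (\<Sum>l<k. a l * \<gamma> l x)" if "x \<in> X - {x0}" for x
      proof -
        have "c x = (\<Sum>l<k. a l * \<beta> l x) + a k * \<beta> k x" using bspec[OF a, of x] that by simp
        also have "a k * \<beta> k x = - (\<Sum>l<k. a l * \<beta> l x0 * (\<beta> k x / \<beta> k x0))"
          unfolding ak by (simp add: sum_distrib_right sum_divide_distrib)
        also have "(\<Sum>l<k. a l * \<beta> l x) + - (\<Sum>l<k. a l * \<beta> l x0 * (\<beta> k x / \<beta> k x0)) = (\<Sum>l<k. a l * \<gamma> l x)"
          by (simp add: \<gamma>_def sum_subtractf[symmetric] algebra_simps)
        finally show ?thesis .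
      qed
      then show ?thesis by blast
    qed
    then have "card (X - {x0}) \<le> k" using Suc.IH Suc.prems(1) by (metis finite_Diff)
    then show ?thesis using x0(1) Suc.prems(1) by simp
  qed
qed

text \<open>In a graph without isolated vertices the complement of a minimum dominating set \<open>D\<close> is
  dominating as well. Hence every vertex of \<open>D\<close> and every vertex outside \<open>D\<close> has a neighbour on the
  other side, and the larger of the two sides serves as \<open>X\<close>.\<close>

lemma half_with_outside_neighbour:
  fixes P :: "'v set"
  assumes "finite P" and nbr: "\<And>x. x \<in> P \<Longrightarrow> \<exists>y\<in>P. y \<noteq> x \<and> R x y"
    and sym: "\<And>x y. R x y \<Longrightarrow> R y x"
  obtains X where "X \<subseteq> P" "card P \<le> 2 * card X" "\<And>x. x \<in> X \<Longrightarrow> \<exists>y\<in>P - X. R x y"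
proof -
  define dom where "dom D \<longleftrightarrow> D \<subseteq> P \<and> (\<forall>x\<in>P - D. \<exists>y\<in>D. R x y)" for D
  have "dom P" by (simp add: dom_def)
  then obtain D where D: "dom D" and min: "\<And>D'. dom D' \<Longrightarrow> card D \<le> card D'"
    using ex_has_least_nat[of dom P card] by blast
  have DP: "D \<subseteq> P" and fin: "finite D" using D assms(1) finite_subset by (auto simp: dom_def)
  have inner: "\<exists>y\<in>P - D. R x y" if x: "x \<in> D" for x
  proof (rule ccontr)
    assume none: "\<not> (\<exists>y\<in>P - D. R x y)"
    have "dom (D - {x})"
      unfolding dom_def
    proof (intro conjI ballI)
      fix z assume z: "z \<in> P - (D - {x})"
      show "\<exists>y\<in>D - {x}. R z y"
      proof (cases "z = x")
        case True
        then show ?thesis using nbr[of x] none DP x by blast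
      next
        case False
        then obtain y where "y \<in> D" "R z y" using D z by (auto simp: dom_def)
        moreover have "y \<noteq> x" using none z False sym[OF \<open>R z y\<close>] by blast
        ultimately show ?thesis by blast
      qed
    qed (use DP in auto)
    then have "card D \<le> card (D - {x})" by (rule min)
    then show False using x fin by (metis card_Diff1_less not_le)
  qed
  have cardP: "card P = card D + card (P - D)"
    using DP assms(1) fin by (simp add: card_Diff_subset card_mono)
  show ?thesis
  proof (cases "card D \<ge> card (P - D)")
    case True
    then show ?thesis using that[of D] DP inner cardP by auto
  next
    case False
    have "\<exists>y\<in>P - (P - D). R x y" if "x \<in> P - D" for x
      using D DP that unfolding dom_def by blast
    then show ?thesis using that[of "P - D"] False cardP by auto
  qed
qed

section \<open>Intersection subspaces and their codimension\<close>

text \<open>The equations satisfied by \<open>U\<close>, viewed as labelled edges between the pieces that they link.\<close>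

definition edges :: "(int \<times> int) set \<Rightarrow> config set \<Rightarrow> ((int \<times> int) \<times> nat \<times> nat) set" where
  "edges M U = {(m, i, j). m \<in> M \<and> i > 0 \<and> j > 0 \<and> i \<noteq> j \<and> U \<subseteq> hyp m i j}"

definition satisfies :: "((int \<times> int) \<times> nat \<times> nat) set \<Rightarrow> config \<Rightarrow> bool" where
  "satisfies G z \<longleftrightarrow> (\<forall>(m, i, j)\<in>G. move_eqn m i j z)"

lemma move_eqn_sym: "move_eqn m i j z \<longleftrightarrow> move_eqn m j i z"
proof -
  have "a * (x - y) = b * (u - v) \<longleftrightarrow> a * (y - x) = b * (v - u)" for a b x y u v :: real
    by (simp add: right_diff_distrib) linarith
  then show ?thesis unfolding move_eqn_def .
qed

lemma hyp_sym: "hyp m i j = hyp m j i"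
  unfolding hyp_def using move_eqn_sym[of m i j] by simp

lemma edges_pieces: "(m, i, j) \<in> edges M U \<Longrightarrow> m \<in> M \<and> i \<in> pieces M U \<and> j \<in> pieces M U \<and> i \<noteq> j"
proof -
  assume "(m, i, j) \<in> edges M U"
  then have "m \<in> M" "i > 0" "j > 0" "i \<noteq> j" "U \<subseteq> hyp m i j" "U \<subseteq> hyp m j i"
    using hyp_sym[of m i j] by (simp_all add: edges_def)
  then show ?thesis unfolding pieces_def by blast
qed

lemma pieces_edges: "pieces M U = {i. \<exists>m j. (m, i, j) \<in> edges M U}"
  unfolding edges_def pieces_def by blast

lemma finite_edges: "finite M \<Longrightarrow> finite (pieces M U) \<Longrightarrow> finite (edges M U)"
  by (rule finite_subset[of _ "M \<times> pieces M U \<times> pieces M U"]) (auto dest: edges_pieces)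

lemma edges_sym: "(m, i, j) \<in> edges M U \<Longrightarrow> (m, j, i) \<in> edges M U"
  using hyp_sym[of m i j] by (simp add: edges_def)

text \<open>Any family of hyperplanes that defines \<open>U\<close> is among those that contain \<open>U\<close>. So \<open>U\<close> is a condition
  on the positions of its own pieces only; \<open>satisfies_edges_cong\<close> makes this precise.\<close>

lemma intersection_eq_edges:
  assumes "U \<in> intersections M"
  shows "U = {z \<in> Rinf. satisfies (edges M U) z}"
proof
  show "U \<subseteq> {z \<in> Rinf. satisfies (edges M U) z}"
    using assms by (auto simp: intersections_def satisfies_def edges_def hyp_def)
  obtain F where F: "U = Rinf \<inter> \<Inter>F" "F \<subseteq> arrangement M"
    using assms by (auto simp: intersections_def)
  have "z \<in> H" if z: "z \<in> Rinf" "satisfies (edges M U) z" and HF: "H \<in> F" for z H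
  proof -
    obtain m i j where H: "H = hyp m i j" "m \<in> M" "i > 0" "j > 0" "i \<noteq> j"
      using F(2) HF by (auto simp: arrangement_def)
    then have "(m, i, j) \<in> edges M U" using F HF by (auto simp: edges_def)
    then show ?thesis using z H by (auto simp: hyp_def satisfies_def)
  qed
  then show "{z \<in> Rinf. satisfies (edges M U) z} \<subseteq> U" unfolding F(1) by blast
qed

lemma satisfies_edges_cong:
  assumes "\<And>i. i \<in> pieces M U \<Longrightarrow> z i = w i"
  shows "satisfies (edges M U) z \<longleftrightarrow> satisfies (edges M U) w"
  unfolding satisfies_def
proof (intro ball_cong refl, clarify)
  fix c d i j assume "((c, d), i, j) \<in> edges M U"
  then have "z i = w i" "z j = w j" using assms edges_pieces by blast+
  then show "move_eqn (c, d) i j z = move_eqn (c, d) i j w" by (simp add: move_eqn_def)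
qed

definition spans_modulo :: "config set \<Rightarrow> nat \<Rightarrow> bool" where
  "spans_modulo U k \<longleftrightarrow> (\<exists>b :: nat \<Rightarrow> config. (\<forall>l<k. b l \<in> Rinf) \<and>
     (\<forall>z\<in>Rinf. \<exists>u\<in>U. \<exists>a :: nat \<Rightarrow> real. \<forall>i. z i = u i + (\<Sum>l<k. a l *\<^sub>R b l i)))"

lemma codim_Least: "codim U = (LEAST k. spans_modulo U k)"
  by (simp add: codim_def spans_modulo_def)

definition coord :: "config \<Rightarrow> nat \<times> bool \<Rightarrow> real" where
  "coord z = (\<lambda>(i, b). if b then snd (z i) else fst (z i))"

definition of_coord :: "(nat \<times> bool \<Rightarrow> real) \<Rightarrow> config" where
  "of_coord v = (\<lambda>i. (v (i, False), v (i, True)))"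

lemma of_coord_coord [simp]: "of_coord (coord z) = z"
  by (auto simp: coord_def of_coord_def fun_eq_iff)

text \<open>If the coordinates in \<open>B\<close> can be prescribed freely on \<open>U\<close>, the unit vectors of the remaining
  coordinates of the pieces of \<open>U\<close> span the whole space together with \<open>U\<close>.\<close>

lemma spans_modulo_complement:
  assumes "U \<in> intersections M" and fin: "finite (pieces M U)"
    and B: "B \<subseteq> pieces M U \<times> UNIV"
    and surj: "\<And>b. \<exists>v. satisfies (edges M U) (of_coord v) \<and> (\<forall>j\<in>B. v j = b j)"
  shows "spans_modulo U (2 * card (pieces M U) - card B)"
proof -
  let ?P = "pieces M U"
  define C where "C = ?P \<times> (UNIV :: bool set) - B"
  have finC: "finite C" using fin by (simp add: C_def)
  have cardC: "card C = 2 * card ?P - card B"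
    unfolding C_def using B fin finite_subset[OF B]
    by (subst card_Diff_subset) (auto simp: card_cartesian_product)
  obtain e where e: "bij_betw e {..<card C} C"
    using ex_bij_betw_nat_finite[OF finC] by (auto simp: lessThan_atLeast0)
  define unit where "unit c = of_coord (\<lambda>c'. if c' = c then 1 else 0)" for c :: "nat \<times> bool"
  have unit_Rinf: "unit c \<in> Rinf" if "c \<in> C" for c
  proof -
    have "fst c > 0" using that by (auto simp: C_def pieces_def)
    then have "unit c 0 = 0" by (auto simp: unit_def of_coord_def zero_prod_def)
    moreover have "finite {i. unit c i \<noteq> 0}"
    proof (rule finite_subset)
      show "{i. unit c i \<noteq> 0} \<subseteq> {fst c}" by (auto simp: unit_def of_coord_def zero_prod_def)
    qed simp
    ultimately show ?thesis by (simp add: Rinf_def)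
  qed
  show ?thesis
    unfolding spans_modulo_def cardC[symmetric]
  proof (intro exI[of _ "\<lambda>l. unit (e l)"] conjI ballI allI impI)
    fix l assume "l < card C"
    then show "unit (e l) \<in> Rinf" using unit_Rinf bij_betwE[OF e] by blast
  next
    fix z assume z: "z \<in> Rinf"
    obtain v where v: "satisfies (edges M U) (of_coord v)" "\<forall>j\<in>B. v j = coord z j"
      using surj by blast
    \<comment> \<open>The part of \<open>z\<close> in \<open>U\<close>: it agrees with \<open>z\<close> on \<open>B\<close> and away from the pieces of \<open>U\<close>.\<close>
    define u where "u i = (if i \<in> ?P then of_coord v i else z i)" for i
    have "satisfies (edges M U) u"
      using v(1) satisfies_edges_cong[of M U u "of_coord v"] by (simp add: u_def)
    moreover have "u \<in> Rinf"
    proof -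
      have "{i. u i \<noteq> 0} \<subseteq> ?P \<union> {i. z i \<noteq> 0}" by (auto simp: u_def)
      then have "finite {i. u i \<noteq> 0}" using z fin by (auto simp: Rinf_def intro: finite_subset)
      moreover have "u 0 = 0" using z by (simp add: u_def Rinf_def pieces_def)
      ultimately show ?thesis by (simp add: Rinf_def)
    qed
    ultimately have "u \<in> U" using intersection_eq_edges[OF assms(1)] by blast
    moreover have "z i = u i + (\<Sum>l<card C. (coord z (e l) - coord u (e l)) *\<^sub>R unit (e l) i)" for i
    proof -
      have "(\<Sum>l<card C. (coord z (e l) - coord u (e l)) *\<^sub>R unit (e l) i) =
          (\<Sum>c\<in>C. (coord z c - coord u c) *\<^sub>R unit c i)"
        using sum.reindex_bij_betw[OF e] .
      moreover have "fst (\<Sum>c\<in>C. (coord z c - coord u c) *\<^sub>R unit c i) = fst (z i) - fst (u i)"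
      proof -
        have "fst (\<Sum>c\<in>C. (coord z c - coord u c) *\<^sub>R unit c i) =
            (\<Sum>c\<in>C. if c = (i, False) then coord z c - coord u c else 0)"
          unfolding fst_sum by (intro sum.cong) (auto simp: unit_def of_coord_def)
        also have "\<dots> = (if (i, False) \<in> C then fst (z i) - fst (u i) else 0)"
          using finC by (simp add: coord_def)
        also have "\<dots> = fst (z i) - fst (u i)"
          using v(2) by (auto simp: C_def u_def coord_def of_coord_def)
        finally show ?thesis .
      qed
      moreover have "snd (\<Sum>c\<in>C. (coord z c - coord u c) *\<^sub>R unit c i) = snd (z i) - snd (u i)"
      proof -
        have "snd (\<Sum>c\<in>C. (coord z c - coord u c) *\<^sub>R unit c i) =
            (\<Sum>c\<in>C. if c = (i, True) then coord z c - coord u c else 0)"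
          unfolding snd_sum by (intro sum.cong) (auto simp: unit_def of_coord_def)
        also have "\<dots> = (if (i, True) \<in> C then snd (z i) - snd (u i) else 0)"
          using finC by (simp add: coord_def)
        also have "\<dots> = snd (z i) - snd (u i)"
          using v(2) by (auto simp: C_def u_def coord_def of_coord_def)
        finally show ?thesis .
      qed
      ultimately show ?thesis by (simp add: prod_eq_iff)
    qed
    ultimately show "\<exists>u\<in>U. \<exists>a. \<forall>i. z i = u i + (\<Sum>l<card C. a l *\<^sub>R unit (e l) i)"
      by (intro bexI[of _ u] exI[of _ "\<lambda>l. coord z (e l) - coord u (e l)"]) auto
  qed
qed


lemma satisfies_combination:
  assumes "satisfies G z" "satisfies G w"
  shows "satisfies G (\<lambda>i. z i + c *\<^sub>R w i)"
proof -
  have "move_eqn m i j (\<lambda>i. z i + c *\<^sub>R w i)" if "move_eqn m i j z" "move_eqn m i j w" for m i j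
  proof -
    let ?d = "of_int (snd m) :: real" and ?e = "of_int (fst m) :: real"
    have "?d * (fst (z j + c *\<^sub>R w j) - fst (z i + c *\<^sub>R w i)) =
        ?d * (fst (z j) - fst (z i)) + c * (?d * (fst (w j) - fst (w i)))"
      by (simp add: algebra_simps)
    also have "\<dots> = ?e * (snd (z j) - snd (z i)) + c * (?e * (snd (w j) - snd (w i)))"
      using that by (simp add: move_eqn_def)
    also have "\<dots> = ?e * (snd (z j + c *\<^sub>R w j) - snd (z i + c *\<^sub>R w i))"
      by (simp add: algebra_simps)
    finally show ?thesis by (simp only: move_eqn_def)
  qed
  then show ?thesis using assms unfolding satisfies_def by blast
qed

lemma satisfies_const: "satisfies G (\<lambda>_. a)"
  by (auto simp: satisfies_def move_eqn_def)

lemma codim_le_of_determining: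
  assumes "U \<in> intersections M" "finite (pieces M U)" "B \<subseteq> pieces M U \<times> UNIV"
    and "\<And>b. \<exists>v. satisfies (edges M U) (of_coord v) \<and> (\<forall>j\<in>B. v j = b j)"
  shows "spans_modulo U (codim U)" and "codim U + card B \<le> 2 * card (pieces M U)"
proof -
  note span = spans_modulo_complement[OF assms]
  show "spans_modulo U (codim U)" unfolding codim_Least using span by (rule LeastI)
  have "codim U \<le> 2 * card (pieces M U) - card B"
    unfolding codim_Least using span by (rule Least_le)
  moreover have "card B \<le> 2 * card (pieces M U)"
    using card_mono[OF _ assms(3)] assms(2) by (simp add: card_cartesian_product mult.commute)
  ultimately show "codim U + card B \<le> 2 * card (pieces M U)" by simp
qed

text \<open>All equations are invariant under translations of the plane, so the two coordinates of one piece
  can be prescribed freely.\<close>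

lemma codim_upper_bound:
  assumes "U \<in> intersections M" "finite (pieces M U)" "pieces M U \<noteq> {}"
  shows "codim U \<le> 2 * card (pieces M U) - 2"
proof -
  obtain i where i: "i \<in> pieces M U" using assms(3) by blast
  have "codim U + card ({i} \<times> (UNIV :: bool set)) \<le> 2 * card (pieces M U)"
  proof (rule codim_le_of_determining(2)[OF assms(1,2)])
    fix b :: "nat \<times> bool \<Rightarrow> real"
    have "of_coord (\<lambda>(k, t). b (i, t)) = (\<lambda>_. (b (i, False), b (i, True)))"
      by (simp add: of_coord_def)
    then have "satisfies (edges M U) (of_coord (\<lambda>(k, t). b (i, t)))"
      using satisfies_const by simp
    then show "\<exists>v. satisfies (edges M U) (of_coord v) \<and> (\<forall>j\<in>{i} \<times> UNIV. v j = b j)"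
      by (intro exI[of _ "\<lambda>(k, t). b (i, t)"]) auto
  qed (use i in auto)
  then show ?thesis by (simp add: card_cartesian_product)
qed

text \<open>The set \<open>X\<close> contains at least half of the pieces, and each \<open>x\<close> in \<open>X\<close> is linked by an equation to a
  piece outside \<open>X\<close>. On configurations supported on \<open>X\<close> these equations decouple: the one chosen for
  \<open>x\<close> involves the position of \<open>x\<close> alone. So they are independent, and they vanish on \<open>U\<close>.\<close>

lemma codim_lower_bound:
  assumes U: "U \<in> intersections M" and fin: "finite (pieces M U)" and span: "spans_modulo U k"
    and nz: "\<And>m. m \<in> M \<Longrightarrow> m \<noteq> (0, 0)"
  shows "card (pieces M U) \<le> 2 * k"
proof -
  let ?P = "pieces M U"
  obtain X where X: "X \<subseteq> ?P" "card ?P \<le> 2 * card X"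
    and nbr: "\<And>x. x \<in> X \<Longrightarrow> \<exists>y\<in>?P - X. \<exists>m. (m, x, y) \<in> edges M U"
  proof (rule half_with_outside_neighbour[OF fin, of "\<lambda>x y. \<exists>m. (m, x, y) \<in> edges M U"])
    fix x assume "x \<in> ?P"
    then obtain m y where e: "(m, x, y) \<in> edges M U" by (auto simp: pieces_edges)
    have "y \<in> ?P" "y \<noteq> x" using edges_pieces[OF e] by simp_all
    then show "\<exists>y\<in>?P. y \<noteq> x \<and> (\<exists>m. (m, x, y) \<in> edges M U)"
      by (intro bexI[of _ y] conjI exI[of _ m] e)
  next
    fix x y assume "\<exists>m. (m, x, y) \<in> edges M U"
    then show "\<exists>m. (m, y, x) \<in> edges M U" using edges_sym by blast
  qed blast
  obtain y m where ym: "\<And>x. x \<in> X \<Longrightarrow> y x \<in> ?P - X \<and> (m x, x, y x) \<in> edges M U"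
    using nbr by metis
  define \<phi> where "\<phi> z x = of_int (snd (m x)) * (fst (z (y x)) - fst (z x)) -
     of_int (fst (m x)) * (snd (z (y x)) - snd (z x))" for z :: config and x
  have \<phi>U: "\<phi> u x = 0" if "u \<in> U" "x \<in> X" for u x
    using ym[OF that(2)] that(1) by (auto simp: \<phi>_def edges_def hyp_def move_eqn_def)
  obtain b where b: "\<forall>z\<in>Rinf. \<exists>u\<in>U. \<exists>a :: nat \<Rightarrow> real. \<forall>i. z i = u i + (\<Sum>l<k. a l *\<^sub>R b l i)"
    using span by (auto simp: spans_modulo_def)
  have "card X \<le> k"
  proof (rule card_le_of_spanning)
    show "finite X" using X(1) fin finite_subset by blast
    fix c :: "nat \<Rightarrow> real"
    \<comment> \<open>Displaces \<open>x\<close> along the normal of its chosen line, so that its form takes the value \<open>c x\<close>.\<close>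
    define z where "z x = (if x \<in> X then
        (- (c x / (of_int (snd (m x)) ^ 2 + of_int (fst (m x)) ^ 2))) *\<^sub>R
          (of_int (snd (m x)), - of_int (fst (m x))) else 0 :: real \<times> real)" for x :: nat
    have \<phi>z: "\<phi> z x = c x" if x: "x \<in> X" for x
    proof -
      have "m x \<noteq> (0, 0)" using ym[OF x] nz by (auto simp: edges_def)
      define d e :: real where "d = of_int (snd (m x))" and "e = of_int (fst (m x))"
      have N: "d ^ 2 + e ^ 2 \<noteq> 0"
        using \<open>m x \<noteq> (0, 0)\<close> by (auto simp: d_def e_def sum_power2_eq_zero_iff prod_eq_iff)
      have "z (y x) = 0" using ym[OF x] by (simp add: z_def)
      moreover have "fst (z x) = - (c x / (d ^ 2 + e ^ 2)) * d" "snd (z x) = c x / (d ^ 2 + e ^ 2) * e"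
        using x by (simp_all add: z_def d_def e_def)
      ultimately have "\<phi> z x = c x / (d ^ 2 + e ^ 2) * (d ^ 2 + e ^ 2)"
        unfolding \<phi>_def d_def[symmetric] e_def[symmetric]
        by (simp only: fst_zero snd_zero) (simp add: power2_eq_square ring_distribs mult_ac add_divide_distrib)
      then show ?thesis using N by auto
    qed
    have "z \<in> Rinf"
    proof -
      have "{x. z x \<noteq> 0} \<subseteq> X" by (auto simp: z_def)
      then have "finite {x. z x \<noteq> 0}" using X(1) fin by (meson finite_subset)
      moreover have "0 \<notin> X" using X(1) by (auto simp: pieces_def)
      ultimately show ?thesis by (simp add: Rinf_def z_def)
    qed
    then obtain u a where u: "u \<in> U" and za: "\<And>i. z i = u i + (\<Sum>l<k. a l *\<^sub>R b l i)"
      using b by blast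
    have "c x = (\<Sum>l<k. a l * \<phi> (b l) x)" if x: "x \<in> X" for x
    proof -
      have "\<phi> z x = \<phi> u x + (\<Sum>l<k. a l * \<phi> (b l) x)"
        unfolding \<phi>_def za
        by (simp add: fst_sum snd_sum sum_distrib_left sum.distrib sum_subtractf algebra_simps)
      then show ?thesis using \<phi>z[OF x] \<phi>U[OF u x] by simp
    qed
    then show "\<exists>a. \<forall>x\<in>X. c x = (\<Sum>l<k. a l * \<phi> (b l) x)" by blast
  qed
  then show ?thesis using X(2) by simp
qed

section \<open>Board points on a subspace\<close>

definition point :: "int \<times> int \<Rightarrow> real \<times> real" where
  "point p = (of_int (fst p), of_int (snd p))"

text \<open>The points counted by \<open>alpha\<close>, as placements of the pieces of \<open>U\<close> on the board: the integer
  points of \<open>(n + 1) * (0, 1)\<close> are the numbers from 1 to \<open>n\<close>.\<close>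

definition board_points :: "(int \<times> int) set \<Rightarrow> config set \<Rightarrow> nat \<Rightarrow> (nat \<Rightarrow> int \<times> int) set" where
  "board_points M U n = {f \<in> pieces M U \<rightarrow>\<^sub>E board n. satisfies (edges M U) (point \<circ> f)}"

lemma finite_board: "finite (board n)"
  by (simp add: board_def)

lemma card_board: "card (board n) = n ^ 2"
  by (simp add: board_def card_cartesian_product power2_eq_square)

lemma reduced_eq: "reduced M U = {w \<in> pieces M U \<rightarrow>\<^sub>E UNIV. satisfies (edges M U) w}"
proof -
  have "(\<forall>m\<in>M. \<forall>i j. i > 0 \<and> j > 0 \<and> i \<noteq> j \<and> U \<subseteq> hyp m i j \<longrightarrow> move_eqn m i j w) \<longleftrightarrow>
      satisfies (edges M U) w" for w
    unfolding satisfies_def edges_def by (auto simp del: split_paired_All)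
  then show ?thesis unfolding reduced_def by simp
qed

lemma move_eqn_scale:
  assumes "t \<noteq> 0" "w i = t *\<^sub>R v i" "w j = t *\<^sub>R v j"
  shows "move_eqn m i j w \<longleftrightarrow> move_eqn m i j v"
proof -
  have eqs: "of_int (snd m) * (fst (w j) - fst (w i)) = t * (of_int (snd m) * (fst (v j) - fst (v i)))"
    "of_int (fst m) * (snd (w j) - snd (w i)) = t * (of_int (fst m) * (snd (v j) - snd (v i)))"
    using assms(2,3) by (simp_all add: algebra_simps)
  show ?thesis unfolding move_eqn_def eqs mult_cancel_left using assms(1) by blast
qed

lemma alpha_eq_card_board_points: "alpha M U n = card (board_points M U n)"
proof -
  let ?P = "pieces M U" and ?t = "real (n + 1)"
  let ?A = "{w \<in> dilate ?P ?t (open_cube ?P \<inter> reduced M U). \<forall>i\<in>?P. fst (w i) \<in> \<int> \<and> snd (w i) \<in> \<int>}"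
  have sat: "satisfies (edges M U) w \<longleftrightarrow> satisfies (edges M U) v"
    if "\<And>i. i \<in> ?P \<Longrightarrow> w i = c *\<^sub>R v i" "c \<noteq> 0" for w v c
    unfolding satisfies_def
  proof (intro ball_cong refl, clarify)
    fix a b i j assume "((a, b), i, j) \<in> edges M U"
    then have "w i = c *\<^sub>R v i" "w j = c *\<^sub>R v j" using that(1) edges_pieces by blast+
    then show "move_eqn (a, b) i j w = move_eqn (a, b) i j v" by (rule move_eqn_scale[OF that(2)])
  qed
  have "bij_betw (\<lambda>f. \<lambda>i\<in>?P. point (f i)) (board_points M U n) ?A"
  proof (rule bij_betwI[where g = "\<lambda>w. \<lambda>i\<in>?P. (\<lfloor>fst (w i)\<rfloor>, \<lfloor>snd (w i)\<rfloor>)"])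
    show "(\<lambda>f. \<lambda>i\<in>?P. point (f i)) \<in> board_points M U n \<rightarrow> ?A"
    proof
      fix f assume f: "f \<in> board_points M U n"
      define v where "v = (\<lambda>i\<in>?P. (1 / ?t) *\<^sub>R point (f i))"
      have "v i \<in> {0<..<1} \<times> {0<..<1}" if "i \<in> ?P" for i
      proof -
        have "f i \<in> board n" using f that by (auto simp: board_points_def)
        then have "1 \<le> fst (f i)" "fst (f i) \<le> int n" "1 \<le> snd (f i)" "snd (f i) \<le> int n"
          by (auto simp: board_def)
        then have "0 < real_of_int (fst (f i))" "real_of_int (fst (f i)) < ?t"
            "0 < real_of_int (snd (f i))" "real_of_int (snd (f i)) < ?t" by linarith+
        then show ?thesis using that by (simp add: v_def point_def)
      qed
      then have cube: "v \<in> open_cube ?P" by (auto simp: open_cube_def v_def)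
      have "satisfies (edges M U) v"
        using sat[of v "1 / ?t" "point \<circ> f"] f by (simp add: v_def board_points_def)
      then have mem: "v \<in> open_cube ?P \<inter> reduced M U"
        using cube by (auto simp: reduced_eq v_def)
      have "(\<lambda>i\<in>?P. point (f i)) = (\<lambda>i\<in>?P. ?t *\<^sub>R v i)" by (auto simp: v_def)
      from this mem have "(\<lambda>i\<in>?P. point (f i)) \<in> dilate ?P ?t (open_cube ?P \<inter> reduced M U)"
        unfolding dilate_def by (rule image_eqI[where x = v])
      then show "(\<lambda>i\<in>?P. point (f i)) \<in> ?A" by (auto simp: point_def)
    qed
  next
    show "(\<lambda>w. \<lambda>i\<in>?P. (\<lfloor>fst (w i)\<rfloor>, \<lfloor>snd (w i)\<rfloor>)) \<in> ?A \<rightarrow> board_points M U n"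
    proof
      fix w assume w: "w \<in> ?A"
      then obtain v where v: "w = (\<lambda>i\<in>?P. ?t *\<^sub>R v i)" "v \<in> open_cube ?P" "satisfies (edges M U) v"
        by (auto simp: dilate_def reduced_eq)
      let ?f = "\<lambda>i\<in>?P. (\<lfloor>fst (w i)\<rfloor>, \<lfloor>snd (w i)\<rfloor>)"
      have pf: "point (?f i) = w i" if "i \<in> ?P" for i
        using w that by (auto simp: point_def prod_eq_iff)
      have "?f i \<in> board n" if i: "i \<in> ?P" for i
      proof -
        have "v i \<in> {0<..<1} \<times> {0<..<1}" using v(2) i by (auto simp: open_cube_def)
        then have v01: "0 < fst (v i)" "fst (v i) < 1" "0 < snd (v i)" "snd (v i) < 1"
          by (auto simp: mem_Times_iff)
        have w_eq: "fst (w i) = ?t * fst (v i)" "snd (w i) = ?t * snd (v i)"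
          using i by (simp_all add: v(1))
        have "0 < fst (w i)" "fst (w i) < ?t" "0 < snd (w i)" "snd (w i) < ?t"
          unfolding w_eq using v01 by simp_all
        moreover have "fst (w i) = of_int \<lfloor>fst (w i)\<rfloor>" "snd (w i) = of_int \<lfloor>snd (w i)\<rfloor>"
          using w i by auto
        ultimately have "0 < \<lfloor>fst (w i)\<rfloor>" "\<lfloor>fst (w i)\<rfloor> < int n + 1" "0 < \<lfloor>snd (w i)\<rfloor>" "\<lfloor>snd (w i)\<rfloor> < int n + 1"
          by linarith+
        then show ?thesis using i by (simp add: board_def)
      qed
      moreover have "satisfies (edges M U) w"
        using sat[of w ?t v] v by simp
      then have "satisfies (edges M U) (point \<circ> ?f)"
        using satisfies_edges_cong[of M U "point \<circ> ?f" w] pf by simp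
      ultimately show "?f \<in> board_points M U n" by (auto simp: board_points_def)
    qed
  next
    fix f assume "f \<in> board_points M U n"
    then show "(\<lambda>i\<in>?P. (\<lfloor>fst ((\<lambda>i\<in>?P. point (f i)) i)\<rfloor>, \<lfloor>snd ((\<lambda>i\<in>?P. point (f i)) i)\<rfloor>)) = f"
      by (auto simp: board_points_def point_def fun_eq_iff PiE_iff extensional_def)
  next
    fix w assume w: "w \<in> ?A"
    then have "w \<in> extensional ?P" by (auto simp: dilate_def)
    then show "(\<lambda>i\<in>?P. point ((\<lambda>i\<in>?P. (\<lfloor>fst (w i)\<rfloor>, \<lfloor>snd (w i)\<rfloor>)) i)) = w"
      using w by (auto simp: point_def fun_eq_iff extensional_def prod_eq_iff)
  qed
  from bij_betw_same_card[OF this] show ?thesis by (simp add: alpha_def)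
qed

text \<open>The coefficient vector of an equation in the coordinates \<open>(k, False)\<close> for \<open>x\<^sub>k\<close> and \<open>(k, True)\<close> for
  \<open>y\<^sub>k\<close>.\<close>

definition edge_form :: "(int \<times> int) \<times> nat \<times> nat \<Rightarrow> nat \<times> bool \<Rightarrow> int" where
  "edge_form = (\<lambda>(m, i, j) (k, b).
     (if b then - fst m else snd m) * ((if k = j then 1 else 0) - (if k = i then 1 else 0)))"

lemma edge_form_eq_0_iff:
  fixes x :: "nat \<times> bool \<Rightarrow> int"
  assumes "finite P" "i \<in> P" "j \<in> P"
  shows "(\<Sum>k\<in>P \<times> UNIV. edge_form (m, i, j) k * x k) = 0 \<longleftrightarrow>
    move_eqn m i j (\<lambda>k. point (x (k, False), x (k, True)))"
proof -
  have "(\<Sum>k\<in>P \<times> UNIV. edge_form (m, i, j) k * x k) =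
      (\<Sum>k\<in>P. \<Sum>b\<in>UNIV. edge_form (m, i, j) (k, b) * x (k, b))"
    by (simp add: sum.cartesian_product)
  also have "\<dots> = (\<Sum>k\<in>P. (if k = j then snd m * x (k, False) - fst m * x (k, True) else 0) -
      (if k = i then snd m * x (k, False) - fst m * x (k, True) else 0))"
    by (intro sum.cong) (auto simp: UNIV_bool edge_form_def)
  also have "\<dots> = (snd m * x (j, False) - fst m * x (j, True)) - (snd m * x (i, False) - fst m * x (i, True))"
    using assms by (simp add: sum_subtractf)
  finally have *: "(\<Sum>k\<in>P \<times> UNIV. edge_form (m, i, j) k * x k) =
      snd m * (x (j, False) - x (i, False)) - fst m * (x (j, True) - x (i, True))"
    by (simp add: algebra_simps)
  have "move_eqn m i j (\<lambda>k. point (x (k, False), x (k, True))) \<longleftrightarrow>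
      real_of_int (snd m * (x (j, False) - x (i, False))) = real_of_int (fst m * (x (j, True) - x (i, True)))"
    by (simp add: move_eqn_def point_def)
  then show ?thesis unfolding * of_int_eq_iff by simp
qed

lemma quasipolynomial_alpha:
  assumes "finite M" "finite (pieces M U)" "pieces M U \<noteq> {}"
  shows "quasipolynomial (\<lambda>n. real (alpha M U n))"
proof -
  let ?P = "pieces M U"
  let ?S = "\<lambda>n. {x \<in> ?P \<times> UNIV \<rightarrow>\<^sub>E {1..int n}. \<forall>c\<in>edge_form ` edges M U. (\<Sum>j\<in>?P \<times> UNIV. c j * x j) = 0}"
  have sat: "(\<forall>c\<in>edge_form ` edges M U. (\<Sum>j\<in>?P \<times> UNIV. c j * x j) = 0) \<longleftrightarrow>
      satisfies (edges M U) (\<lambda>k. point (x (k, False), x (k, True)))" for x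
  proof -
    have "(\<Sum>k\<in>?P \<times> UNIV. edge_form e k * x k) = 0 \<longleftrightarrow>
        (case e of (m, i, j) \<Rightarrow> move_eqn m i j (\<lambda>k. point (x (k, False), x (k, True))))"
      if "e \<in> edges M U" for e
    proof -
      obtain m i j where e: "e = (m, i, j)" by (cases e)
      then have "i \<in> ?P" "j \<in> ?P" using that edges_pieces[of m i j M U] by blast+
      then show ?thesis using edge_form_eq_0_iff[OF assms(2), of i j m x] by (simp add: e)
    qed
    then show ?thesis unfolding satisfies_def ball_simps(9) by (rule ball_cong[OF refl])
  qed
  have "alpha M U n = card (?S n)" for n
  proof -
    have "bij_betw (\<lambda>x. \<lambda>i\<in>?P. (x (i, False), x (i, True))) (?S n) (board_points M U n)"
    proof (rule bij_betwI[where g = "\<lambda>f. \<lambda>(i, b)\<in>?P \<times> UNIV. if b then snd (f i) else fst (f i)"])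
      show "(\<lambda>x. \<lambda>i\<in>?P. (x (i, False), x (i, True))) \<in> ?S n \<rightarrow> board_points M U n"
      proof
        fix x assume x: "x \<in> ?S n"
        have "satisfies (edges M U) (point \<circ> (\<lambda>i\<in>?P. (x (i, False), x (i, True))))"
          using x unfolding mem_Collect_eq sat
          by (subst satisfies_edges_cong[where w = "\<lambda>k. point (x (k, False), x (k, True))"]) auto
        moreover have "(x (i, False), x (i, True)) \<in> board n" if "i \<in> ?P" for i
          using x that by (auto simp: board_def dest: PiE_mem)
        ultimately show "(\<lambda>i\<in>?P. (x (i, False), x (i, True))) \<in> board_points M U n"
          by (auto simp: board_points_def)
      qed
    next
      show "(\<lambda>f. \<lambda>(i, b)\<in>?P \<times> UNIV. if b then snd (f i) else fst (f i)) \<in> board_points M U n \<rightarrow> ?S n"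
      proof
        fix f assume f: "f \<in> board_points M U n"
        let ?x = "\<lambda>(i, b)\<in>?P \<times> UNIV. if b then snd (f i) else fst (f i)"
        have "satisfies (edges M U) (\<lambda>k. point (?x (k, False), ?x (k, True)))"
          using f by (subst satisfies_edges_cong[where w = "point \<circ> f"]) (auto simp: board_points_def)
        moreover have "?x k \<in> {1..int n}" if "k \<in> ?P \<times> UNIV" for k
        proof -
          obtain i b where k: "k = (i, b)" "i \<in> ?P" using \<open>k \<in> ?P \<times> UNIV\<close> by auto
          have "f i \<in> board n" using f k(2) by (auto simp: board_points_def)
          then show ?thesis using k by (auto simp: board_def)
        qed
        then have "?x \<in> ?P \<times> UNIV \<rightarrow>\<^sub>E {1..int n}" by (intro PiE_I) auto
        ultimately show "?x \<in> ?S n" unfolding mem_Collect_eq sat by blast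
      qed
    next
      fix x assume "x \<in> ?S n"
      then have "x \<in> extensional (?P \<times> UNIV)" by (auto simp: PiE_iff)
      then show "(\<lambda>(i, b)\<in>?P \<times> UNIV. if b then snd ((\<lambda>i\<in>?P. (x (i, False), x (i, True))) i)
          else fst ((\<lambda>i\<in>?P. (x (i, False), x (i, True))) i)) = x"
        by (auto simp: fun_eq_iff extensional_def)
    next
      fix f assume "f \<in> board_points M U n"
      then have "f \<in> extensional ?P" by (auto simp: board_points_def PiE_iff)
      then show "(\<lambda>i\<in>?P. ((\<lambda>(i, b)\<in>?P \<times> UNIV. if b then snd (f i) else fst (f i)) (i, False),
          (\<lambda>(i, b)\<in>?P \<times> UNIV. if b then snd (f i) else fst (f i)) (i, True))) = f"
        by (auto simp: fun_eq_iff extensional_def)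
    qed
    from bij_betw_same_card[OF this] show ?thesis by (simp only: alpha_eq_card_board_points)
  qed
  moreover have "quasipolynomial (\<lambda>n. real (card (?S n)))"
    by (rule quasipolynomial_cube_count) (use finite_edges[OF assms(1,2)] assms in auto)
  ultimately show ?thesis by (simp only:)
qed

text \<open>A point of \<open>U\<close> is determined by as many coordinates as \<open>U\<close> has dimensions in the
  space of its pieces.\<close>

lemma alpha_growth:
  assumes U: "U \<in> intersections M" and fin: "finite (pieces M U)"
  shows "alpha M U n \<le> (n + 1) ^ (2 * card (pieces M U) - codim U)"
proof -
  let ?P = "pieces M U"
  let ?V = "{v. satisfies (edges M U) (of_coord v)}"
  have comb: "\<forall>v\<in>?V. \<forall>w\<in>?V. \<forall>c. (\<lambda>j. v j + c * w j) \<in> ?V"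
  proof (intro ballI allI)
    fix v w c assume vw: "v \<in> ?V" "w \<in> ?V"
    have "of_coord (\<lambda>j. v j + c * w j) = (\<lambda>i. of_coord v i + c *\<^sub>R of_coord w i)"
      by (simp add: of_coord_def)
    then show "(\<lambda>j. v j + c * w j) \<in> ?V"
      using satisfies_combination[of _ "of_coord v" "of_coord w" c] vw by simp
  qed
  have finJ: "finite (?P \<times> (UNIV :: bool set))" using fin by simp
  have "(\<lambda>_. 0) \<in> ?V" using satisfies_const[of _ 0] by (simp add: of_coord_def zero_prod_def)
  from determining_coordinates[of "?P \<times> (UNIV :: bool set)" ?V, OF finJ comb this]
  obtain B where B: "B \<subseteq> ?P \<times> (UNIV :: bool set)"
    and det: "\<forall>v\<in>?V. (\<forall>j\<in>B. v j = 0) \<longrightarrow> (\<forall>j\<in>?P \<times> UNIV. v j = 0)"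
    and surj: "\<forall>b. \<exists>v\<in>?V. \<forall>j\<in>B. v j = b j"
    by (elim exE conjE)
  have "codim U + card B \<le> 2 * card ?P"
    by (rule codim_le_of_determining(2)[OF U fin B]) (use surj in blast)
  then have dim: "card B \<le> 2 * card ?P - codim U" by simp
  have finB: "finite B" by (rule finite_subset[OF B finJ])
  let ?g = "\<lambda>f. \<lambda>j\<in>B. if snd j then snd (f (fst j)) else fst (f (fst j))"
  have "inj_on ?g (board_points M U n)"
  proof (rule inj_onI)
    fix f g assume f: "f \<in> board_points M U n" and g: "g \<in> board_points M U n" and eq: "?g f = ?g g"
    define v where "v = coord (\<lambda>i. (point \<circ> f) i + (-1) *\<^sub>R (point \<circ> g) i)"
    have "satisfies (edges M U) (\<lambda>i. (point \<circ> f) i + (-1) *\<^sub>R (point \<circ> g) i)"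
      by (rule satisfies_combination[of _ "point \<circ> f" "point \<circ> g" "-1"])
        (use f g in \<open>simp_all add: board_points_def\<close>)
    then have "v \<in> ?V" by (simp add: v_def)
    moreover have "v j = 0" if "j \<in> B" for j
      using fun_cong[OF eq, of j] that by (auto simp: v_def coord_def point_def split: prod.splits if_splits)
    ultimately have v0: "v j = 0" if "j \<in> ?P \<times> UNIV" for j using det that by blast
    have "f i = g i" if "i \<in> ?P" for i
      using v0[of "(i, False)"] v0[of "(i, True)"] that by (simp add: v_def coord_def point_def prod_eq_iff)
    then show "f = g" using f g unfolding board_points_def by (auto intro: PiE_ext)
  qed
  moreover have "?g ` board_points M U n \<subseteq> B \<rightarrow>\<^sub>E {1..int n}"
  proof (rule image_subsetI, rule PiE_I)
    fix f j assume f: "f \<in> board_points M U n" and j: "j \<in> B"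
    have "fst j \<in> ?P" using j B by auto
    then have "f (fst j) \<in> board n" using f by (auto simp: board_points_def)
    then show "?g f j \<in> {1..int n}" using j by (auto simp: board_def)
  qed simp
  ultimately have "card (board_points M U n) \<le> card (B \<rightarrow>\<^sub>E {1..int n})"
    by (rule card_inj_on_le) (simp add: finite_PiE finB)
  also have "\<dots> = n ^ card B" using finB by (simp add: card_PiE)
  also have "\<dots> \<le> (n + 1) ^ card B" by (rule power_mono) auto
  also have "\<dots> \<le> (n + 1) ^ (2 * card ?P - codim U)" using dim by (rule power_increasing) simp
  finally show ?thesis by (simp add: alpha_eq_card_board_points)
qed

text \<open>The choice in the definition of \<open>gamma_bar\<close> is made from a nonempty set.\<close>

lemma gamma_bar_coeffs:
  assumes "U \<in> intersections M" "finite M" "finite (pieces M U)" "pieces M U \<noteq> {}"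
  shows "is_quasipoly_coeffs (\<lambda>n. real (alpha M U n)) (2 * card (pieces M U) - codim U)
    (\<lambda>j. gamma_bar M j U)"
proof -
  have "\<bar>real (alpha M U n)\<bar> \<le> real (n + 1) ^ (2 * card (pieces M U) - codim U)" for n
    using alpha_growth[OF assms(1,3), of n] by (metis abs_of_nat of_nat_le_iff of_nat_power)
  then obtain g where "is_quasipoly_coeffs (\<lambda>n. real (alpha M U n)) (2 * card (pieces M U) - codim U) g"
    using quasipolynomial_coeffs[OF quasipolynomial_alpha[OF assms(2-4)]] by blast
  from someI[of "is_quasipoly_coeffs _ _", OF this] show ?thesis unfolding gamma_bar_def .
qed

section \<open>Moebius inversion over the intersection subspaces\<close>

lemma pieces_antimono: "U \<subseteq> W \<Longrightarrow> pieces M W \<subseteq> pieces M U"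
  unfolding pieces_def by blast

lemma finite_intersections_on:
  assumes "finite M" "finite S"
  shows "finite {U \<in> intersections M. pieces M U \<subseteq> S}"
proof (rule finite_imageD)
  have "edges M ` {U \<in> intersections M. pieces M U \<subseteq> S} \<subseteq> Pow (M \<times> S \<times> S)"
    using edges_pieces by fast
  then show "finite (edges M ` {U \<in> intersections M. pieces M U \<subseteq> S})"
    using assms by (meson finite_Pow_iff finite_SigmaI finite_subset)
  show "inj_on (edges M) {U \<in> intersections M. pieces M U \<subseteq> S}"
  proof (rule inj_onI)
    fix U W assume "U \<in> {U \<in> intersections M. pieces M U \<subseteq> S}"
      "W \<in> {U \<in> intersections M. pieces M U \<subseteq> S}" "edges M U = edges M W"
    then show "U = W" using intersection_eq_edges[of U M] intersection_eq_edges[of W M] by simp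
  qed
qed

text \<open>The smallest intersection subspace with pieces in \<open>S\<close> that contains \<open>z\<close>.\<close>

definition flat :: "(int \<times> int) set \<Rightarrow> nat set \<Rightarrow> config \<Rightarrow> config set" where
  "flat M S z = {w \<in> Rinf. \<forall>m\<in>M. \<forall>i\<in>S. \<forall>j\<in>S. i \<noteq> j \<and> move_eqn m i j z \<longrightarrow> move_eqn m i j w}"

lemma flat_in_intersections:
  assumes "0 \<notin> S"
  shows "flat M S z \<in> intersections M"
proof -
  let ?F = "{hyp m i j | m i j. m \<in> M \<and> i \<in> S \<and> j \<in> S \<and> i \<noteq> j \<and> move_eqn m i j z}"
  have "flat M S z = Rinf \<inter> \<Inter>?F" unfolding flat_def hyp_def by blast
  moreover have "i > 0" if "i \<in> S" for i using that assms by (cases i) auto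
  then have "?F \<subseteq> arrangement M" unfolding arrangement_def by blast
  ultimately show ?thesis unfolding intersections_def by blast
qed

lemma hyp_proper:
  assumes "m \<noteq> (0, 0)" "i \<noteq> j" "i > 0"
  shows "\<exists>w\<in>Rinf. (\<forall>k. k \<noteq> i \<longrightarrow> w k = 0) \<and> w \<notin> hyp m i j"
proof -
  \<comment> \<open>A displacement of \<open>i\<close> along the normal of the line leaves the hyperplane.\<close>
  define w where "w k = (if k = i then (of_int (snd m), - of_int (fst m)) else 0 :: real \<times> real)" for k
  have "{k. w k \<noteq> 0} \<subseteq> {i}" by (auto simp: w_def)
  then have "finite {k. w k \<noteq> 0}" by (rule finite_subset) simp
  then have "w \<in> Rinf" using assms(3) by (simp add: Rinf_def w_def)
  moreover have "w \<notin> hyp m i j"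
  proof
    assume "w \<in> hyp m i j"
    then have "- (of_int (snd m) * of_int (snd m)) = (of_int (fst m) * of_int (fst m) :: real)"
      using assms(2) by (auto simp: hyp_def move_eqn_def w_def)
    then have "(of_int (snd m) :: real)\<^sup>2 + (of_int (fst m))\<^sup>2 = 0"
      unfolding power2_eq_square by linarith
    then show False using assms(1) by (simp add: sum_power2_eq_zero_iff prod_eq_iff)
  qed
  ultimately show ?thesis by (auto simp: w_def intro!: bexI[of _ w])
qed

text \<open>Equations among the pieces in \<open>S\<close> do not constrain any other piece \<open>i\<close>: the configuration that is
  zero except at \<open>i\<close> satisfies them all.\<close>

lemma pieces_flat:
  assumes nz: "\<And>m. m \<in> M \<Longrightarrow> m \<noteq> (0, 0)"
  shows "pieces M (flat M S z) \<subseteq> S"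
proof
  fix i assume "i \<in> pieces M (flat M S z)"
  then obtain m j where m: "m \<in> M" "i > 0" "j \<noteq> i" "flat M S z \<subseteq> hyp m i j"
    by (auto simp: pieces_def)
  show "i \<in> S"
  proof (rule ccontr)
    assume i: "i \<notin> S"
    obtain w where w: "w \<in> Rinf" "\<forall>k. k \<noteq> i \<longrightarrow> w k = 0" "w \<notin> hyp m i j"
      using hyp_proper[of m i j] nz m by blast
    have "move_eqn m' k l w" if "k \<in> S" "l \<in> S" for m' k l
    proof -
      have "k \<noteq> i" "l \<noteq> i" using i that by auto
      then have "w k = 0" "w l = 0" using w(2) by auto
      then show ?thesis by (simp add: move_eqn_def)
    qed
    then have "w \<in> flat M S z" using w(1) unfolding flat_def by blast
    then show False using m(4) w(3) by blast
  qed
qed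

lemma mem_iff_flat_subset:
  assumes U: "U \<in> intersections M" "pieces M U \<subseteq> S" and z: "z \<in> Rinf"
  shows "z \<in> U \<longleftrightarrow> flat M S z \<subseteq> U"
proof
  assume zU: "z \<in> U"
  show "flat M S z \<subseteq> U"
  proof
    fix w assume w: "w \<in> flat M S z"
    have "move_eqn m i j w" if e: "(m, i, j) \<in> edges M U" for m i j
    proof -
      have "move_eqn m i j z" using e zU by (auto simp: edges_def hyp_def)
      moreover have "m \<in> M" "i \<in> S" "j \<in> S" "i \<noteq> j" using edges_pieces[OF e] U(2) by auto
      ultimately show ?thesis using w unfolding flat_def by blast
    qed
    then have "satisfies (edges M U) w" unfolding satisfies_def by blast
    then show "w \<in> U" using w intersection_eq_edges[OF U(1)] unfolding flat_def by blast
  qed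
next
  assume "flat M S z \<subseteq> U"
  moreover have "z \<in> flat M S z" using z by (simp add: flat_def)
  ultimately show "z \<in> U" by blast
qed

lemma flat_eq_Rinf_iff:
  assumes nz: "\<And>m. m \<in> M \<Longrightarrow> m \<noteq> (0, 0)" and S: "0 \<notin> S"
  shows "flat M S z = Rinf \<longleftrightarrow> (\<forall>m\<in>M. \<forall>i\<in>S. \<forall>j\<in>S. i \<noteq> j \<longrightarrow> \<not> move_eqn m i j z)"
proof
  assume eq: "flat M S z = Rinf"
  show "\<forall>m\<in>M. \<forall>i\<in>S. \<forall>j\<in>S. i \<noteq> j \<longrightarrow> \<not> move_eqn m i j z"
  proof (intro ballI impI notI)
    fix m i j assume a: "m \<in> M" "i \<in> S" "j \<in> S" "i \<noteq> j" "move_eqn m i j z"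
    have "i > 0" using a(2) S by (cases i) auto
    then obtain w where w: "w \<in> Rinf" "w \<notin> hyp m i j"
      using hyp_proper[of m i j] nz a(1,4) by blast
    then have "w \<in> flat M S z" using eq by simp
    then have "move_eqn m i j w" using a unfolding flat_def by blast
    then show False using w by (simp add: hyp_def)
  qed
next
  assume none: "\<forall>m\<in>M. \<forall>i\<in>S. \<forall>j\<in>S. i \<noteq> j \<longrightarrow> \<not> move_eqn m i j z"
  show "flat M S z = Rinf"
  proof
    show "Rinf \<subseteq> flat M S z" using none unfolding flat_def by blast
  qed (simp add: flat_def)
qed

lemma Rinf_in_intersections: "Rinf \<in> intersections M"
  unfolding intersections_def by (rule CollectI, rule exI[of _ "{}"]) simp

lemma intersections_subset_Rinf: "U \<in> intersections M \<Longrightarrow> U \<subseteq> Rinf"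
  by (auto simp: intersections_def)

text \<open>This is the recursion for the Moebius function, with the term of \<open>B\<close> moved to the left.\<close>

lemma moebius_interval_sum:
  assumes "A \<in> L" "B \<in> L" "B \<subseteq> A" "finite {C \<in> L. B \<subseteq> C \<and> C \<subseteq> A}"
  shows "(\<Sum>C \<in> {C \<in> L. B \<subseteq> C \<and> C \<subseteq> A}. moebius_mu L A C) = (if B = A then 1 else 0)"
proof (cases "B = A")
  case True
  then have "{C \<in> L. B \<subseteq> C \<and> C \<subseteq> A} = {A}" using assms(1) by blast
  then show ?thesis using True by (simp add: moebius_mu.simps)
next
  case False
  let ?I = "{C \<in> L. B \<subset> C \<and> C \<subseteq> A}"
  have eq: "{C \<in> L. B \<subseteq> C \<and> C \<subseteq> A} = insert B ?I" using assms(2,3) by blast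
  have fin: "finite ?I" using assms(4) unfolding eq by simp
  have "B \<subset> A" "A \<noteq> B" using assms(3) False by auto
  then have "moebius_mu L A B = - (\<Sum>C \<in> ?I. moebius_mu L A C)"
    using fin by (subst moebius_mu.simps) simp
  then show ?thesis using fin False unfolding eq by (subst sum.insert) auto
qed

text \<open>The subspaces with pieces in \<open>S\<close> that contain \<open>z\<close> form the interval between \<open>flat M S z\<close> and the
  whole space, and the Moebius function sums to zero over an interval with more than one element.\<close>

lemma moebius_inversion:
  assumes M: "finite M" "\<And>m. m \<in> M \<Longrightarrow> m \<noteq> (0, 0)" and S: "finite S" "0 \<notin> S" and z: "z \<in> Rinf"
  shows "(\<Sum>U \<in> {U \<in> intersections M. pieces M U \<subseteq> S}. if z \<in> U then moebius_mu (intersections M) Rinf U else 0) =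
    (if \<forall>m\<in>M. \<forall>i\<in>S. \<forall>j\<in>S. i \<noteq> j \<longrightarrow> \<not> move_eqn m i j z then 1 else 0)"
proof -
  let ?L = "{U \<in> intersections M. pieces M U \<subseteq> S}"
  let ?I = "{U \<in> intersections M. flat M S z \<subseteq> U \<and> U \<subseteq> Rinf}"
  have fin: "finite ?L" using finite_intersections_on M(1) S(1) .
  have I: "?I = {U \<in> ?L. z \<in> U}"
  proof (rule set_eqI)
    fix U
    show "U \<in> ?I \<longleftrightarrow> U \<in> {U \<in> ?L. z \<in> U}"
    proof
      assume U: "U \<in> ?I"
      then have "pieces M U \<subseteq> S" using pieces_antimono pieces_flat[of M, OF M(2)] by blast
      then show "U \<in> {U \<in> ?L. z \<in> U}" using U mem_iff_flat_subset[of U M S z] z by simp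
    next
      assume U: "U \<in> {U \<in> ?L. z \<in> U}"
      then show "U \<in> ?I"
        using mem_iff_flat_subset[of U M S z] z intersections_subset_Rinf[of U M] by simp
    qed
  qed
  have "(\<Sum>U \<in> ?L. if z \<in> U then moebius_mu (intersections M) Rinf U else 0) =
      (\<Sum>U \<in> ?I. moebius_mu (intersections M) Rinf U)"
    unfolding I using fin by (subst sum.inter_filter) auto
  also have "\<dots> = (if flat M S z = Rinf then 1 else 0)"
  proof (rule moebius_interval_sum)
    show "finite ?I" unfolding I by (rule finite_subset[OF _ fin]) auto
    show "flat M S z \<in> intersections M" by (rule flat_in_intersections) fact
    show "flat M S z \<subseteq> Rinf" by (auto simp: flat_def)
  qed (rule Rinf_in_intersections)
  finally show ?thesis using flat_eq_Rinf_iff[of M S z] M(2) S(2) by simp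
qed

section \<open>Labelled placements\<close>

text \<open>Lying on a common line in the direction \<open>(c, d)\<close> and differing by an integer multiple of \<open>(c, d)\<close> are the same
  for integer points, because \<open>c\<close> and \<open>d\<close> are coprime.\<close>

lemma attacks_iff_move_eqn:
  assumes "rider M" "f i = p" "f j = q"
  shows "attacks M p q \<longleftrightarrow> (\<exists>m\<in>M. move_eqn m i j (point \<circ> f))"
proof -
  have "(\<exists>k. fst q - fst p = k * c \<and> snd q - snd p = k * d) \<longleftrightarrow> move_eqn (c, d) i j (point \<circ> f)"
    if cd: "(c, d) \<in> M" for c d
  proof -
    have cop: "coprime c d" using assms(1) cd by (auto simp: rider_def)
    let ?x = "fst q - fst p" and ?y = "snd q - snd p"
    have "(\<exists>k. ?x = k * c \<and> ?y = k * d) \<longleftrightarrow> d * ?x = c * ?y"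
    proof
      assume eq: "d * ?x = c * ?y"
      then have "c dvd d * ?x" by simp
      then have "c dvd ?x" using cop by (simp add: coprime_dvd_mult_right_iff)
      then obtain k where k: "?x = k * c" by (metis dvd_def mult.commute)
      show "\<exists>k. ?x = k * c \<and> ?y = k * d"
      proof (cases "c = 0")
        case True
        then have d: "d * d = 1" using cop by (auto simp: abs_if split: if_splits)
        have "?x = 0" using k True by simp
        moreover have "?y = (?y * d) * d" using d by (simp only: mult.assoc mult_1_right)
        ultimately show ?thesis using True by (intro exI[of _ "?y * d"]) simp
      next
        case False
        have "c * ?y = c * (k * d)" using eq unfolding k by (metis mult.assoc mult.commute)
        then have "?y = k * d" using mult_left_cancel[OF False] by blast
        then show ?thesis using k by blast
      qed
    qed (auto simp: mult_ac)
    moreover have "move_eqn (c, d) i j (point \<circ> f) \<longleftrightarrow> real_of_int (d * ?x) = real_of_int (c * ?y)"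
      using assms(2,3) by (simp add: move_eqn_def point_def)
    ultimately show ?thesis unfolding of_int_eq_iff by simp
  qed
  then show ?thesis unfolding attacks_def by fast
qed

definition labelled_placements :: "(int \<times> int) set \<Rightarrow> nat \<Rightarrow> (nat \<Rightarrow> int \<times> int) set" where
  "labelled_placements M n = {f \<in> {1..n} \<rightarrow>\<^sub>E board n.
     \<forall>i\<in>{1..n}. \<forall>j\<in>{1..n}. i \<noteq> j \<longrightarrow> \<not> attacks M (f i) (f j)}"

lemma card_injections:
  assumes "finite A" "finite B"
  shows "real (card {f \<in> A \<rightarrow>\<^sub>E B. inj_on f A}) = falling_factorial (card B) (card A)"
proof -
  have c: "card {f \<in> A \<rightarrow>\<^sub>E B. inj_on f A} = (\<Prod>l<card A. card B - l)"
    using card_inj_on_subset_funcset[OF assms order_refl] by (simp add: lessThan_atLeast0)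
  show ?thesis
  proof (cases "card A \<le> card B")
    case True
    have "real (\<Prod>l<card A. card B - l) = (\<Prod>l<card A. real (card B) - real l)"
      unfolding of_nat_prod using True by (intro prod.cong) (auto simp: of_nat_diff)
    then show ?thesis unfolding c falling_factorial_def .
  next
    case False
    then have "card B \<in> {..<card A}" by simp
    then have "(\<Prod>l<card A. card B - l) = 0" "(\<Prod>l<card A. real (card B) - real l) = 0"
      by (intro prod_zero bexI[of _ "card B"]; simp)+
    then show ?thesis unfolding c falling_factorial_def by (simp only: of_nat_0)
  qed
qed

lemma falling_factorial_self: "falling_factorial n n = fact n"
proof -
  have "falling_factorial n n = (\<Prod>l<n. real (n - l))"
    unfolding falling_factorial_def by (intro prod.cong) (auto simp: of_nat_diff)
  also have "\<dots> = fact n" by (simp add: fact_prod_rev lessThan_atLeast0)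
  finally show ?thesis .
qed

text \<open>Every square attacks itself, so the labels sit on different squares and each placement of
  unlabelled pieces carries \<open>n!\<close> labellings.\<close>

lemma card_labelled_placements:
  assumes "rider M"
  shows "real (card (labelled_placements M n)) = fact n * real (nonattacking_count M n n)"
proof -
  let ?N = "{S. S \<subseteq> board n \<and> card S = n \<and> (\<forall>z\<in>S. \<forall>z'\<in>S. z \<noteq> z' \<longrightarrow> \<not> attacks M z z')}"
  let ?F = "\<lambda>S. {f \<in> {1..n} \<rightarrow>\<^sub>E S. inj_on f {1..n}}"
  have refl: "attacks M p p" for p
    using assms unfolding rider_def attacks_def by fastforce
  have finN: "finite ?N" by (rule finite_subset[of _ "Pow (board n)"]) (auto simp: finite_board)
  have finS: "finite S" if "S \<in> ?N" for S using that finite_board finite_subset by blast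
  have image: "f ` {1..n} = S" if "S \<in> ?N" "f \<in> ?F S" for S f
  proof (rule card_subset_eq)
    show "finite S" using finS that(1) .
    show "card (f ` {1..n}) = card S" using that by (simp add: card_image)
  qed (use that in auto)
  have "labelled_placements M n = (\<Union>S\<in>?N. ?F S)"
  proof
    show "labelled_placements M n \<subseteq> (\<Union>S\<in>?N. ?F S)"
    proof
      fix f assume f: "f \<in> labelled_placements M n"
      have inj: "inj_on f {1..n}"
      proof (rule inj_onI, rule ccontr)
        fix i j assume ij: "i \<in> {1..n}" "j \<in> {1..n}" "f i = f j" "i \<noteq> j"
        then have "\<not> attacks M (f i) (f j)" using f unfolding labelled_placements_def by blast
        then show False using refl[of "f j"] ij(3) by simp
      qed
      then have "f ` {1..n} \<in> ?N" using f by (auto simp: labelled_placements_def card_image)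
      moreover have "f \<in> ?F (f ` {1..n})" using f inj by (auto simp: labelled_placements_def PiE_iff)
      ultimately show "f \<in> (\<Union>S\<in>?N. ?F S)" by (rule UN_I)
    qed
    show "(\<Union>S\<in>?N. ?F S) \<subseteq> labelled_placements M n"
    proof
      fix f assume "f \<in> (\<Union>S\<in>?N. ?F S)"
      then obtain S where S: "S \<in> ?N" and f: "f \<in> {1..n} \<rightarrow>\<^sub>E S" "inj_on f {1..n}" by blast
      have "f \<in> {1..n} \<rightarrow>\<^sub>E board n" using PiE_mono[of "{1..n}" "\<lambda>_. S" "\<lambda>_. board n"] S f(1) by blast
      moreover have "\<not> attacks M (f i) (f j)" if "i \<in> {1..n}" "j \<in> {1..n}" "i \<noteq> j" for i j
      proof -
        have "f i \<in> S" "f j \<in> S" using f(1) that by auto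
        moreover have "f i \<noteq> f j" using f(2) that by (auto dest: inj_onD)
        ultimately show ?thesis using S by blast
      qed
      ultimately show "f \<in> labelled_placements M n" unfolding labelled_placements_def by blast
    qed
  qed
  moreover have "card (\<Union>S\<in>?N. ?F S) = (\<Sum>S\<in>?N. card (?F S))"
  proof (rule card_UN_disjoint[OF finN]; intro ballI impI)
    fix S assume S: "S \<in> ?N"
    show "finite (?F S)"
      by (rule finite_subset[of _ "{1..n} \<rightarrow>\<^sub>E S"]) (use finS[OF S] in \<open>auto intro: finite_PiE\<close>)
    fix T assume T: "T \<in> ?N" "S \<noteq> T"
    show "?F S \<inter> ?F T = {}"
    proof (rule equals0I)
      fix f assume f: "f \<in> ?F S \<inter> ?F T"
      have "f ` {1..n} = S" by (rule image[OF S IntD1[OF f]])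
      moreover have "f ` {1..n} = T" by (rule image[OF T(1) IntD2[OF f]])
      ultimately show False using T(2) by simp
    qed
  qed
  ultimately have "card (labelled_placements M n) = (\<Sum>S\<in>?N. card (?F S))" by (simp only:)
  then have "real (card (labelled_placements M n)) = (\<Sum>S\<in>?N. real (card (?F S)))" by simp
  also have "\<dots> = (\<Sum>S\<in>?N. fact n)"
  proof (rule sum.cong)
    fix S assume S: "S \<in> ?N"
    have "real (card (?F S)) = falling_factorial (card S) (card {1..n})"
      by (rule card_injections[OF _ finS[OF S]]) simp
    moreover have "card S = n" using S by blast
    ultimately show "real (card (?F S)) = fact n"
      by (simp only: card_atLeastAtMost diff_Suc_1 falling_factorial_self)
  qed simp
  finally show ?thesis by (simp add: nonattacking_count_def)
qed


definition labelled_config :: "nat \<Rightarrow> (nat \<Rightarrow> int \<times> int) \<Rightarrow> config" where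
  "labelled_config n f = (\<lambda>i. if i \<in> {1..n} then point (f i) else 0)"

lemma labelled_config_Rinf: "labelled_config n f \<in> Rinf"
proof -
  have "{i. labelled_config n f i \<noteq> 0} \<subseteq> {1..n}" by (auto simp: labelled_config_def)
  then have "finite {i. labelled_config n f i \<noteq> 0}" by (rule finite_subset) simp
  then show ?thesis by (simp add: Rinf_def labelled_config_def)
qed

text \<open>Membership in \<open>U\<close> concerns the pieces of \<open>U\<close> only; the other pieces choose their squares freely.\<close>

lemma card_labelled_in_subspace:
  assumes U: "U \<in> intersections M" "pieces M U \<subseteq> {1..n}"
  shows "card {f \<in> {1..n} \<rightarrow>\<^sub>E board n. labelled_config n f \<in> U} =
    alpha M U n * n ^ (2 * (n - card (pieces M U)))"
proof -
  let ?P = "pieces M U" and ?A = "{f \<in> {1..n} \<rightarrow>\<^sub>E board n. labelled_config n f \<in> U}"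
  let ?R = "({1..n} - ?P) \<rightarrow>\<^sub>E board n"
  have mem: "labelled_config n f \<in> U \<longleftrightarrow> satisfies (edges M U) (point \<circ> f)" for f
  proof -
    have "labelled_config n f \<in> U \<longleftrightarrow> satisfies (edges M U) (labelled_config n f)"
      using intersection_eq_edges[OF U(1)] labelled_config_Rinf by blast
    also have "\<dots> \<longleftrightarrow> satisfies (edges M U) (point \<circ> f)"
      by (rule satisfies_edges_cong) (use U(2) in \<open>auto simp: labelled_config_def\<close>)
    finally show ?thesis .
  qed
  have cong: "satisfies (edges M U) (point \<circ> f) \<longleftrightarrow> satisfies (edges M U) (point \<circ> g)"
    if "\<And>i. i \<in> ?P \<Longrightarrow> f i = g i" for f g
    by (rule satisfies_edges_cong) (simp add: that)
  have "bij_betw (\<lambda>f. (restrict f ?P, restrict f ({1..n} - ?P))) ?A (board_points M U n \<times> ?R)"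
  proof (rule bij_betwI[where g = "\<lambda>(g, h). \<lambda>i\<in>{1..n}. if i \<in> ?P then g i else h i"])
    show "(\<lambda>f. (restrict f ?P, restrict f ({1..n} - ?P))) \<in> ?A \<rightarrow> board_points M U n \<times> ?R"
    proof
      fix f assume f: "f \<in> ?A"
      have "satisfies (edges M U) (point \<circ> restrict f ?P)"
        using f cong[of "restrict f ?P" f] by (simp add: mem)
      then show "(restrict f ?P, restrict f ({1..n} - ?P)) \<in> board_points M U n \<times> ?R"
        using f U(2) by (auto simp: board_points_def)
    qed
  next
    show "(\<lambda>(g, h). \<lambda>i\<in>{1..n}. if i \<in> ?P then g i else h i) \<in> board_points M U n \<times> ?R \<rightarrow> ?A"
    proof (rule Pi_I, clarify)
      fix g h assume g: "g \<in> board_points M U n" and h: "h \<in> ?R"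
      let ?f = "\<lambda>i\<in>{1..n}. if i \<in> ?P then g i else h i"
      have "?f i = g i" if "i \<in> ?P" for i using that U(2) by auto
      then have "satisfies (edges M U) (point \<circ> ?f) \<longleftrightarrow> satisfies (edges M U) (point \<circ> g)"
        by (rule cong)
      then have "satisfies (edges M U) (point \<circ> ?f)"
        using g unfolding board_points_def by blast
      moreover have "?f i \<in> board n" if i: "i \<in> {1..n}" for i
      proof -
        have "g \<in> ?P \<rightarrow>\<^sub>E board n" using g by (simp add: board_points_def)
        then have "i \<in> ?P \<Longrightarrow> g i \<in> board n" by (rule PiE_mem)
        moreover have "i \<notin> ?P \<Longrightarrow> h i \<in> board n" using PiE_mem[OF h, of i] i by blast
        ultimately show ?thesis using i by auto
      qed
      then have "?f \<in> {1..n} \<rightarrow>\<^sub>E board n" by (intro PiE_I) auto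
      ultimately show "?f \<in> {1..n} \<rightarrow>\<^sub>E board n \<and> labelled_config n ?f \<in> U" by (simp add: mem)
    qed
  next
    fix f assume "f \<in> ?A"
    then show "(case (restrict f ?P, restrict f ({1..n} - ?P)) of
        (g, h) \<Rightarrow> \<lambda>i\<in>{1..n}. if i \<in> ?P then g i else h i) = f"
      by (auto simp: fun_eq_iff PiE_iff extensional_def)
  next
    fix y assume y: "y \<in> board_points M U n \<times> ?R"
    obtain g h where gh: "y = (g, h)" by (cases y)
    let ?f = "\<lambda>i\<in>{1..n}. if i \<in> ?P then g i else h i"
    have gh_ext: "g \<in> extensional ?P" "h \<in> extensional ({1..n} - ?P)"
      using y by (auto simp: gh board_points_def PiE_iff)
    have f1: "restrict ?f ?P x = g x" for x
      using gh_ext(1) U(2) by (cases "x \<in> ?P") (auto simp: extensional_def)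
    have f2: "restrict ?f ({1..n} - ?P) x = h x" for x
      using gh_ext(2) by (cases "x \<in> {1..n} - ?P") (auto simp: extensional_def)
    have "restrict ?f ?P = g" by (rule ext, rule f1)
    moreover have "restrict ?f ({1..n} - ?P) = h" by (rule ext, rule f2)
    ultimately show "(restrict (case y of (g, h) \<Rightarrow> \<lambda>i\<in>{1..n}. if i \<in> ?P then g i else h i) ?P,
        restrict (case y of (g, h) \<Rightarrow> \<lambda>i\<in>{1..n}. if i \<in> ?P then g i else h i) ({1..n} - ?P)) = y"
      by (simp only: gh prod.case)
  qed
  then have "card ?A = card (board_points M U n) * card ?R"
    by (simp only: bij_betw_same_card card_cartesian_product)
  moreover have "card ?R = n ^ (2 * (n - card ?P))"
  proof -
    have "card ({1..n} - ?P) = n - card ?P"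
      using U(2) finite_subset[OF U(2)] by (simp add: card_Diff_subset)
    then show ?thesis by (simp add: card_PiE card_board power_mult)
  qed
  ultimately show ?thesis by (simp add: alpha_eq_card_board_points)
qed

theorem labelled_count_by_subspaces:
  assumes "rider M"
  shows "fact n * real (nonattacking_count M n n) =
    (\<Sum>U \<in> {U \<in> intersections M. pieces M U \<subseteq> {1..n}}.
      of_int (moebius_mu (intersections M) Rinf U) * (real (alpha M U n) * real n ^ (2 * (n - card (pieces M U)))))"
proof -
  let ?L = "{U \<in> intersections M. pieces M U \<subseteq> {1..n}}"
  let ?\<mu> = "moebius_mu (intersections M) Rinf"
  let ?A = "{1..n} \<rightarrow>\<^sub>E board n"
  have M: "finite M" "\<And>m. m \<in> M \<Longrightarrow> m \<noteq> (0, 0)" using assms by (auto simp: rider_def)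
  have finL: "finite ?L" by (rule finite_intersections_on[OF M(1)]) simp
  have finA: "finite ?A" by (simp add: finite_PiE finite_board)
  have indicator: "(\<Sum>U\<in>?L. if labelled_config n f \<in> U then ?\<mu> U else 0) =
      (if f \<in> labelled_placements M n then 1 else 0)" if f: "f \<in> ?A" for f
  proof -
    have "f \<in> labelled_placements M n \<longleftrightarrow>
        (\<forall>i\<in>{1..n}. \<forall>j\<in>{1..n}. i \<noteq> j \<longrightarrow> \<not> (\<exists>m\<in>M. move_eqn m i j (point \<circ> f)))"
      using f attacks_iff_move_eqn[OF assms, of f _ _ _] by (simp add: labelled_placements_def)
    also have "\<dots> \<longleftrightarrow> (\<forall>m\<in>M. \<forall>i\<in>{1..n}. \<forall>j\<in>{1..n}. i \<noteq> j \<longrightarrow> \<not> move_eqn m i j (labelled_config n f))"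
      by (auto simp: move_eqn_def labelled_config_def)
    finally show ?thesis
      using moebius_inversion[OF M, of "{1..n}" "labelled_config n f"] labelled_config_Rinf by simp
  qed
  have "labelled_placements M n = {f \<in> ?A. f \<in> labelled_placements M n}"
    by (auto simp: labelled_placements_def)
  then have "int (card (labelled_placements M n)) = (\<Sum>f\<in>?A. if f \<in> labelled_placements M n then 1 else 0)"
    using finA by (subst sum.inter_filter[symmetric]) (simp_all flip: card_eq_sum)
  also have "\<dots> = (\<Sum>f\<in>?A. \<Sum>U\<in>?L. if labelled_config n f \<in> U then ?\<mu> U else 0)"
    using indicator by (intro sum.cong) simp_all
  also have "\<dots> = (\<Sum>U\<in>?L. \<Sum>f\<in>?A. if labelled_config n f \<in> U then ?\<mu> U else 0)"
    by (rule sum.swap)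
  also have "\<dots> = (\<Sum>U\<in>?L. ?\<mu> U * int (card {f \<in> ?A. labelled_config n f \<in> U}))"
    using finA by (intro sum.cong) (simp_all flip: sum.inter_filter add: mult.commute)
  also have "\<dots> = (\<Sum>U\<in>?L. ?\<mu> U * int (alpha M U n * n ^ (2 * (n - card (pieces M U)))))"
  proof (rule sum.cong[OF refl])
    fix U assume "U \<in> ?L"
    then have "U \<in> intersections M" "pieces M U \<subseteq> {1..n}" by simp_all
    then show "?\<mu> U * int (card {f \<in> ?A. labelled_config n f \<in> U}) =
        ?\<mu> U * int (alpha M U n * n ^ (2 * (n - card (pieces M U))))"
      by (simp only: card_labelled_in_subspace)
  qed
  finally have "real_of_int (int (card (labelled_placements M n))) =
      real_of_int (\<Sum>U\<in>?L. ?\<mu> U * int (alpha M U n * n ^ (2 * (n - card (pieces M U)))))"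
    by (simp only:)
  then show ?thesis using card_labelled_placements[OF assms, of n] by simp
qed

section \<open>Invariance under relabelling\<close>

abbreviation relabelling :: "(nat \<Rightarrow> nat) \<Rightarrow> bool" where
  "relabelling \<pi> \<equiv> \<pi> permutes {0<..}"

lemma relabelling_0: "relabelling \<pi> \<Longrightarrow> \<pi> 0 = 0"
  by (erule permutes_not_in) simp

lemma relabelling_inv: "relabelling \<pi> \<Longrightarrow> relabelling (inv \<pi>)"
  by (rule permutes_inv)

lemma comp_in_Rinf:
  assumes "relabelling \<pi>" "z \<in> Rinf"
  shows "z \<circ> \<pi> \<in> Rinf"
proof -
  have "{i. (z \<circ> \<pi>) i \<noteq> 0} = \<pi> -` {i. z i \<noteq> 0}" by auto
  moreover have "finite (\<pi> -` {i. z i \<noteq> 0})"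
    using assms permutes_inj[OF assms(1)] by (intro finite_vimageI) (auto simp: Rinf_def)
  moreover have "(z \<circ> \<pi>) 0 = 0"
    using relabelling_0[OF assms(1)] assms(2) by (simp add: Rinf_def)
  ultimately show ?thesis by (simp add: Rinf_def)
qed

lemma comp_in_Rinf_iff: "relabelling \<pi> \<Longrightarrow> z \<circ> \<pi> \<in> Rinf \<longleftrightarrow> z \<in> Rinf"
proof
  assume \<pi>: "relabelling \<pi>" and z: "z \<circ> \<pi> \<in> Rinf"
  have "(z \<circ> \<pi>) \<circ> inv \<pi> \<in> Rinf" by (rule comp_in_Rinf[OF relabelling_inv[OF \<pi>] z])
  then show "z \<in> Rinf" by (simp add: comp_assoc permutes_inv_o(1)[OF \<pi>])
qed (rule comp_in_Rinf)

lemma relabel_comp: "relabel \<pi> (relabel \<sigma> U) = relabel (\<pi> \<circ> \<sigma>) U"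
  by (simp add: relabel_def comp_assoc)

lemma relabel_id: "relabel id U = U"
  by (simp add: relabel_def)

lemma relabel_inv:
  assumes "relabelling \<pi>"
  shows "relabel (inv \<pi>) (relabel \<pi> U) = U" "relabel \<pi> (relabel (inv \<pi>) U) = U"
  using assms by (simp_all add: relabel_comp permutes_inv_o relabel_id)

lemma relabel_mono: "U \<subseteq> W \<Longrightarrow> relabel \<pi> U \<subseteq> relabel \<pi> W"
  by (auto simp: relabel_def)

lemma relabel_subset_iff:
  assumes "relabelling \<pi>"
  shows "relabel \<pi> U \<subseteq> relabel \<pi> W \<longleftrightarrow> U \<subseteq> W"
  using relabel_mono[of "relabel \<pi> U" "relabel \<pi> W" "inv \<pi>"] relabel_mono[of U W \<pi>]
  unfolding relabel_inv[OF assms] by blast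

lemma relabel_Rinf: "relabelling \<pi> \<Longrightarrow> relabel \<pi> Rinf = Rinf"
  unfolding relabel_def by (simp add: comp_in_Rinf_iff)

lemma relabel_hyp: "relabelling \<pi> \<Longrightarrow> relabel \<pi> (hyp m i j) = hyp m (\<pi> i) (\<pi> j)"
  unfolding relabel_def hyp_def by (simp add: comp_in_Rinf_iff) (simp add: move_eqn_def)

lemma relabelling_pos_iff: "relabelling \<pi> \<Longrightarrow> \<pi> i > 0 \<longleftrightarrow> i > 0"
  using permutes_in_image[of \<pi> "{0<..}" i] by simp

lemma edges_relabel:
  assumes \<pi>: "relabelling \<pi>"
  shows "(m, \<pi> i, \<pi> j) \<in> edges M (relabel \<pi> U) \<longleftrightarrow> (m, i, j) \<in> edges M U"
proof -
  have "relabel \<pi> U \<subseteq> hyp m (\<pi> i) (\<pi> j) \<longleftrightarrow> U \<subseteq> hyp m i j"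
    unfolding relabel_hyp[OF \<pi>, symmetric] by (rule relabel_subset_iff[OF \<pi>])
  moreover have "\<pi> i = \<pi> j \<longleftrightarrow> i = j" using permutes_inj[OF \<pi>] by (rule inj_eq)
  ultimately show ?thesis using relabelling_pos_iff[OF \<pi>] by (simp add: edges_def)
qed

lemma satisfies_edges_relabel:
  assumes \<pi>: "relabelling \<pi>"
  shows "satisfies (edges M (relabel \<pi> U)) z \<longleftrightarrow> satisfies (edges M U) (z \<circ> \<pi>)"
proof
  assume s: "satisfies (edges M (relabel \<pi> U)) z"
  have "move_eqn m i j (z \<circ> \<pi>)" if "(m, i, j) \<in> edges M U" for m i j
  proof -
    have "(m, \<pi> i, \<pi> j) \<in> edges M (relabel \<pi> U)" using that by (simp add: edges_relabel[OF \<pi>])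
    then have "move_eqn m (\<pi> i) (\<pi> j) z" using s by (auto simp: satisfies_def)
    then show ?thesis by (simp add: move_eqn_def)
  qed
  then show "satisfies (edges M U) (z \<circ> \<pi>)" by (auto simp: satisfies_def)
next
  assume s: "satisfies (edges M U) (z \<circ> \<pi>)"
  have "move_eqn m i j z" if e: "(m, i, j) \<in> edges M (relabel \<pi> U)" for m i j
  proof -
    obtain i' j' where ij: "i = \<pi> i'" "j = \<pi> j'" using permutes_surj[OF \<pi>] by (meson surjD)
    then have "(m, i', j') \<in> edges M U" using e edges_relabel[OF \<pi>] by simp
    then have "move_eqn m i' j' (z \<circ> \<pi>)" using s by (auto simp: satisfies_def)
    then show ?thesis by (simp add: move_eqn_def ij)
  qed
  then show "satisfies (edges M (relabel \<pi> U)) z" by (auto simp: satisfies_def)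
qed

lemma pieces_relabel:
  assumes \<pi>: "relabelling \<pi>"
  shows "pieces M (relabel \<pi> U) = \<pi> ` pieces M U"
proof
  show "\<pi> ` pieces M U \<subseteq> pieces M (relabel \<pi> U)"
    unfolding pieces_edges using edges_relabel[OF \<pi>] by blast
  show "pieces M (relabel \<pi> U) \<subseteq> \<pi> ` pieces M U"
  proof
    fix i assume "i \<in> pieces M (relabel \<pi> U)"
    then obtain m j where e: "(m, i, j) \<in> edges M (relabel \<pi> U)" by (auto simp: pieces_edges)
    obtain i' j' where ij: "i = \<pi> i'" "j = \<pi> j'" using permutes_surj[OF \<pi>] by (meson surjD)
    then have "(m, i', j') \<in> edges M U" using e edges_relabel[OF \<pi>] by simp
    then show "i \<in> \<pi> ` pieces M U" unfolding pieces_edges ij by blast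
  qed
qed

lemma card_pieces_relabel: "relabelling \<pi> \<Longrightarrow> card (pieces M (relabel \<pi> U)) = card (pieces M U)"
  by (simp add: pieces_relabel card_image permutes_inj_on)

lemma relabel_in_intersections:
  assumes \<pi>: "relabelling \<pi>" and U: "U \<in> intersections M"
  shows "relabel \<pi> U \<in> intersections M"
proof -
  obtain F where F: "U = Rinf \<inter> \<Inter>F" "F \<subseteq> arrangement M"
    using U by (auto simp: intersections_def)
  have "relabel \<pi> U = relabel \<pi> Rinf \<inter> \<Inter>(relabel \<pi> ` F)"
    unfolding F(1) relabel_def by auto
  moreover have "relabel \<pi> ` F \<subseteq> arrangement M"
  proof
    fix H assume "H \<in> relabel \<pi> ` F"
    then obtain m i j where H: "H = relabel \<pi> (hyp m i j)" "m \<in> M" "i > 0" "j > 0" "i \<noteq> j"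
      using F(2) by (auto simp: arrangement_def)
    have "H = hyp m (\<pi> i) (\<pi> j)" "\<pi> i > 0" "\<pi> j > 0" "\<pi> i \<noteq> \<pi> j"
      using H relabel_hyp[OF \<pi>] relabelling_pos_iff[OF \<pi>] inj_eq[OF permutes_inj[OF \<pi>]] by simp_all
    then show "H \<in> arrangement M" using H(2) unfolding arrangement_def by blast
  qed
  ultimately show ?thesis unfolding intersections_def relabel_Rinf[OF \<pi>] by blast
qed

lemma spans_modulo_relabel:
  assumes \<pi>: "relabelling \<pi>" and span: "spans_modulo U k"
  shows "spans_modulo (relabel \<pi> U) k"
proof -
  obtain b :: "nat \<Rightarrow> config" where b: "\<forall>l<k. b l \<in> Rinf"
    "\<forall>z\<in>Rinf. \<exists>u\<in>U. \<exists>a :: nat \<Rightarrow> real. \<forall>i. z i = u i + (\<Sum>l<k. a l *\<^sub>R b l i)"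
    using span unfolding spans_modulo_def by blast
  show ?thesis
    unfolding spans_modulo_def
  proof (intro exI[of _ "\<lambda>l. b l \<circ> inv \<pi>"] conjI ballI)
    show "\<forall>l<k. b l \<circ> inv \<pi> \<in> Rinf"
      using b(1) comp_in_Rinf[OF relabelling_inv[OF \<pi>]] by blast
    fix z assume "z \<in> Rinf"
    then have "z \<circ> \<pi> \<in> Rinf" by (rule comp_in_Rinf[OF \<pi>])
    then obtain u a where u: "u \<in> U" "\<forall>i. (z \<circ> \<pi>) i = u i + (\<Sum>l<k. a l *\<^sub>R b l i)"
      using b(2) by blast
    have "u \<circ> inv \<pi> \<in> relabel \<pi> U"
      using u(1) \<pi> by (simp add: relabel_def comp_assoc permutes_inv_o)
    moreover have "z i = (u \<circ> inv \<pi>) i + (\<Sum>l<k. a l *\<^sub>R (b l \<circ> inv \<pi>) i)" for i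
      using u(2)[rule_format, of "inv \<pi> i"] by (simp add: permutes_inverses[OF \<pi>])
    ultimately show "\<exists>u\<in>relabel \<pi> U. \<exists>a. \<forall>i. z i = u i + (\<Sum>l<k. a l *\<^sub>R (b l \<circ> inv \<pi>) i)"
      by (intro bexI[of _ "u \<circ> inv \<pi>"] exI[of _ a]) auto
  qed
qed

lemma codim_relabel:
  assumes \<pi>: "relabelling \<pi>"
  shows "codim (relabel \<pi> U) = codim U"
proof -
  have "spans_modulo (relabel \<pi> U) k \<longleftrightarrow> spans_modulo U k" for k
    using spans_modulo_relabel[OF \<pi>, of U k]
      spans_modulo_relabel[OF relabelling_inv[OF \<pi>], of "relabel \<pi> U" k]
    unfolding relabel_inv[OF \<pi>] by blast
  then show ?thesis by (simp add: codim_Least)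
qed

lemma alpha_relabel:
  assumes \<pi>: "relabelling \<pi>"
  shows "alpha M (relabel \<pi> U) n = alpha M U n"
proof -
  let ?P = "pieces M U"
  have P: "pieces M (relabel \<pi> U) = \<pi> ` ?P" by (rule pieces_relabel[OF \<pi>])
  have "bij_betw (\<lambda>f. restrict (f \<circ> \<pi>) ?P) (board_points M (relabel \<pi> U) n) (board_points M U n)"
  proof (rule bij_betwI[where g = "\<lambda>f. restrict (f \<circ> inv \<pi>) (\<pi> ` ?P)"])
    show "(\<lambda>f. restrict (f \<circ> \<pi>) ?P) \<in> board_points M (relabel \<pi> U) n \<rightarrow> board_points M U n"
    proof
      fix f assume f: "f \<in> board_points M (relabel \<pi> U) n"
      have "satisfies (edges M U) (point \<circ> f \<circ> \<pi>)"
        using f by (simp add: board_points_def satisfies_edges_relabel[OF \<pi>])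
      then have "satisfies (edges M U) (point \<circ> restrict (f \<circ> \<pi>) ?P)"
        by (subst satisfies_edges_cong[where w = "point \<circ> f \<circ> \<pi>"]) simp_all
      moreover have "f (\<pi> i) \<in> board n" if "i \<in> ?P" for i
        using f that by (auto simp: board_points_def P)
      ultimately show "restrict (f \<circ> \<pi>) ?P \<in> board_points M U n"
        by (simp add: board_points_def)
    qed
    show "(\<lambda>f. restrict (f \<circ> inv \<pi>) (\<pi> ` ?P)) \<in> board_points M U n \<rightarrow> board_points M (relabel \<pi> U) n"
    proof
      fix f assume f: "f \<in> board_points M U n"
      have "satisfies (edges M U) (point \<circ> restrict (f \<circ> inv \<pi>) (\<pi> ` ?P) \<circ> \<pi>)"
        using f by (subst satisfies_edges_cong[where w = "point \<circ> f"])
          (simp_all add: board_points_def permutes_inverses[OF \<pi>])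
      then have "satisfies (edges M (relabel \<pi> U)) (point \<circ> restrict (f \<circ> inv \<pi>) (\<pi> ` ?P))"
        by (simp add: satisfies_edges_relabel[OF \<pi>])
      moreover have "f (inv \<pi> i) \<in> board n" if "i \<in> \<pi> ` ?P" for i
        using f that by (auto simp: board_points_def permutes_inverses[OF \<pi>])
      ultimately show "restrict (f \<circ> inv \<pi>) (\<pi> ` ?P) \<in> board_points M (relabel \<pi> U) n"
        by (simp add: board_points_def P)
    qed
  next
    fix f assume "f \<in> board_points M (relabel \<pi> U) n"
    then have f: "f \<in> extensional (\<pi> ` ?P)" by (auto simp: board_points_def P PiE_iff)
    show "restrict (restrict (f \<circ> \<pi>) ?P \<circ> inv \<pi>) (\<pi> ` ?P) = f"
    proof
      fix i
      show "restrict (restrict (f \<circ> \<pi>) ?P \<circ> inv \<pi>) (\<pi> ` ?P) i = f i"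
        using f by (cases "i \<in> \<pi> ` ?P") (auto simp: extensional_def permutes_inverses[OF \<pi>])
    qed
  next
    fix f assume "f \<in> board_points M U n"
    then have f: "f \<in> extensional ?P" by (auto simp: board_points_def PiE_iff)
    show "restrict (restrict (f \<circ> inv \<pi>) (\<pi> ` ?P) \<circ> \<pi>) ?P = f"
    proof
      fix i
      show "restrict (restrict (f \<circ> inv \<pi>) (\<pi> ` ?P) \<circ> \<pi>) ?P i = f i"
        using f by (cases "i \<in> ?P") (auto simp: extensional_def permutes_inverses[OF \<pi>])
    qed
  qed
  then show ?thesis by (simp only: alpha_eq_card_board_points bij_betw_same_card)
qed

lemma gamma_bar_relabel:
  assumes \<pi>: "relabelling \<pi>"
  shows "gamma_bar M j (relabel \<pi> U) n = gamma_bar M j U n"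
  unfolding gamma_bar_def alpha_relabel[OF \<pi>] codim_relabel[OF \<pi>] card_pieces_relabel[OF \<pi>] ..

text \<open>The induction is on the number of elements above \<open>B\<close>, which also bounds the intervals
  that the recursion visits.\<close>

lemma moebius_mu_order_iso:
  assumes iso: "\<And>X Y. X \<in> L \<Longrightarrow> Y \<in> L \<Longrightarrow> F X \<subseteq> F Y \<longleftrightarrow> X \<subseteq> Y"
    and surj: "F ` L = L" and A: "A \<in> L" and B: "B \<in> L"
    and fin: "finite {C \<in> L. B \<subseteq> C}"
  shows "moebius_mu L (F A) (F B) = moebius_mu L A B"
  using B fin
proof (induction "card {C \<in> L. B \<subseteq> C}" arbitrary: B rule: less_induct)
  case less
  let ?I = "{C \<in> L. B \<subset> C \<and> C \<subseteq> A}" and ?J = "{C \<in> L. F B \<subset> C \<and> C \<subseteq> F A}"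
  have inj: "F X = F Y \<longleftrightarrow> X = Y" if "X \<in> L" "Y \<in> L" for X Y
    using iso[OF that] iso[OF that(2,1)] by auto
  have strict: "F X \<subset> F Y \<longleftrightarrow> X \<subset> Y" if "X \<in> L" "Y \<in> L" for X Y
    using iso[OF that] inj[OF that] by auto
  have J: "?J = F ` ?I"
  proof
    show "F ` ?I \<subseteq> ?J"
    proof (rule image_subsetI)
      fix C assume C: "C \<in> ?I"
      then have "C \<in> L" by blast
      moreover have "F C \<in> L" using surj \<open>C \<in> L\<close> by blast
      ultimately show "F C \<in> ?J"
        using C strict[OF less.prems(1) \<open>C \<in> L\<close>] iso[OF \<open>C \<in> L\<close> A] by simp
    qed
    show "?J \<subseteq> F ` ?I"
    proof
      fix D assume D: "D \<in> ?J"
      then obtain C where C: "C \<in> L" "D = F C" using surj by blast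
      then have "C \<in> ?I" using D strict[OF less.prems(1) C(1)] iso[OF C(1) A] by blast
      then show "D \<in> F ` ?I" using C(2) by blast
    qed
  qed
  have inj_I: "inj_on F ?I" by (rule inj_onI) (simp add: inj)
  have finI: "finite ?I" using less.prems(2) by (rule finite_subset[rotated]) blast
  have IH: "moebius_mu L (F A) (F C) = moebius_mu L A C" if C: "C \<in> ?I" for C
  proof (rule less.hyps)
    have "B \<in> {D \<in> L. B \<subseteq> D}" "B \<notin> {D \<in> L. C \<subseteq> D}" using C less.prems(1) by blast+
    moreover have sub: "{D \<in> L. C \<subseteq> D} \<subseteq> {D \<in> L. B \<subseteq> D}" using C by blast
    ultimately have "{D \<in> L. C \<subseteq> D} \<subset> {D \<in> L. B \<subseteq> D}" by blast
    then show "card {D \<in> L. C \<subseteq> D} < card {D \<in> L. B \<subseteq> D}"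
      by (rule psubset_card_mono[OF less.prems(2)])
    show "finite {D \<in> L. C \<subseteq> D}" using sub less.prems(2) by (rule finite_subset)
  qed (use C in blast)
  show ?case
  proof (cases "A = B")
    case True
    then show ?thesis by (simp add: moebius_mu.simps)
  next
    case False
    show ?thesis
    proof (cases "B \<subset> A")
      case True
      have "moebius_mu L (F A) (F B) = - (\<Sum>C\<in>?J. moebius_mu L (F A) C)"
        using True False strict[OF less.prems(1) A] inj[OF A less.prems(1)] finI
        by (subst moebius_mu.simps) (simp add: J)
      also have "\<dots> = - (\<Sum>C\<in>?I. moebius_mu L A C)"
        unfolding J sum.reindex[OF inj_I] using IH by simp
      also have "\<dots> = moebius_mu L A B"
        using True False finI by (subst (2) moebius_mu.simps) simp
      finally show ?thesis .
    next
      case not_sub: False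
      then show ?thesis
        using False strict[OF less.prems(1) A] inj[OF A less.prems(1)]
        by (subst (1 2) moebius_mu.simps) simp
    qed
  qed
qed

lemma moebius_mu_relabel:
  assumes \<pi>: "relabelling \<pi>" and U: "U \<in> intersections M" and fin: "finite M" "finite (pieces M U)"
  shows "moebius_mu (intersections M) Rinf (relabel \<pi> U) = moebius_mu (intersections M) Rinf U"
proof -
  have "moebius_mu (intersections M) (relabel \<pi> Rinf) (relabel \<pi> U) = moebius_mu (intersections M) Rinf U"
  proof (rule moebius_mu_order_iso)
    show "relabel \<pi> ` intersections M = intersections M"
    proof
      show "intersections M \<subseteq> relabel \<pi> ` intersections M"
      proof
        fix W assume "W \<in> intersections M"
        then have "relabel (inv \<pi>) W \<in> intersections M"
          by (rule relabel_in_intersections[OF relabelling_inv[OF \<pi>]])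
        then show "W \<in> relabel \<pi> ` intersections M"
          using relabel_inv(2)[OF \<pi>, of W] by (intro image_eqI[where x = "relabel (inv \<pi>) W"]) simp_all
      qed
    qed (use relabel_in_intersections[OF \<pi>] in blast)
    show "finite {C \<in> intersections M. U \<subseteq> C}"
      by (rule finite_subset[OF _ finite_intersections_on[OF fin]]) (use pieces_antimono in blast)
  qed (use relabel_subset_iff[OF \<pi>] U Rinf_in_intersections in simp_all)
  then show ?thesis by (simp add: relabel_Rinf[OF \<pi>])
qed

section \<open>The number of subspaces of a type\<close>

lemma extend_injection_to_permutation:
  assumes "finite P" "inj_on f P" "P \<subseteq> A" "f ` P \<subseteq> A"
  shows "\<exists>\<pi>. \<pi> permutes A \<and> (\<forall>i\<in>P. \<pi> i = f i)"
proof -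
  let ?Q = "f ` P"
  have "card ?Q = card P" by (rule card_image[OF assms(2)])
  then have "card (?Q - P) = card (P - ?Q)"
    using assms(1) by (simp add: card_Diff_subset_Int Int_commute)
  then obtain g where g: "bij_betw g (?Q - P) (P - ?Q)"
    using assms(1) finite_same_card_bij[of "?Q - P" "P - ?Q"] by blast
  define \<pi> where "\<pi> i = (if i \<in> P then f i else if i \<in> ?Q - P then g i else i)" for i
  have "bij_betw \<pi> P ?Q"
    using assms(2) by (rule bij_betw_cong[THEN iffD2, rotated, OF inj_on_imp_bij_betw]) (simp add: \<pi>_def)
  moreover have "bij_betw \<pi> (?Q - P) (P - ?Q)"
    using g by (rule bij_betw_cong[THEN iffD2, rotated]) (simp add: \<pi>_def)
  ultimately have "bij_betw \<pi> (P \<union> (?Q - P)) (?Q \<union> (P - ?Q))"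
    by (rule bij_betw_combine) blast
  then have "bij_betw \<pi> (P \<union> ?Q) (P \<union> ?Q)" by (simp add: Un_commute)
  then have "\<pi> permutes (P \<union> ?Q)" by (rule bij_imp_permutes) (simp add: \<pi>_def)
  then have "\<pi> permutes A" by (rule permutes_subset) (use assms in blast)
  then show ?thesis by (intro exI[of _ \<pi>]) (simp add: \<pi>_def)
qed

lemma equiv_same_type: "equiv UNIV same_type"
proof (rule equivI)
  show "refl same_type"
    unfolding same_type_def refl_on_def by (auto intro!: exI[of _ id] simp: permutes_id relabel_id)
  show "sym same_type"
  proof (rule symI)
    fix U W assume "(U, W) \<in> same_type"
    then obtain \<pi> where \<pi>: "relabelling \<pi>" "W = relabel \<pi> U" by (auto simp: same_type_def)
    then have "U = relabel (inv \<pi>) W" by (simp add: relabel_inv)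
    then show "(W, U) \<in> same_type" using relabelling_inv[OF \<pi>(1)] by (auto simp: same_type_def)
  qed
  show "trans same_type"
  proof (rule transI)
    fix U V W assume "(U, V) \<in> same_type" "(V, W) \<in> same_type"
    then obtain \<pi> \<rho> where "relabelling \<pi>" "V = relabel \<pi> U" "relabelling \<rho>" "W = relabel \<rho> V"
      by (auto simp: same_type_def)
    then have "W = relabel (\<rho> \<circ> \<pi>) U" "relabelling (\<rho> \<circ> \<pi>)"
      by (simp_all add: relabel_comp permutes_compose)
    then show "(U, W) \<in> same_type" by (auto simp: same_type_def)
  qed
qed simp

lemma relabel_cong:
  assumes U: "U \<in> intersections M" and "relabelling \<pi>" "relabelling \<sigma>"
    and eq: "\<And>i. i \<in> pieces M U \<Longrightarrow> \<pi> i = \<sigma> i"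
  shows "relabel \<pi> U = relabel \<sigma> U"
proof -
  have "z \<circ> \<pi> \<in> U \<longleftrightarrow> z \<circ> \<sigma> \<in> U" for z
  proof -
    have "satisfies (edges M U) (z \<circ> \<pi>) \<longleftrightarrow> satisfies (edges M U) (z \<circ> \<sigma>)"
      by (rule satisfies_edges_cong) (simp add: eq)
    moreover have "z \<circ> \<pi> \<in> Rinf \<longleftrightarrow> z \<circ> \<sigma> \<in> Rinf"
      using comp_in_Rinf_iff assms(2,3) by blast
    ultimately show ?thesis using intersection_eq_edges[OF U] by blast
  qed
  then show ?thesis by (simp add: relabel_def)
qed

lemma pieces_pos: "pieces M U \<subseteq> {0<..}"
  by (auto simp: pieces_def)

lemma card_Aut_pos:
  assumes "finite (pieces M U)"
  shows "card (Aut M U) > 0"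
proof -
  have "id \<in> Aut M U" by (simp add: Aut_def permutes_id relabel_id)
  moreover have "finite (Aut M U)"
    by (rule finite_subset[OF _ finite_permutations[OF assms]]) (auto simp: Aut_def)
  ultimately show ?thesis using card_gt_0_iff by blast
qed

text \<open>Each injection of the pieces of \<open>U\<close> into \<open>{1..n}\<close> extends to a relabelling and so produces a
  subspace of the type of \<open>U\<close>. Every subspace of this type with pieces in \<open>{1..n}\<close> arises, and it
  arises from one injection for each automorphism of \<open>U\<close>.\<close>

lemma card_subspaces_of_type:
  assumes U: "U \<in> intersections M" and fin: "finite (pieces M U)"
  shows "real (card {W. (U, W) \<in> same_type \<and> pieces M W \<subseteq> {1..n}}) * real (card (Aut M U)) =
    falling_factorial n (card (pieces M U))"
proof -
  let ?P = "pieces M U" and ?T = "{W. (U, W) \<in> same_type \<and> pieces M W \<subseteq> {1..n}}"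
  let ?I = "{f \<in> ?P \<rightarrow>\<^sub>E {1..n}. inj_on f ?P}"
  have "\<exists>\<pi>. relabelling \<pi> \<and> (\<forall>i\<in>?P. \<pi> i = f i)" if f: "f \<in> ?I" for f
  proof -
    have "f i \<in> {0<..}" if "i \<in> ?P" for i
      using PiE_mem[of f ?P "\<lambda>_. {1..n}" i] f that by simp
    then have "f ` ?P \<subseteq> {0<..}" by blast
    moreover have "inj_on f ?P" using f by blast
    ultimately show ?thesis
      by (intro extend_injection_to_permutation[OF fin] pieces_pos)
  qed
  then have "\<forall>f\<in>?I. \<exists>\<pi>. relabelling \<pi> \<and> (\<forall>i\<in>?P. \<pi> i = f i)" by blast
  from bchoice[OF this] obtain extn where *: "\<forall>f\<in>?I. relabelling (extn f) \<and> (\<forall>i\<in>?P. extn f i = f i)"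
    by (elim exE)
  have extn: "relabelling (extn f)" "i \<in> ?P \<Longrightarrow> extn f i = f i" if "f \<in> ?I" for f i
    using bspec[OF * that] by simp_all
  let ?\<Phi> = "\<lambda>f. relabel (extn f) U"
  have finI: "finite ?I"
    by (rule finite_subset[of _ "?P \<rightarrow>\<^sub>E {1..n}"]) (use fin in \<open>auto intro: finite_PiE\<close>)
  have \<Phi>T: "?\<Phi> f \<in> ?T" if f: "f \<in> ?I" for f
  proof -
    have "pieces M (?\<Phi> f) = f ` ?P"
      using pieces_relabel[OF extn(1)[OF f]] extn(2)[OF f] by (simp cong: image_cong)
    moreover have "f ` ?P \<subseteq> {1..n}" using f by blast
    moreover have "(U, ?\<Phi> f) \<in> same_type" using extn(1)[OF f] by (auto simp: same_type_def)
    ultimately show ?thesis by simp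
  qed
  have fibre: "card {f \<in> ?I. ?\<Phi> f = W} = card (Aut M U)" if W: "W \<in> ?T" for W
  proof -
    obtain \<rho> where \<rho>: "relabelling \<rho>" "W = relabel \<rho> U" using W by (auto simp: same_type_def)
    have range: "\<rho> ` ?P \<subseteq> {1..n}" using W pieces_relabel[OF \<rho>(1), of M U] \<rho>(2) by simp
    have AutD: "relabelling \<sigma>" "\<sigma> ` ?P = ?P" "relabel \<sigma> U = U" if "\<sigma> \<in> Aut M U" for \<sigma>
    proof -
      have \<sigma>: "\<sigma> permutes ?P" and "relabel \<sigma> U = U" using that by (simp_all add: Aut_def)
      then show "relabel \<sigma> U = U" by simp
      show "relabelling \<sigma>" by (rule permutes_subset[OF \<sigma> pieces_pos])
      show "\<sigma> ` ?P = ?P" by (rule permutes_image[OF \<sigma>])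
    qed
    have "bij_betw (\<lambda>\<sigma>. restrict (\<rho> \<circ> \<sigma>) ?P) (Aut M U) {f \<in> ?I. ?\<Phi> f = W}"
      unfolding bij_betw_def
    proof
      show "inj_on (\<lambda>\<sigma>. restrict (\<rho> \<circ> \<sigma>) ?P) (Aut M U)"
      proof (rule inj_onI)
        fix \<sigma> \<tau> assume \<sigma>: "\<sigma> \<in> Aut M U" and \<tau>: "\<tau> \<in> Aut M U"
          and eq: "restrict (\<rho> \<circ> \<sigma>) ?P = restrict (\<rho> \<circ> \<tau>) ?P"
        show "\<sigma> = \<tau>"
        proof
          fix i
          show "\<sigma> i = \<tau> i"
          proof (cases "i \<in> ?P")
            case True
            then have "\<rho> (\<sigma> i) = \<rho> (\<tau> i)" using fun_cong[OF eq, of i] by simp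
            then show ?thesis using permutes_inj[OF \<rho>(1)] by (simp add: inj_eq)
          next
            case False
            then show ?thesis
              using \<sigma> \<tau> permutes_not_in[of \<sigma> ?P i] permutes_not_in[of \<tau> ?P i] by (simp add: Aut_def)
          qed
        qed
      qed
      show "(\<lambda>\<sigma>. restrict (\<rho> \<circ> \<sigma>) ?P) ` Aut M U = {f \<in> ?I. ?\<Phi> f = W}"
      proof
        show "(\<lambda>\<sigma>. restrict (\<rho> \<circ> \<sigma>) ?P) ` Aut M U \<subseteq> {f \<in> ?I. ?\<Phi> f = W}"
        proof (rule image_subsetI)
          fix \<sigma> assume \<sigma>: "\<sigma> \<in> Aut M U"
          let ?f = "restrict (\<rho> \<circ> \<sigma>) ?P"
          have comp: "relabelling (\<rho> \<circ> \<sigma>)" by (rule permutes_compose[OF AutD(1)[OF \<sigma>] \<rho>(1)])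
          have "?f \<in> ?P \<rightarrow>\<^sub>E {1..n}"
          proof (rule restrict_PiE_iff[THEN iffD2], rule ballI)
            fix i assume "i \<in> ?P"
            then have "\<sigma> i \<in> ?P" using AutD(2)[OF \<sigma>] by blast
            then show "(\<rho> \<circ> \<sigma>) i \<in> {1..n}" using range by (simp only: comp_apply image_subset_iff)
          qed
          moreover have "inj_on ?f ?P"
            using permutes_inj_on[OF comp, of ?P] by (simp only: inj_on_restrict_eq)
          ultimately have f: "?f \<in> ?I" by blast
          have "?\<Phi> ?f = relabel (\<rho> \<circ> \<sigma>) U"
            by (rule relabel_cong[OF U extn(1)[OF f] comp]) (simp add: extn(2)[OF f])
          also have "\<dots> = W" using AutD(3)[OF \<sigma>] \<rho>(2) by (simp flip: relabel_comp)
          finally show "?f \<in> {f \<in> ?I. ?\<Phi> f = W}" using f by blast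
        qed
        show "{f \<in> ?I. ?\<Phi> f = W} \<subseteq> (\<lambda>\<sigma>. restrict (\<rho> \<circ> \<sigma>) ?P) ` Aut M U"
        proof
          fix f assume "f \<in> {f \<in> ?I. ?\<Phi> f = W}"
          then have f: "f \<in> ?I" and fW: "?\<Phi> f = W" by blast+
          \<comment> \<open>The relabellings to the same subspace \<open>W\<close> differ by a stabilizer of \<open>U\<close>, which restricts
            to an automorphism.\<close>
          define \<tau> where "\<tau> = inv \<rho> \<circ> extn f"
          have \<tau>: "relabelling \<tau>"
            unfolding \<tau>_def by (rule permutes_compose[OF extn(1)[OF f] relabelling_inv[OF \<rho>(1)]])
          have "relabel \<tau> U = relabel (inv \<rho>) (?\<Phi> f)" by (simp add: \<tau>_def relabel_comp)
          then have \<tau>U: "relabel \<tau> U = U" by (simp add: fW \<rho>(2) relabel_inv[OF \<rho>(1)])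
          then have \<tau>P: "\<tau> ` ?P = ?P" using pieces_relabel[OF \<tau>, of M U] by simp
          define \<sigma> where "\<sigma> i = (if i \<in> ?P then \<tau> i else i)" for i
          have "bij_betw \<sigma> ?P ?P"
            using \<tau>P permutes_inj[OF \<tau>] by (auto simp: bij_betw_def \<sigma>_def inj_on_def inj_def)
          then have \<sigma>: "\<sigma> permutes ?P" by (rule bij_imp_permutes) (simp add: \<sigma>_def)
          have "relabel \<sigma> U = relabel \<tau> U"
            by (rule relabel_cong[OF U permutes_subset[OF \<sigma> pieces_pos] \<tau>]) (simp add: \<sigma>_def)
          then have "\<sigma> \<in> Aut M U" using \<sigma> \<tau>U by (simp add: Aut_def)
          moreover have "f = restrict (\<rho> \<circ> \<sigma>) ?P"
          proof
            fix i
            show "f i = restrict (\<rho> \<circ> \<sigma>) ?P i"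
            proof (cases "i \<in> ?P")
              case True
              then show ?thesis
                using extn(2)[OF f True] by (simp add: \<sigma>_def \<tau>_def permutes_inverses[OF \<rho>(1)])
            next
              case False
              then show ?thesis using f by (auto simp: PiE_iff extensional_def)
            qed
          qed
          ultimately show "f \<in> (\<lambda>\<sigma>. restrict (\<rho> \<circ> \<sigma>) ?P) ` Aut M U" by blast
        qed
      qed
    qed
    from bij_betw_same_card[OF this] show ?thesis by simp
  qed
  have T_image: "?T \<subseteq> ?\<Phi> ` ?I"
  proof
    fix W assume W: "W \<in> ?T"
    have "{f \<in> ?I. ?\<Phi> f = W} \<noteq> {}"
      using fibre[OF W] card_Aut_pos[OF fin] by (metis card.empty less_numeral_extra(3))
    then show "W \<in> ?\<Phi> ` ?I" by blast
  qed
  then have finT: "finite ?T" using finI by (meson finite_imageI finite_subset)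
  have "card ?I = (\<Sum>W\<in>?T. card {f \<in> ?I. ?\<Phi> f = W})"
    unfolding card_eq_sum by (rule sum.group[symmetric, OF finI finT]) (use \<Phi>T in blast)
  also have "\<dots> = card ?T * card (Aut M U)" using fibre by simp
  finally have "real (card ?T) * real (card (Aut M U)) = real (card ?I)" by simp
  then show ?thesis using card_injections[OF fin, of "{1..n}"] by simp
qed

text \<open>Orbit counting: a quantity that does not change under relabelling is summed over the subspaces
  within \<open>{1..n}\<close> type by type. The value at the chosen representative \<open>SOME U. U \<in> T\<close> is the common
  value on \<open>T\<close>.\<close>

theorem sum_over_types:
  fixes F :: "config set \<Rightarrow> real"
  assumes M: "finite M" and \<kappa>: "\<kappa> > 0"
    and inv: "\<And>\<pi> U. relabelling \<pi> \<Longrightarrow> U \<in> intersections M \<Longrightarrow> finite (pieces M U) \<Longrightarrow> F (relabel \<pi> U) = F U"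
  shows "(\<Sum>U \<in> {U \<in> intersections M. card (pieces M U) = \<kappa> \<and> codim U = \<nu> \<and> pieces M U \<subseteq> {1..n}}. F U) =
    falling_factorial n \<kappa> * (\<Sum>T \<in> subspace_types M \<kappa> \<nu>.
      let U = (SOME U. U \<in> T) in 1 / real (card (Aut M U)) * F U)"
proof -
  let ?S = "{U \<in> intersections M. card (pieces M U) = \<kappa> \<and> codim U = \<nu>}"
  let ?W = "{U \<in> intersections M. card (pieces M U) = \<kappa> \<and> codim U = \<nu> \<and> pieces M U \<subseteq> {1..n}}"
  let ?Ts = "subspace_types M \<kappa> \<nu>"
  have finP: "finite (pieces M U)" if "U \<in> ?S" for U
    using that \<kappa> by (intro card_ge_0_finite) simp
  have closed: "W \<in> ?S" if "U \<in> ?S" "(U, W) \<in> same_type" for U W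
    using that relabel_in_intersections card_pieces_relabel codim_relabel by (auto simp: same_type_def)
  have TsE: "\<exists>U\<in>?S. T = same_type `` {U}" if "T \<in> ?Ts" for T
    using that unfolding subspace_types_def by (rule quotientE) blast
  have T_sub: "T \<subseteq> ?S" if T: "T \<in> ?Ts" for T
  proof
    fix W assume W: "W \<in> T"
    obtain U where U: "U \<in> ?S" "T = same_type `` {U}" using TsE[OF T] by blast
    then show "W \<in> ?S" using W closed by blast
  qed
  have fin_on: "finite {U \<in> intersections M. pieces M U \<subseteq> {1..k}}" for k
    by (rule finite_intersections_on[OF M]) simp
  have finTs: "finite ?Ts"
  proof (rule finite_subset)
    show "finite ((\<lambda>U. same_type `` {U}) ` {U \<in> intersections M. pieces M U \<subseteq> {1..\<kappa>}})"
      using fin_on by (rule finite_imageI)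
    show "?Ts \<subseteq> (\<lambda>U. same_type `` {U}) ` {U \<in> intersections M. pieces M U \<subseteq> {1..\<kappa>}}"
    proof
      fix T assume "T \<in> ?Ts"
      then obtain U where U: "U \<in> ?S" "T = same_type `` {U}" using TsE by blast
      \<comment> \<open>Only finitely many types exist, because each has a representative with pieces \<open>{1..\<kappa>}\<close>.\<close>
      then obtain h where h: "bij_betw h (pieces M U) {1..\<kappa>}"
        using finite_same_card_bij[OF finP[OF U(1)], of "{1..\<kappa>}"] by auto
      have "inj_on h (pieces M U)" "h ` pieces M U \<subseteq> {0<..}" using h by (auto simp: bij_betw_def)
      then obtain \<pi> where \<pi>: "relabelling \<pi>" "\<And>i. i \<in> pieces M U \<Longrightarrow> \<pi> i = h i"
        using extend_injection_to_permutation[OF finP[OF U(1)] _ pieces_pos, of h] by blast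
      have "pieces M (relabel \<pi> U) = h ` pieces M U"
        using pieces_relabel[OF \<pi>(1)] \<pi>(2) by (simp cong: image_cong)
      then have "pieces M (relabel \<pi> U) = {1..\<kappa>}" using h by (simp add: bij_betw_def)
      moreover have "(U, relabel \<pi> U) \<in> same_type" using \<pi>(1) by (auto simp: same_type_def)
      then have "T = same_type `` {relabel \<pi> U}"
        unfolding U(2) using equiv_class_eq[OF equiv_same_type] by blast
      moreover have "relabel \<pi> U \<in> intersections M" using relabel_in_intersections[OF \<pi>(1)] U(1) by blast
      ultimately show "T \<in> (\<lambda>U. same_type `` {U}) ` {U \<in> intersections M. pieces M U \<subseteq> {1..\<kappa>}}"
        by blast
    qed
  qed
  have finT: "finite {W \<in> T. pieces M W \<subseteq> {1..n}}" if "T \<in> ?Ts" for T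
    by (rule finite_subset[OF _ fin_on[of n]]) (use T_sub[OF that] in blast)
  have W_eq: "?W = (\<Union>T\<in>?Ts. {W \<in> T. pieces M W \<subseteq> {1..n}})"
  proof
    show "?W \<subseteq> (\<Union>T\<in>?Ts. {W \<in> T. pieces M W \<subseteq> {1..n}})"
    proof
      fix U assume U: "U \<in> ?W"
      then have "same_type `` {U} \<in> ?Ts" unfolding subspace_types_def by (intro quotientI) simp
      moreover have "U \<in> same_type `` {U}" using equiv_class_self[OF equiv_same_type] by blast
      ultimately show "U \<in> (\<Union>T\<in>?Ts. {W \<in> T. pieces M W \<subseteq> {1..n}})" using U by blast
    qed
    show "(\<Union>T\<in>?Ts. {W \<in> T. pieces M W \<subseteq> {1..n}}) \<subseteq> ?W" using T_sub by blast
  qed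
  have disj: "\<forall>S\<in>?Ts. \<forall>T\<in>?Ts. S \<noteq> T \<longrightarrow> {W \<in> S. pieces M W \<subseteq> {1..n}} \<inter> {W \<in> T. pieces M W \<subseteq> {1..n}} = {}"
  proof (intro ballI impI)
    fix S T assume "S \<in> ?Ts" "T \<in> ?Ts" "S \<noteq> T"
    then have "S \<in> UNIV // same_type" "T \<in> UNIV // same_type"
      unfolding subspace_types_def quotient_def by blast+
    then have "S \<inter> T = {}" using quotient_disj[OF equiv_same_type] \<open>S \<noteq> T\<close> by blast
    then show "{W \<in> S. pieces M W \<subseteq> {1..n}} \<inter> {W \<in> T. pieces M W \<subseteq> {1..n}} = {}" by blast
  qed
  have "sum F ?W = (\<Sum>T\<in>?Ts. sum F {W \<in> T. pieces M W \<subseteq> {1..n}})"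
    unfolding W_eq by (rule sum.UNION_disjoint[OF finTs ballI[OF finT] disj])
  also have "\<dots> = (\<Sum>T\<in>?Ts. falling_factorial n \<kappa> * (let U = (SOME U. U \<in> T) in 1 / real (card (Aut M U)) * F U))"
  proof (rule sum.cong[OF refl])
    fix T assume T: "T \<in> ?Ts"
    define U where "U = (SOME U. U \<in> T)"
    obtain V where V: "V \<in> ?S" "T = same_type `` {V}" using TsE[OF T] by blast
    then have "V \<in> T" using equiv_class_self[OF equiv_same_type] by blast
    then have UT: "U \<in> T" unfolding U_def by (rule someI[of "\<lambda>U. U \<in> T"])
    then have TU: "T = same_type `` {U}"
      unfolding V(2) using equiv_class_eq[OF equiv_same_type] by blast
    have US: "U \<in> ?S" using T_sub[OF T] UT by blast
    have const: "F W = F U" if "W \<in> T" for W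
      using that inv[OF _ _ finP[OF US]] US unfolding TU same_type_def by auto
    have set_eq: "{W \<in> T. pieces M W \<subseteq> {1..n}} = {W. (U, W) \<in> same_type \<and> pieces M W \<subseteq> {1..n}}"
      unfolding TU by blast
    have "real (card {W \<in> T. pieces M W \<subseteq> {1..n}}) * real (card (Aut M U)) = falling_factorial n \<kappa>"
      unfolding set_eq using card_subspaces_of_type[OF _ finP[OF US]] US by simp
    then have "real (card {W \<in> T. pieces M W \<subseteq> {1..n}}) = falling_factorial n \<kappa> * (1 / real (card (Aut M U)))"
      using card_Aut_pos[OF finP[OF US]] by (simp add: field_simps)
    moreover have "sum F {W \<in> T. pieces M W \<subseteq> {1..n}} = real (card {W \<in> T. pieces M W \<subseteq> {1..n}}) * F U"
      using const by simp
    ultimately show "sum F {W \<in> T. pieces M W \<subseteq> {1..n}} =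
        falling_factorial n \<kappa> * (let U = (SOME U. U \<in> T) in 1 / real (card (Aut M U)) * F U)"
      unfolding Let_def U_def[symmetric] by simp
  qed
  finally show ?thesis by (simp add: sum_distrib_left)
qed

section \<open>The counting formula\<close>

lemma pieces_eq_empty_iff:
  assumes "U \<in> intersections M" and nz: "\<And>m. m \<in> M \<Longrightarrow> m \<noteq> (0, 0)"
  shows "pieces M U = {} \<longleftrightarrow> U = Rinf"
proof
  assume "pieces M U = {}"
  then have "edges M U = {}" using edges_pieces by fast
  then show "U = Rinf" using intersection_eq_edges[OF assms(1)] by (simp add: satisfies_def)
next
  assume U: "U = Rinf"
  show "pieces M U = {}"
  proof (rule ccontr)
    assume "pieces M U \<noteq> {}"
    then obtain m i j where "m \<in> M" "i > 0" "j \<noteq> i" "Rinf \<subseteq> hyp m i j"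
      unfolding U by (auto simp: pieces_def)
    then show False using hyp_proper[of m i j] nz by blast
  qed
qed

lemma alpha_Rinf:
  assumes nz: "\<And>m. m \<in> M \<Longrightarrow> m \<noteq> (0, 0)"
  shows "alpha M Rinf n = 1"
proof -
  have P: "pieces M Rinf = {}" using pieces_eq_empty_iff[OF Rinf_in_intersections nz] by blast
  then have "edges M Rinf = {}" using edges_pieces by fast
  then show ?thesis by (simp add: alpha_eq_card_board_points board_points_def P satisfies_def)
qed

lemma moebius_mu_self: "moebius_mu L A A = 1"
  by (simp add: moebius_mu.simps)

lemma two_le_card_pieces:
  assumes "finite (pieces M U)" "pieces M U \<noteq> {}"
  shows "2 \<le> card (pieces M U)"
proof -
  obtain m i j where e: "(m, i, j) \<in> edges M U" using assms(2) by (auto simp: pieces_edges)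
  have "{i, j} \<subseteq> pieces M U" "i \<noteq> j" using edges_pieces[OF e] by simp_all
  then show ?thesis using card_mono[OF assms(1), of "{i, j}"] by simp
qed

lemma codim_bounds:
  assumes U: "U \<in> intersections M" "finite (pieces M U)" "pieces M U \<noteq> {}"
    and nz: "\<And>m. m \<in> M \<Longrightarrow> m \<noteq> (0, 0)"
  shows "card (pieces M U) \<le> 2 * codim U" "codim U \<le> 2 * card (pieces M U) - 2"
proof -
  have "spans_modulo U (codim U)"
    by (rule codim_le_of_determining(1)[OF U(1,2), of "{}"])
      (use satisfies_const[of "edges M U" "(0, 0)"] in \<open>auto simp: of_coord_def intro!: exI[of _ "\<lambda>_. 0"]\<close>)
  then show "card (pieces M U) \<le> 2 * codim U" using codim_lower_bound[OF U(1,2)] nz by blast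
  show "codim U \<le> 2 * card (pieces M U) - 2" by (rule codim_upper_bound[OF U])
qed

text \<open>The monomial of \<open>gamma_bar M j U\<close> in \<open>alpha M U n\<close> has degree \<open>2 * \<kappa> - codim U - j\<close>; the factor for
  the free pieces raises it to \<open>2 * n - i\<close> with \<open>i = codim U + j\<close>.\<close>

lemma alpha_expansion:
  assumes U: "U \<in> intersections M" "pieces M U \<subseteq> {1..n}" "pieces M U \<noteq> {}"
    and M: "finite M" "\<And>m. m \<in> M \<Longrightarrow> m \<noteq> (0, 0)" and n: "n \<ge> 1"
  shows "real (alpha M U n) * real n ^ (2 * (n - card (pieces M U))) =
    (\<Sum>i = 1..2 * n. real n ^ (2 * n - i) * (if codim U \<le> i then gamma_bar M (i - codim U) U n else 0))"
proof -
  let ?\<kappa> = "card (pieces M U)" and ?\<nu> = "codim U" and ?g = "\<lambda>j. gamma_bar M j U n"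
  have fin: "finite (pieces M U)" using U(2) finite_subset by blast
  have \<kappa>n: "?\<kappa> \<le> n" using card_mono[OF _ U(2)] by simp
  note \<nu> = codim_bounds[OF U(1) fin U(3) M(2)]
  have \<kappa>2: "2 \<le> ?\<kappa>" by (rule two_le_card_pieces[OF fin U(3)])
  define D where "D = 2 * ?\<kappa> - ?\<nu>"
  have coeffs: "is_quasipoly_coeffs (\<lambda>n. real (alpha M U n)) D (\<lambda>j. gamma_bar M j U)"
    unfolding D_def by (rule gamma_bar_coeffs[OF U(1) M(1) fin U(3)])
  have "real (alpha M U n) * real n ^ (2 * (n - ?\<kappa>)) = (\<Sum>j\<le>D. ?g j * real n ^ (D - j)) * real n ^ (2 * (n - ?\<kappa>))"
    using coeffs n by (simp add: is_quasipoly_coeffs_def)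
  also have "\<dots> = (\<Sum>j\<le>D. real n ^ (2 * n - (?\<nu> + j)) * ?g j)"
    unfolding sum_distrib_right
  proof (rule sum.cong[OF refl])
    fix j assume "j \<in> {..D}"
    then have "D - j + 2 * (n - ?\<kappa>) = 2 * n - (?\<nu> + j)" using \<kappa>n \<nu> \<kappa>2 by (simp add: D_def)
    then have "real n ^ (D - j) * real n ^ (2 * (n - ?\<kappa>)) = real n ^ (2 * n - (?\<nu> + j))"
      by (simp flip: power_add)
    then show "?g j * real n ^ (D - j) * real n ^ (2 * (n - ?\<kappa>)) = real n ^ (2 * n - (?\<nu> + j)) * ?g j"
      by simp
  qed
  also have "\<dots> = (\<Sum>j\<le>2 * n - ?\<nu>. real n ^ (2 * n - (?\<nu> + j)) * ?g j)"
  proof (rule sum.mono_neutral_left)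
    show "{..D} \<subseteq> {..2 * n - ?\<nu>}" using \<kappa>n by (auto simp: D_def)
    show "\<forall>j\<in>{..2 * n - ?\<nu>} - {..D}. real n ^ (2 * n - (?\<nu> + j)) * ?g j = 0"
      using coeffs by (simp add: is_quasipoly_coeffs_def)
  qed simp
  also have "\<dots> = (\<Sum>i = ?\<nu>..2 * n. real n ^ (2 * n - i) * ?g (i - ?\<nu>))"
  proof (rule sum.reindex_bij_witness[of _ "\<lambda>i. i - ?\<nu>" "\<lambda>j. ?\<nu> + j"])
  qed (use \<nu> \<kappa>n in auto)
  also have "\<dots> = (\<Sum>i = 1..2 * n. real n ^ (2 * n - i) * (if ?\<nu> \<le> i then ?g (i - ?\<nu>) else 0))"
    using \<nu>(1) \<kappa>2 by (intro sum.mono_neutral_cong_left) auto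
  finally show ?thesis .
qed

text \<open>The bounds on the codimension show that no subspace falls outside the ranges of \<open>\<kappa>\<close> and \<open>\<nu>\<close>.\<close>

lemma group_by_type:
  assumes "rider M"
  shows "(\<Sum>U \<in> {U \<in> intersections M. pieces M U \<subseteq> {1..n} \<and> pieces M U \<noteq> {} \<and> codim U \<le> i}.
      of_int (moebius_mu (intersections M) Rinf U) * gamma_bar M (i - codim U) U n) =
    (\<Sum>\<kappa> = 2..2 * i. falling_factorial n \<kappa> *
       (\<Sum>\<nu> = nat \<lceil>real \<kappa> / 2\<rceil>..min i (2 * \<kappa> - 2).
         \<Sum>T \<in> subspace_types M \<kappa> \<nu>.
           let U = (SOME U. U \<in> T) in
             of_int (moebius_mu (intersections M) Rinf U) * (1 / real (card (Aut M U)))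
               * gamma_bar M (i - \<nu>) U n))"
proof -
  let ?S = "{U \<in> intersections M. pieces M U \<subseteq> {1..n} \<and> pieces M U \<noteq> {} \<and> codim U \<le> i}"
  let ?W = "\<lambda>\<kappa> \<nu>. {U \<in> intersections M. card (pieces M U) = \<kappa> \<and> codim U = \<nu> \<and> pieces M U \<subseteq> {1..n}}"
  let ?F = "\<lambda>j U. of_int (moebius_mu (intersections M) Rinf U) * gamma_bar M j U n"
  have M: "finite M" "\<And>m. m \<in> M \<Longrightarrow> m \<noteq> (0, 0)" using assms by (auto simp: rider_def)
  let ?R = "SIGMA \<kappa>:{2..2 * i}. {nat \<lceil>real \<kappa> / 2\<rceil>..min i (2 * \<kappa> - 2)}"
  have finS: "finite ?S"
    by (rule finite_subset[OF _ finite_intersections_on[OF M(1), of "{1..n}"]]) auto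
  have "(card (pieces M U), codim U) \<in> ?R" if U: "U \<in> ?S" for U
  proof -
    have fin: "finite (pieces M U)" using U finite_subset[of _ "{1..n}"] by blast
    have "2 \<le> card (pieces M U)" by (rule two_le_card_pieces[OF fin]) (use U in blast)
    moreover have "card (pieces M U) \<le> 2 * codim U" "codim U \<le> 2 * card (pieces M U) - 2"
      using codim_bounds[of U M] fin U M(2) by blast+
    moreover have "nat \<lceil>real (card (pieces M U)) / 2\<rceil> \<le> codim U"
      using \<open>card (pieces M U) \<le> 2 * codim U\<close> by (simp add: nat_le_iff ceiling_le_iff)
    ultimately show ?thesis using U by simp
  qed
  then have sub: "(\<lambda>U. (card (pieces M U), codim U)) ` ?S \<subseteq> ?R" by blast
  have "(\<Sum>U\<in>?S. ?F (i - codim U) U) =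
      (\<Sum>y\<in>?R. \<Sum>U\<in>{U \<in> ?S. (card (pieces M U), codim U) = y}. ?F (i - codim U) U)"
    by (rule sum.group[symmetric, OF finS _ sub]) simp
  also have "\<dots> = (\<Sum>(\<kappa>, \<nu>)\<in>?R. falling_factorial n \<kappa> *
       (\<Sum>T \<in> subspace_types M \<kappa> \<nu>. let U = (SOME U. U \<in> T) in
             of_int (moebius_mu (intersections M) Rinf U) * (1 / real (card (Aut M U)))
               * gamma_bar M (i - \<nu>) U n))"
  proof (rule sum.cong[OF refl])
    fix y assume y: "y \<in> ?R"
    obtain \<kappa> \<nu> where \<kappa>\<nu>: "y = (\<kappa>, \<nu>)" by (cases y)
    have le: "\<kappa> > 0" "\<nu> \<le> i" using y by (auto simp: \<kappa>\<nu>)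
    have "{U \<in> ?S. (card (pieces M U), codim U) = y} = ?W \<kappa> \<nu>" using le by (auto simp: \<kappa>\<nu>)
    then have "(\<Sum>U\<in>{U \<in> ?S. (card (pieces M U), codim U) = y}. ?F (i - codim U) U) =
        (\<Sum>U\<in>?W \<kappa> \<nu>. ?F (i - \<nu>) U)" by simp
    also have "\<dots> = falling_factorial n \<kappa> * (\<Sum>T \<in> subspace_types M \<kappa> \<nu>.
        let U = (SOME U. U \<in> T) in 1 / real (card (Aut M U)) * ?F (i - \<nu>) U)"
      by (rule sum_over_types[OF M(1) le(1)]) (simp add: moebius_mu_relabel[OF _ _ M(1)] gamma_bar_relabel)
    finally show "(\<Sum>U\<in>{U \<in> ?S. (card (pieces M U), codim U) = y}. ?F (i - codim U) U) =
      (case y of (\<kappa>, \<nu>) \<Rightarrow> falling_factorial n \<kappa> *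
       (\<Sum>T \<in> subspace_types M \<kappa> \<nu>. let U = (SOME U. U \<in> T) in
             of_int (moebius_mu (intersections M) Rinf U) * (1 / real (card (Aut M U)))
               * gamma_bar M (i - \<nu>) U n))"
      by (simp add: \<kappa>\<nu> Let_def mult_ac)
  qed
  also have "\<dots> = (\<Sum>\<kappa> = 2..2 * i. \<Sum>\<nu> = nat \<lceil>real \<kappa> / 2\<rceil>..min i (2 * \<kappa> - 2). falling_factorial n \<kappa> *
       (\<Sum>T \<in> subspace_types M \<kappa> \<nu>. let U = (SOME U. U \<in> T) in
             of_int (moebius_mu (intersections M) Rinf U) * (1 / real (card (Aut M U)))
               * gamma_bar M (i - \<nu>) U n))"
    by (rule sum.Sigma[symmetric]) simp_all
  finally show ?thesis by (simp only: sum_distrib_left)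
qed

text \<open>The whole space is the only intersection subspace without pieces, and it contributes
  \<open>n ^ (2 * n)\<close>.\<close>

theorem theorem7p1:
  fixes M :: "(int \<times> int) set" and n :: nat
  assumes "rider M" and "n \<ge> 1"
  shows "real (nonattacking_count M n n) =
    1 / fact n *
    (real n ^ (2 * n) +
     (\<Sum>i = 1..2 * n. real n ^ (2 * n - i) *
       (\<Sum>\<kappa> = 2..2 * i. falling_factorial n \<kappa> *
         (\<Sum>\<nu> = nat \<lceil>real \<kappa> / 2\<rceil>..min i (2 * \<kappa> - 2).
           \<Sum>T \<in> subspace_types M \<kappa> \<nu>.
             let U = (SOME U. U \<in> T) in
               of_int (moebius_mu (intersections M) Rinf U) * (1 / real (card (Aut M U)))
                 * gamma_bar M (i - \<nu>) U n))))"
proof -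
  let ?L = "{U \<in> intersections M. pieces M U \<subseteq> {1..n}}"
  let ?L' = "{U \<in> intersections M. pieces M U \<subseteq> {1..n} \<and> pieces M U \<noteq> {}}"
  let ?\<mu> = "\<lambda>U. real_of_int (moebius_mu (intersections M) Rinf U)"
  let ?t = "\<lambda>U. real (alpha M U n) * real n ^ (2 * (n - card (pieces M U)))"
  have M: "finite M" "\<And>m. m \<in> M \<Longrightarrow> m \<noteq> (0, 0)" using assms(1) by (auto simp: rider_def)
  have finL: "finite ?L" by (rule finite_intersections_on[OF M(1)]) simp
  then have finL': "finite ?L'" by (rule finite_subset[rotated]) auto
  have P0: "pieces M Rinf = {}" using pieces_eq_empty_iff[OF Rinf_in_intersections M(2)] by blast
  have L: "?L = insert Rinf ?L'"
  proof
    show "?L \<subseteq> insert Rinf ?L'" using pieces_eq_empty_iff[OF _ M(2)] by blast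
    show "insert Rinf ?L' \<subseteq> ?L" using P0 Rinf_in_intersections by auto
  qed
  have "fact n * real (nonattacking_count M n n) = (\<Sum>U\<in>?L. ?\<mu> U * ?t U)"
    by (rule labelled_count_by_subspaces[OF assms(1)])
  also have "\<dots> = ?\<mu> Rinf * ?t Rinf + (\<Sum>U\<in>?L'. ?\<mu> U * ?t U)"
    unfolding L by (rule sum.insert[OF finL']) (simp add: P0)
  also have "?\<mu> Rinf * ?t Rinf = real n ^ (2 * n)"
    by (simp add: moebius_mu_self alpha_Rinf[OF M(2)] P0)
  also have "(\<Sum>U\<in>?L'. ?\<mu> U * ?t U) =
      (\<Sum>U\<in>?L'. \<Sum>i = 1..2 * n. real n ^ (2 * n - i) * (if codim U \<le> i then ?\<mu> U * gamma_bar M (i - codim U) U n else 0))"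
  proof (rule sum.cong[OF refl])
    fix U assume "U \<in> ?L'"
    then have "?t U = (\<Sum>i = 1..2 * n. real n ^ (2 * n - i) * (if codim U \<le> i then gamma_bar M (i - codim U) U n else 0))"
      by (intro alpha_expansion M assms(2)) simp_all
    then have "?\<mu> U * ?t U = (\<Sum>i = 1..2 * n. ?\<mu> U * (real n ^ (2 * n - i) * (if codim U \<le> i then gamma_bar M (i - codim U) U n else 0)))"
      by (simp only: sum_distrib_left)
    also have "\<dots> = (\<Sum>i = 1..2 * n. real n ^ (2 * n - i) * (if codim U \<le> i then ?\<mu> U * gamma_bar M (i - codim U) U n else 0))"
      by (intro sum.cong) auto
    finally show "?\<mu> U * ?t U = \<dots>" .
  qed
  also have "\<dots> = (\<Sum>i = 1..2 * n. \<Sum>U\<in>?L'. real n ^ (2 * n - i) * (if codim U \<le> i then ?\<mu> U * gamma_bar M (i - codim U) U n else 0))"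
    by (rule sum.swap)
  also have "\<dots> = (\<Sum>i = 1..2 * n. real n ^ (2 * n - i) *
      (\<Sum>U\<in>{U \<in> intersections M. pieces M U \<subseteq> {1..n} \<and> pieces M U \<noteq> {} \<and> codim U \<le> i}.
        ?\<mu> U * gamma_bar M (i - codim U) U n))"
  proof (rule sum.cong[OF refl])
    fix i
    have "{U \<in> ?L'. codim U \<le> i} = {U \<in> intersections M. pieces M U \<subseteq> {1..n} \<and> pieces M U \<noteq> {} \<and> codim U \<le> i}"
      by blast
    then show "(\<Sum>U\<in>?L'. real n ^ (2 * n - i) * (if codim U \<le> i then ?\<mu> U * gamma_bar M (i - codim U) U n else 0)) =
      real n ^ (2 * n - i) * (\<Sum>U\<in>{U \<in> intersections M. pieces M U \<subseteq> {1..n} \<and> pieces M U \<noteq> {} \<and> codim U \<le> i}.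
        ?\<mu> U * gamma_bar M (i - codim U) U n)"
      by (simp only: sum_distrib_left[symmetric] sum.inter_filter[OF finL', symmetric])
  qed
  finally have "fact n * real (nonattacking_count M n n) = real n ^ (2 * n) + \<dots>" .
  moreover have "x = 1 / fact n * y" if "fact n * x = y" for x y :: real
    using that by auto
  ultimately show ?thesis
    unfolding group_by_type[OF assms(1)] by blast
qed

end
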